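(* Let $0<s<1$, $\nu=\frac{1-s^2}{2s}$, $\alpha=\frac{1+s^2}{4s}$, and let $n\ge 0$ be an integer. For $f\in\mathcal{X}_s(\mathbb{C})$ define $$[\mathscr{W}^s_nf](z,\overline{z})=\frac{\nu}{\pi}\left(\frac{\nu^n}{n!}\right)^{1/2}e^{-\alpha z^2}\int_{\mathbb{C}}e^{-\nu|\xi|^2+\alpha\xi^2+\nu\overline{\xi}z}(\overline{z}-\overline{\xi})^nf(\xi)\,d\lambda(\xi),\qquad z\in\mathbb{C}.$$ Then $\mathscr{W}^s_n$ is a unitary operator from $\mathcal{X}_s(\mathbb{C})$ onto $\mathcal{X}_{n,s}(\mathbb{C})$. Moreover, the functions $$\psi^s_{m,n}(z,\overline{z})=\left(\frac{1-s}{\pi\nu^nn!\sqrt{s}}\right)^{1/2}\left(\frac{1-s}{1+s}\right)^{m/2}\frac{e^{-z^2/2}}{\sqrt{2^mm!}}\left(\nabla^n_{\nu,\alpha-\frac12}H_m\right)(z),\qquad m=0,1,2,\dots,$$ form an orthonormal basis of $\mathcal{X}_{n,s}(\mathbb{C})$.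
   Context: $d\lambda$ is Lebesgue measure on $\mathbb{C}\equiv\mathbb{R}^2$; $\partial_z,\partial_{\overline z}$ are the Wirtinger derivatives. Throughout $0<s<1$, $\nu=\frac{1-s^2}{2s}$, $\alpha=\frac{1+s^2}{4s}$. Put $\omega_s(z)=e^{\alpha(z^2+\overline{z}^2)-\nu|z|^2}$. $\mathcal{X}_s(\mathbb{C})$ is the Hilbert space of entire functions belonging to $L^2(\mathbb{C},\omega_s\,d\lambda)$, with the inner product of that space. Let $\Delta_\nu=-\partial_z\partial_{\overline z}+\nu\overline{z}\,\partial_{\overline z}$, and let $\mathcal{F}^{2,\nu}_n(\mathbb{C})=\{F\in L^2(\mathbb{C},e^{-\nu|z|^2}d\lambda):\Delta_\nu F=n\nu F\}$ (such eigenfunctions are smooth by ellipticity). Then $\mathcal{X}_{n,s}(\mathbb{C})=\{z\mapsto e^{-\alpha z^2}F(z):F\in\mathcal{F}^{2,\nu}_n(\mathbb{C})\}$, a subspace of $L^2(\mathbb{C},\omega_s\,d\lambda)$ with its inner product. For a complex-plane smooth function $g$ and $\gamma\in\mathbb{R}$, $\nabla_{\nu,\gamma}g=-\partial_zg+\nu\overline{z}g-2\gamma zg$, and $\nabla^n_{\nu,\gamma}$ is its $n$-th iterate. $H_m$ is the (physicists') Hermite polynomial in the complex variable $z$: $H_m(z)=m!\sum_{k=0}^{\lfloor m/2\rfloor}\frac{(-1)^k}{k!}\frac{(2z)^{m-2k}}{(m-2k)!}$. *)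

theory Defs
  imports "HOL-Analysis.Analysis"
begin

subsection \<open>Wirtinger derivatives and smooth functions on the plane\<close>

definition wirt :: "(complex \<Rightarrow> complex) \<Rightarrow> complex \<Rightarrow> complex" where
  "wirt g z = (frechet_derivative g (at z) 1 - \<i> * frechet_derivative g (at z) \<i>) / 2"

definition wirt_bar :: "(complex \<Rightarrow> complex) \<Rightarrow> complex \<Rightarrow> complex" where
  "wirt_bar g z = (frechet_derivative g (at z) 1 + \<i> * frechet_derivative g (at z) \<i>) / 2"

text \<open>Differentiability below is real differentiability. The two Wirtinger derivatives are an
  invertible linear combination of the two partial derivatives, so \<open>Ck k\<close> is the usual class of
  \<open>k\<close> times continuously differentiable functions on the real plane.\<close>

primrec Ck :: "nat \<Rightarrow> (complex \<Rightarrow> complex) \<Rightarrow> bool" where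
  "Ck 0 f \<longleftrightarrow> continuous_on UNIV f"
| "Ck (Suc k) f \<longleftrightarrow> (\<forall>z. f differentiable (at z)) \<and> Ck k (wirt f) \<and> Ck k (wirt_bar f)"

definition smooth :: "(complex \<Rightarrow> complex) \<Rightarrow> bool" where
  "smooth f \<longleftrightarrow> (\<forall>k. Ck k f)"


subsection \<open>Square integrable functions, unitary operators, orthonormal bases\<close>

text \<open>The spaces of interest consist of continuous functions, and all measures used are Lebesgue
  measure with a positive density, so they are treated as sets of functions rather than of classes
  modulo equality almost everywhere; \<open>l2_inner\<close> is positive definite on them.\<close>

definition L2 :: "complex measure \<Rightarrow> (complex \<Rightarrow> complex) set" where
  "L2 M = {f \<in> borel_measurable M. integrable M (\<lambda>z. (norm (f z))\<^sup>2)}"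

definition l2_inner :: "complex measure \<Rightarrow> (complex \<Rightarrow> complex) \<Rightarrow> (complex \<Rightarrow> complex) \<Rightarrow> complex" where
  "l2_inner M f g = (LINT z|M. f z * cnj (g z))"

definition l2_norm :: "complex measure \<Rightarrow> (complex \<Rightarrow> complex) \<Rightarrow> real" where
  "l2_norm M f = sqrt (LINT z|M. (norm (f z))\<^sup>2)"

definition unitary_onto ::
    "complex measure \<Rightarrow> (complex \<Rightarrow> complex) set \<Rightarrow> (complex \<Rightarrow> complex) set
      \<Rightarrow> ((complex \<Rightarrow> complex) \<Rightarrow> (complex \<Rightarrow> complex)) \<Rightarrow> bool" where
  "unitary_onto M V W T \<longleftrightarrow>
     (\<forall>a b. \<forall>f\<in>V. \<forall>g\<in>V. T (\<lambda>z. a * f z + b * g z) = (\<lambda>z. a * T f z + b * T g z)) \<and>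
     (\<forall>f\<in>V. \<forall>g\<in>V. l2_inner M (T f) (T g) = l2_inner M f g) \<and>
     bij_betw T V W"

definition orthonormal_basis ::
    "complex measure \<Rightarrow> (complex \<Rightarrow> complex) set \<Rightarrow> (nat \<Rightarrow> complex \<Rightarrow> complex) \<Rightarrow> bool" where
  "orthonormal_basis M V e \<longleftrightarrow>
     (\<forall>m. e m \<in> V) \<and>
     (\<forall>j k. l2_inner M (e j) (e k) = (if j = k then 1 else 0)) \<and>
     (\<forall>f\<in>V. \<forall>\<epsilon>>0. \<exists>N c. l2_norm M (\<lambda>z. f z - (\<Sum>m<N. c m * e m z)) < \<epsilon>)"


subsection \<open>The spaces\<close>

definition nu :: "real \<Rightarrow> real" where
  "nu s = (1 - s\<^sup>2) / (2 * s)"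

definition alpha :: "real \<Rightarrow> real" where
  "alpha s = (1 + s\<^sup>2) / (4 * s)"

text \<open>The exponent is a real number, so taking the real part only changes the type.\<close>

definition omega :: "real \<Rightarrow> complex \<Rightarrow> real" where
  "omega s z = exp (Re (of_real (alpha s) * (z\<^sup>2 + (cnj z)\<^sup>2)) - nu s * (norm z)\<^sup>2)"

definition omega_measure :: "real \<Rightarrow> complex measure" where
  "omega_measure s = density lborel (\<lambda>z. ennreal (omega s z))"

definition gauss_measure :: "real \<Rightarrow> complex measure" where
  "gauss_measure \<nu> = density lborel (\<lambda>z. ennreal (exp (- \<nu> * (norm z)\<^sup>2)))"

definition X_space :: "real \<Rightarrow> (complex \<Rightarrow> complex) set" where
  "X_space s = {f. f holomorphic_on UNIV \<and> f \<in> L2 (omega_measure s)}"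

definition magnetic_laplacian :: "real \<Rightarrow> (complex \<Rightarrow> complex) \<Rightarrow> complex \<Rightarrow> complex" where
  "magnetic_laplacian \<nu> F z =
     - wirt (wirt_bar F) z + of_real \<nu> * cnj z * wirt_bar F z"

text \<open>By elliptic regularity every \<open>L\<^sup>2\<close> eigenfunction has a unique smooth representative, and it is
  this representative that is meant.\<close>

definition fock_space :: "real \<Rightarrow> nat \<Rightarrow> (complex \<Rightarrow> complex) set" where
  "fock_space \<nu> n = {F. smooth F \<and> F \<in> L2 (gauss_measure \<nu>) \<and>
     (\<forall>z. magnetic_laplacian \<nu> F z = of_nat n * of_real \<nu> * F z)}"

definition Xn_space :: "nat \<Rightarrow> real \<Rightarrow> (complex \<Rightarrow> complex) set" where
  "Xn_space n s = {(\<lambda>z. exp (- of_real (alpha s) * z\<^sup>2) * F z) | F. F \<in> fock_space (nu s) n}"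


subsection \<open>The transform and the basis functions\<close>

definition W_integrand ::
    "real \<Rightarrow> nat \<Rightarrow> (complex \<Rightarrow> complex) \<Rightarrow> complex \<Rightarrow> complex \<Rightarrow> complex" where
  "W_integrand s n f z \<xi> =
     exp (- of_real (nu s * (norm \<xi>)\<^sup>2) + of_real (alpha s) * \<xi>\<^sup>2 + of_real (nu s) * cnj \<xi> * z)
       * (cnj z - cnj \<xi>) ^ n * f \<xi>"

definition W_op :: "real \<Rightarrow> nat \<Rightarrow> (complex \<Rightarrow> complex) \<Rightarrow> complex \<Rightarrow> complex" where
  "W_op s n f z =
     of_real (nu s / pi * sqrt (nu s ^ n / fact n)) * exp (- of_real (alpha s) * z\<^sup>2)
       * (LINT \<xi>|lborel. W_integrand s n f z \<xi>)"

definition nabla :: "real \<Rightarrow> real \<Rightarrow> (complex \<Rightarrow> complex) \<Rightarrow> complex \<Rightarrow> complex" where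
  "nabla \<nu> \<gamma> g z = - wirt g z + of_real \<nu> * cnj z * g z - 2 * of_real \<gamma> * z * g z"

definition hermite :: "nat \<Rightarrow> complex \<Rightarrow> complex" where
  "hermite m z =
     fact m * (\<Sum>k\<le>m div 2. (-1) ^ k / fact k * ((2 * z) ^ (m - 2 * k) / fact (m - 2 * k)))"

definition psi :: "real \<Rightarrow> nat \<Rightarrow> nat \<Rightarrow> complex \<Rightarrow> complex" where
  "psi s m n z =
     of_real (sqrt ((1 - s) / (pi * nu s ^ n * fact n * sqrt s))
              * ((1 - s) / (1 + s)) powr (real m / 2))
       * (exp (- z\<^sup>2 / 2) / of_real (sqrt (2 ^ m * fact m)))
       * (nabla (nu s) (alpha s - 1 / 2) ^^ n) (hermite m) z"

end

theory Submission
  imports Defs "HOL-Complex_Analysis.Complex_Analysis" "HOL-Probability.Probability"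
begin

text \<open>
  Multiplication by \<open>exp (\<alpha> z\<^sup>2)\<close> is an isometry of \<open>L\<^sup>2(\<omega>\<^sub>s)\<close> onto \<open>L\<^sup>2(exp (- \<nu> |z|\<^sup>2))\<close> that carries
  \<open>X\<^sub>s\<close> to the Fock space \<open>F\<^sub>0\<close> and \<open>X\<^sub>n\<^sub>,\<^sub>s\<close> to the eigenspace \<open>F\<^sub>n\<close>. There the magnetic Laplacian
  is \<open>A\<^sup>* A\<close> with \<open>A = \<partial>/\<partial>z\<^sup>-\<close>, \<open>A\<^sup>* = - \<partial>/\<partial>z + \<nu> z\<^sup>-\<close> and \<open>[A, A\<^sup>*] = \<nu>\<close>, where \<open>z\<^sup>-\<close> denotes
  the conjugate variable. Hence \<open>(\<nu>\<^sup>n n!)\<^sup>-\<^sup>1\<^sup>/\<^sup>2 (A\<^sup>*)\<^sup>n\<close> is unitary from \<open>F\<^sub>0\<close> onto \<open>F\<^sub>n\<close>. The integral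
  in the transform evaluates to this operator: after the translation \<open>\<xi> \<mapsto> z + \<xi>\<close> it is a Gaussian
  moment of an entire function, that is, a Taylor coefficient. Finally \<open>\<psi>\<^sub>m\<^sub>,\<^sub>n\<close> is the image of
  \<open>\<psi>\<^sub>m\<^sub>,\<^sub>0\<close>, and the functions \<open>exp (\<gamma> z\<^sup>2) H\<^sub>m\<close> with \<open>\<gamma> = \<alpha> - 1/2\<close> are orthogonal in \<open>F\<^sub>0\<close> because the
  lowering operator of the Hermite polynomials is, up to a factor, adjoint to the raising operator.
\<close>

subsection \<open>Wirtinger calculus\<close>

text \<open>An element of an eigenspace is only known to be smooth and square integrable. So neither
  \<open>wirt_bar F\<close> nor \<open>creation \<nu> F\<close> is known to lie in L2, and
  integration by parts on the whole plane has a boundary term. One cutoff at radius R serves both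
  purposes: the gradient of its square is at most 2/R times the cutoff, so an energy estimate first
  gives square integrability, and afterwards the boundary term is O(1/R) and vanishes in the limit.
  The exponent gamma = alpha - 1/2 enters twice. It is what remains of the exponentials in
  \<open>psi\<close> under the isometry, and it satisfies 4 gamma (1 + gamma) = nu^2, the relation
  behind the orthogonality. For completeness, polynomials times exp(gamma z^2) must approximate
  plain polynomials. The partial sums of the series of exp(-gamma z^2) leave an error dominated by
  exp(2 gamma |z|^2), which is square integrable only if 4 gamma < nu, that is s > 1/3. Only the
  weaker 2 gamma < nu holds for every s, with margin nu - 2 gamma = 1 - s.\<close>

definition has_wirt :: "(complex \<Rightarrow> complex) \<Rightarrow> complex \<Rightarrow> complex \<Rightarrow> complex \<Rightarrow> bool" where
  "has_wirt f a b z \<longleftrightarrow> (f has_derivative (\<lambda>h. a * h + b * cnj h)) (at z)"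

lemma has_wirtD:
  assumes "has_wirt f a b z"
  shows "wirt f z = a" "wirt_bar f z = b" "f differentiable (at z)"
proof -
  have D: "(f has_derivative (\<lambda>h. a * h + b * cnj h)) (at z)"
    using assms by (simp add: has_wirt_def)
  then have F: "frechet_derivative f (at z) = (\<lambda>h. a * h + b * cnj h)"
    by (metis frechet_derivative_at)
  show "wirt f z = a" "wirt_bar f z = b"
    unfolding wirt_def wirt_bar_def F by (auto simp: algebra_simps)
  show "f differentiable (at z)"
    using D by (auto simp: differentiable_def)
qed

text \<open>A real linear map of the plane is determined by its values at 1 and the imaginary unit,
  so it has exactly one form a h + b cnj h. Working with the pair (a, b) replaces working with
  partial derivatives.\<close>

lemma frechet_derivative_wirt:
  assumes "f differentiable (at z)"
  shows "frechet_derivative f (at z) h = wirt f z * h + wirt_bar f z * cnj h"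
proof -
  interpret linear "frechet_derivative f (at z)"
    using assms by (rule linear_frechet_derivative)
  have "h = Re h *\<^sub>R 1 + Im h *\<^sub>R \<i>"
    by (simp add: complex_eq_iff)
  then have "frechet_derivative f (at z) h
      = Re h *\<^sub>R frechet_derivative f (at z) 1 + Im h *\<^sub>R frechet_derivative f (at z) \<i>"
    by (metis add scale)
  then show ?thesis
    unfolding wirt_def wirt_bar_def
    by (simp add: complex_eq_iff field_simps)
qed

lemma has_wirt_wirt:
  assumes "f differentiable (at z)"
  shows "has_wirt f (wirt f z) (wirt_bar f z) z"
  using assms frechet_derivative_works[of f "at z"]
  by (simp add: has_wirt_def frechet_derivative_wirt[OF assms, abs_def])

lemma has_wirt_const: "has_wirt (\<lambda>_. c) 0 0 z"
  by (simp add: has_wirt_def)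

lemma has_wirt_add:
  assumes "has_wirt f a b z" "has_wirt g c d z"
  shows "has_wirt (\<lambda>z. f z + g z) (a + c) (b + d) z"
proof -
  have "((\<lambda>z. f z + g z) has_derivative
      (\<lambda>h. (a * h + b * cnj h) + (c * h + d * cnj h))) (at z)"
    using assms unfolding has_wirt_def by (rule has_derivative_add)
  then show ?thesis
    by (simp add: has_wirt_def algebra_simps)
qed

lemma has_wirt_mult:
  assumes "has_wirt f a b z" "has_wirt g c d z"
  shows "has_wirt (\<lambda>z. f z * g z) (a * g z + f z * c) (b * g z + f z * d) z"
proof -
  have "((\<lambda>z. f z * g z) has_derivative
      (\<lambda>h. f z * (c * h + d * cnj h) + (a * h + b * cnj h) * g z)) (at z)"
    using assms unfolding has_wirt_def by (rule has_derivative_mult)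
  then show ?thesis
    by (simp add: has_wirt_def algebra_simps)
qed

lemma has_wirt_cmult: "has_wirt f a b z \<Longrightarrow> has_wirt (\<lambda>z. c * f z) (c * a) (c * b) z"
  using has_wirt_mult[OF has_wirt_const[of c]] by fastforce

lemma has_wirt_minus: "has_wirt f a b z \<Longrightarrow> has_wirt (\<lambda>z. - f z) (- a) (- b) z"
  using has_wirt_cmult[of f a b z "-1"] by simp

lemma has_wirt_cnj:
  assumes "has_wirt f a b z"
  shows "has_wirt (\<lambda>z. cnj (f z)) (cnj b) (cnj a) z"
proof -
  have "((\<lambda>z. cnj (f z)) has_derivative (\<lambda>h. cnj (a * h + b * cnj h))) (at z)"
    using assms unfolding has_wirt_def
    by (rule bounded_linear.has_derivative[OF bounded_linear_cnj])
  then show ?thesis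
    by (simp add: has_wirt_def algebra_simps)
qed

lemma has_wirt_holomorphic:
  "(f has_field_derivative a) (at z) \<Longrightarrow> has_wirt f a 0 z"
  by (simp add: has_wirt_def has_field_derivative_def mult_commute_abs)

lemma has_wirt_chain:
  assumes "has_wirt f a b z" "(g has_field_derivative d) (at (f z))"
  shows "has_wirt (\<lambda>z. g (f z)) (d * a) (d * b) z"
proof -
  have "((\<lambda>z. g (f z)) has_derivative (\<lambda>h. d * (a * h + b * cnj h))) (at z)"
    using has_derivative_compose[of f "\<lambda>h. a * h + b * cnj h" z UNIV g "(*) d"] assms
    by (simp add: has_wirt_def has_field_derivative_def)
  then show ?thesis
    by (simp add: has_wirt_def algebra_simps)
qed

lemma has_wirt_ident: "has_wirt (\<lambda>z. z) 1 0 z"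
  by (simp add: has_wirt_def)

lemma has_wirt_cnj_ident: "has_wirt cnj 0 1 z"
  using has_wirt_cnj[OF has_wirt_ident[of z]] by simp

section \<open>Closure properties of k times continuously differentiable and of smooth
  functions\<close>

lemma Ck_mono: "Ck (Suc k) f \<Longrightarrow> Ck k f"
proof (induction k arbitrary: f)
  case 0
  then have "\<forall>z. f differentiable (at z)" by simp
  then show ?case
    by (simp add: continuous_at_imp_continuous_on differentiable_imp_continuous_within)
next
  case (Suc k)
  then show ?case by (metis Ck.simps(2))
qed

lemma Ck_Suc_intro:
  assumes "\<And>z. has_wirt f (a z) (b z) z" "Ck k a" "Ck k b"
  shows "Ck (Suc k) f"
proof -
  have "wirt f = a" "wirt_bar f = b"
    using has_wirtD[OF assms(1)] by auto
  then show ?thesis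
    using assms has_wirtD(3)[OF assms(1)] by simp
qed

lemma Ck_SucD: "Ck (Suc k) f \<Longrightarrow> has_wirt f (wirt f z) (wirt_bar f z) z"
  by (simp add: has_wirt_wirt)

lemma Ck_const: "Ck k (\<lambda>_. c)"
proof (induction k arbitrary: c)
  case (Suc k)
  then show ?case by (intro Ck_Suc_intro[OF has_wirt_const])
qed simp

lemma Ck_add: "Ck k f \<Longrightarrow> Ck k g \<Longrightarrow> Ck k (\<lambda>z. f z + g z)"
proof (induction k arbitrary: f g)
  case (Suc k)
  show ?case
    by (rule Ck_Suc_intro[OF has_wirt_add[OF Ck_SucD[OF Suc.prems(1)] Ck_SucD[OF Suc.prems(2)]]])
      (use Suc in auto)
qed (simp add: continuous_on_add)

lemma Ck_mult: "Ck k f \<Longrightarrow> Ck k g \<Longrightarrow> Ck k (\<lambda>z. f z * g z)"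
proof (induction k arbitrary: f g)
  case (Suc k)
  \<comment> \<open>The product rule multiplies a derivative of one factor by the other factor
    itself, so the undifferentiated factors are needed at order k as well.\<close>
  then have *: "Ck k f" "Ck k g" using Ck_mono by blast+
  have d: "Ck k (wirt f)" "Ck k (wirt_bar f)" "Ck k (wirt g)" "Ck k (wirt_bar g)"
    using Suc.prems by simp_all
  show ?case
    by (rule Ck_Suc_intro[OF has_wirt_mult[OF Ck_SucD[OF Suc.prems(1)] Ck_SucD[OF Suc.prems(2)]]])
      (intro Ck_add Suc.IH * d)+
qed (simp add: continuous_on_mult)

lemma Ck_cnj: "Ck k f \<Longrightarrow> Ck k (\<lambda>z. cnj (f z))"
proof (induction k arbitrary: f)
  case (Suc k)
  show ?case
    by (rule Ck_Suc_intro[OF has_wirt_cnj[OF Ck_SucD[OF Suc.prems(1)]]]) (use Suc in auto)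
qed (simp add: continuous_on_cnj)

lemma Ck_holomorphic: "f holomorphic_on UNIV \<Longrightarrow> Ck k f"
proof (induction k arbitrary: f)
  case 0
  then show ?case by (simp add: holomorphic_on_imp_continuous_on)
next
  case (Suc k)
  have "(f has_field_derivative deriv f z) (at z)" for z
    using Suc.prems by (simp add: holomorphic_derivI)
  moreover have "deriv f holomorphic_on UNIV"
    using Suc.prems by (simp add: holomorphic_deriv)
  ultimately show ?case
    using Suc by (intro Ck_Suc_intro[OF has_wirt_holomorphic]) (auto simp: Ck_const)
qed

lemma smooth_const: "smooth (\<lambda>_. c)" by (simp add: smooth_def Ck_const)
lemma smooth_add: "smooth f \<Longrightarrow> smooth g \<Longrightarrow> smooth (\<lambda>z. f z + g z)"
  by (simp add: smooth_def Ck_add)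
lemma smooth_mult: "smooth f \<Longrightarrow> smooth g \<Longrightarrow> smooth (\<lambda>z. f z * g z)"
  by (simp add: smooth_def Ck_mult)
lemma smooth_cnj: "smooth f \<Longrightarrow> smooth (\<lambda>z. cnj (f z))"
  by (simp add: smooth_def Ck_cnj)
lemma smooth_holomorphic: "f holomorphic_on UNIV \<Longrightarrow> smooth f"
  by (simp add: smooth_def Ck_holomorphic)
lemma smooth_cmult: "smooth f \<Longrightarrow> smooth (\<lambda>z. c * f z)"
  by (intro smooth_mult smooth_const)
lemma smooth_minus: "smooth f \<Longrightarrow> smooth (\<lambda>z. - f z)"
  using smooth_cmult[of f "-1"] by simp
lemma smooth_cnj_ident: "smooth cnj"
  using smooth_cnj[OF smooth_holomorphic[OF holomorphic_on_ident]] by simp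
lemma smooth_wirt: "smooth f \<Longrightarrow> smooth (wirt f)"
  unfolding smooth_def by (metis Ck.simps(2))
lemma smooth_wirt_bar: "smooth f \<Longrightarrow> smooth (wirt_bar f)"
  unfolding smooth_def by (metis Ck.simps(2))
lemma smooth_Ck: "smooth f \<Longrightarrow> Ck k f"
  by (simp add: smooth_def)
lemma smooth_has_wirt: "smooth f \<Longrightarrow> has_wirt f (wirt f z) (wirt_bar f z) z"
  using Ck_SucD[of 0 f] smooth_Ck by blast
lemma smooth_continuous: "smooth f \<Longrightarrow> continuous_on UNIV f"
  using smooth_Ck[of f 0] by simp

subsection \<open>Equality of mixed derivatives\<close>

text \<open>The mean value inequality for G minus the linear function with slope c. It is applied
  with c close to the derivative for second differences and with c = 0 for a Lipschitz
  bound.\<close>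

lemma vector_mean_value_bound:
  fixes G :: "real \<Rightarrow> 'a::real_normed_vector"
  assumes "0 \<le> t" "\<And>\<sigma>. 0 \<le> \<sigma> \<Longrightarrow> \<sigma> \<le> t \<Longrightarrow> (G has_vector_derivative G' \<sigma>) (at \<sigma>)"
    and B: "\<And>\<sigma>. 0 \<le> \<sigma> \<Longrightarrow> \<sigma> \<le> t \<Longrightarrow> norm (G' \<sigma> - c) \<le> B"
  shows "norm (G t - G 0 - t *\<^sub>R c) \<le> t * B"
proof -
  let ?H = "\<lambda>\<sigma>. G \<sigma> - \<sigma> *\<^sub>R c"
  have "norm (?H t - ?H 0) \<le> B * norm (t - 0)"
  proof (rule differentiable_bound[of "{0..t}" ?H "\<lambda>\<sigma> h. h *\<^sub>R (G' \<sigma> - c)" B])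
    fix \<sigma> assume "\<sigma> \<in> {0..t}"
    then have \<sigma>: "0 \<le> \<sigma>" "\<sigma> \<le> t" by auto
    have "(G has_derivative (\<lambda>h. h *\<^sub>R G' \<sigma>)) (at \<sigma>)"
      using assms(2)[OF \<sigma>] by (simp add: has_vector_derivative_def)
    then have "(?H has_derivative (\<lambda>h. h *\<^sub>R G' \<sigma> - h *\<^sub>R c)) (at \<sigma>)"
      by (intro derivative_eq_intros) auto
    then show "(?H has_derivative (\<lambda>h. h *\<^sub>R (G' \<sigma> - c))) (at \<sigma> within {0..t})"
      by (simp add: scaleR_diff_right has_derivative_at_withinI)
    show "onorm (\<lambda>h. h *\<^sub>R (G' \<sigma> - c)) \<le> B"
    proof (rule onorm_bound)
      show "0 \<le> B" using order_trans[OF norm_ge_zero B[OF \<sigma>]] .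
      show "norm (h *\<^sub>R (G' \<sigma> - c)) \<le> B * norm h" for h
        using mult_right_mono[OF B[OF \<sigma>], of "norm h"] by (simp add: mult.commute)
    qed
  qed (use assms in auto)
  then show ?thesis using assms(1) by (simp add: mult.commute algebra_simps)
qed

lemma has_vector_derivative_along:
  assumes "g differentiable (at (p + \<sigma> *\<^sub>R a))"
  shows "((\<lambda>\<sigma>. g (p + \<sigma> *\<^sub>R a)) has_vector_derivative
    frechet_derivative g (at (p + \<sigma> *\<^sub>R a)) a) (at (\<sigma>::real))"
proof -
  let ?F = "frechet_derivative g (at (p + \<sigma> *\<^sub>R a))"
  have "(g has_derivative ?F) (at (p + \<sigma> *\<^sub>R a))"
    using assms frechet_derivative_works by blast
  moreover have "((\<lambda>\<sigma>. p + \<sigma> *\<^sub>R a) has_derivative (\<lambda>h. h *\<^sub>R a)) (at \<sigma>)"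
    by (auto intro!: derivative_eq_intros)
  ultimately have "((\<lambda>\<sigma>. g (p + \<sigma> *\<^sub>R a)) has_derivative (\<lambda>h. ?F (h *\<^sub>R a))) (at \<sigma>)"
    using has_derivative_compose by fast
  then show ?thesis
    using assms by (simp add: has_vector_derivative_def linear_frechet_derivative linear_scale)
qed

text \<open>Both mixed derivatives are the limit of the same second difference quotient.\<close>

lemma second_difference_bound:
  fixes u :: "'a::real_normed_vector \<Rightarrow> 'b::real_normed_vector"
  assumes u: "\<And>z. u differentiable (at z)"
    and Du: "\<And>z. (\<lambda>z. frechet_derivative u (at z) a) differentiable (at z)"
    and cont: "continuous (at p)
      (\<lambda>z. frechet_derivative (\<lambda>z. frechet_derivative u (at z) a) (at z) b)"
    and "\<epsilon> > 0"
  shows "\<exists>d>0. \<forall>t. 0 < t \<and> t < d \<longrightarrow>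
    norm (u (p + t *\<^sub>R a + t *\<^sub>R b) - u (p + t *\<^sub>R a) - u (p + t *\<^sub>R b) + u p
      - t\<^sup>2 *\<^sub>R frechet_derivative (\<lambda>z. frechet_derivative u (at z) a) (at p) b) \<le> t\<^sup>2 * \<epsilon>"
proof -
  let ?D = "\<lambda>z. frechet_derivative u (at z) a"
  let ?DD = "\<lambda>z. frechet_derivative ?D (at z) b"
  obtain d where d: "d > 0" "\<And>z. dist z p < d \<Longrightarrow> dist (?DD z) (?DD p) < \<epsilon>"
    using cont \<open>\<epsilon> > 0\<close> unfolding continuous_at_eps_delta by blast
  \<comment> \<open>For t < e the whole parallelogram spanned by t a and t b at p lies within
    distance d of p. The summand 1 keeps the denominator positive when a = b = 0.\<close>
  define e where "e = d / (norm a + norm b + 1)"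
  have "e > 0" using d by (simp add: e_def add_nonneg_pos)
  have "norm (u (p + t *\<^sub>R a + t *\<^sub>R b) - u (p + t *\<^sub>R a) - u (p + t *\<^sub>R b) + u p
      - t\<^sup>2 *\<^sub>R ?DD p) \<le> t\<^sup>2 * \<epsilon>" if t: "0 < t" "t < e" for t
  proof -
    have close: "norm (\<sigma> *\<^sub>R a + \<tau> *\<^sub>R b) < d"
      if "0 \<le> \<sigma>" "\<sigma> \<le> t" "0 \<le> \<tau>" "\<tau> \<le> t" for \<sigma> \<tau>
    proof -
      have "norm (\<sigma> *\<^sub>R a + \<tau> *\<^sub>R b) \<le> \<sigma> * norm a + \<tau> * norm b"
        using that norm_triangle_ineq[of "\<sigma> *\<^sub>R a" "\<tau> *\<^sub>R b"] by simp
      also have "\<dots> \<le> t * norm a + t * norm b"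
        using that by (intro add_mono mult_right_mono) auto
      also have "\<dots> < t * (norm a + norm b + 1)" using t by (simp add: algebra_simps)
      also have "\<dots> \<le> e * (norm a + norm b + 1)"
        using t by (intro mult_right_mono) auto
      also have "\<dots> = d"
        using norm_ge_zero[of a] norm_ge_zero[of b] unfolding e_def by (auto simp: add_nonneg_eq_0_iff)
      finally show ?thesis .
    qed
    \<comment> \<open>Mean value inequality in direction b, applied to the derivative along
      a.\<close>
    have inner: "norm (?D (p + \<sigma> *\<^sub>R a + t *\<^sub>R b) - ?D (p + \<sigma> *\<^sub>R a) - t *\<^sub>R ?DD p) \<le> t * \<epsilon>"
      if "0 \<le> \<sigma>" "\<sigma> \<le> t" for \<sigma>
    proof -
      have "norm (?D (p + \<sigma> *\<^sub>R a + t *\<^sub>R b) - ?D (p + \<sigma> *\<^sub>R a + 0 *\<^sub>R b) - t *\<^sub>R ?DD p) \<le> t * \<epsilon>"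
      proof (rule vector_mean_value_bound[where G = "\<lambda>\<tau>. ?D (p + \<sigma> *\<^sub>R a + \<tau> *\<^sub>R b)"])
        fix \<tau> assume \<tau>: "0 \<le> \<tau>" "\<tau> \<le> t"
        show "((\<lambda>\<tau>. ?D (p + \<sigma> *\<^sub>R a + \<tau> *\<^sub>R b)) has_vector_derivative
          ?DD (p + \<sigma> *\<^sub>R a + \<tau> *\<^sub>R b)) (at \<tau>)"
          by (rule has_vector_derivative_along[OF Du])
        have "dist (p + \<sigma> *\<^sub>R a + \<tau> *\<^sub>R b) p < d"
          using close[OF that \<tau>] by (simp add: dist_norm algebra_simps)
        then show "norm (?DD (p + \<sigma> *\<^sub>R a + \<tau> *\<^sub>R b) - ?DD p) \<le> \<epsilon>"
          using d(2) by (fastforce simp: dist_norm)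
      qed (use t in auto)
      then show ?thesis by simp
    qed
    \<comment> \<open>The second difference is the increment over [0, t] of this first difference;
      \<open>inner\<close> controls its derivative.\<close>
    let ?G = "\<lambda>\<sigma>. u (p + t *\<^sub>R b + \<sigma> *\<^sub>R a) - u (p + \<sigma> *\<^sub>R a)"
    have "norm (?G t - ?G 0 - t *\<^sub>R (t *\<^sub>R ?DD p)) \<le> t * (t * \<epsilon>)"
    proof (rule vector_mean_value_bound)
      fix \<sigma> assume "0 \<le> \<sigma>" "\<sigma> \<le> t"
      then show "norm ((?D (p + t *\<^sub>R b + \<sigma> *\<^sub>R a) - ?D (p + \<sigma> *\<^sub>R a)) - t *\<^sub>R ?DD p) \<le> t * \<epsilon>"
        using inner[of \<sigma>] by (simp add: algebra_simps)
      show "(?G has_vector_derivative ?D (p + t *\<^sub>R b + \<sigma> *\<^sub>R a) - ?D (p + \<sigma> *\<^sub>R a)) (at \<sigma>)"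
        by (intro has_vector_derivative_diff has_vector_derivative_along u)
    qed (use t in auto)
    then show ?thesis by (simp add: power2_eq_square algebra_simps)
  qed
  then show ?thesis using \<open>e > 0\<close> by blast
qed

lemma symmetric_second_derivative:
  fixes u :: "'a::real_normed_vector \<Rightarrow> 'b::real_normed_vector"
  assumes "\<And>z. u differentiable (at z)"
    and "\<And>z. (\<lambda>z. frechet_derivative u (at z) a) differentiable (at z)"
    and "\<And>z. (\<lambda>z. frechet_derivative u (at z) b) differentiable (at z)"
    and "continuous (at p)
      (\<lambda>z. frechet_derivative (\<lambda>z. frechet_derivative u (at z) a) (at z) b)"
    and "continuous (at p)
      (\<lambda>z. frechet_derivative (\<lambda>z. frechet_derivative u (at z) b) (at z) a)"
  shows "frechet_derivative (\<lambda>z. frechet_derivative u (at z) a) (at p) b =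
    frechet_derivative (\<lambda>z. frechet_derivative u (at z) b) (at p) a" (is "?x = ?y")
proof (rule ccontr)
  assume "?x \<noteq> ?y"
  then have pos: "norm (?x - ?y) / 3 > 0" by simp
  \<comment> \<open>A third of the gap: the two estimates together would give 3 t^2 times this
    number at most 2 t^2 times it.\<close>
  let ?\<epsilon> = "norm (?x - ?y) / 3"
  obtain d where d: "d > 0" "\<And>t. 0 < t \<Longrightarrow> t < d \<Longrightarrow>
    norm (u (p + t *\<^sub>R a + t *\<^sub>R b) - u (p + t *\<^sub>R a) - u (p + t *\<^sub>R b) + u p - t\<^sup>2 *\<^sub>R ?x)
      \<le> t\<^sup>2 * ?\<epsilon>"
    using second_difference_bound[OF assms(1,2,4) pos] by blast
  obtain e where e: "e > 0" "\<And>t. 0 < t \<Longrightarrow> t < e \<Longrightarrow>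
    norm (u (p + t *\<^sub>R b + t *\<^sub>R a) - u (p + t *\<^sub>R b) - u (p + t *\<^sub>R a) + u p - t\<^sup>2 *\<^sub>R ?y)
      \<le> t\<^sup>2 * ?\<epsilon>"
    using second_difference_bound[OF assms(1,3,5) pos] by blast
  define t where "t = min d e / 2"
  have t: "0 < t" "t < d" "t < e" using d e by (auto simp: t_def)
  let ?Q = "u (p + t *\<^sub>R a + t *\<^sub>R b) - u (p + t *\<^sub>R a) - u (p + t *\<^sub>R b) + u p"
  have "norm (?Q - t\<^sup>2 *\<^sub>R ?x) \<le> t\<^sup>2 * ?\<epsilon>" "norm (?Q - t\<^sup>2 *\<^sub>R ?y) \<le> t\<^sup>2 * ?\<epsilon>"
    using d(2)[of t] e(2)[of t] t by (simp_all add: algebra_simps)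
  then have "norm ((?Q - t\<^sup>2 *\<^sub>R ?y) - (?Q - t\<^sup>2 *\<^sub>R ?x)) \<le> 2 * (t\<^sup>2 * ?\<epsilon>)"
    using norm_triangle_ineq4[of "?Q - t\<^sup>2 *\<^sub>R ?y" "?Q - t\<^sup>2 *\<^sub>R ?x"] by linarith
  then have "norm (t\<^sup>2 *\<^sub>R (?x - ?y)) \<le> 2 * (t\<^sup>2 * ?\<epsilon>)"
    by (simp add: algebra_simps)
  moreover have "norm (t\<^sup>2 *\<^sub>R (?x - ?y)) = 3 * (t\<^sup>2 * ?\<epsilon>)" by simp
  moreover have "t\<^sup>2 * ?\<epsilon> > 0" using t pos by (intro mult_pos_pos) auto
  ultimately show False by linarith
qed

text \<open>The commutator of the two Wirtinger derivatives is a constant multiple of the commutator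
  of the derivatives along 1 and the imaginary unit, which vanishes by the symmetry of second
  derivatives.\<close>

lemma smooth_wirt_commute:
  assumes "smooth u"
  shows "wirt (wirt_bar u) z = wirt_bar (wirt u) z"
proof -
  let ?P = "\<lambda>a z. frechet_derivative u (at z) a"
  have diff: "f differentiable (at z)" if "smooth f" for f z
    using has_wirtD(3)[OF smooth_has_wirt[OF that]] .
  have P: "?P a = (\<lambda>z. wirt u z * a + wirt_bar u z * cnj a)" for a
    using frechet_derivative_wirt[OF diff[OF assms]] by blast
  have sP: "smooth (?P a)" for a
    unfolding P by (intro smooth_add smooth_mult smooth_const smooth_wirt smooth_wirt_bar assms)
  have Q: "(\<lambda>z. frechet_derivative f (at z) b) = (\<lambda>z. wirt f z * b + wirt_bar f z * cnj b)"
    if "smooth f" for f b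
    using frechet_derivative_wirt[OF diff[OF that]] by blast
  have c: "continuous (at z) (\<lambda>z. frechet_derivative (?P a) (at z) b)" for a b z
  proof -
    have "smooth (\<lambda>z. wirt (?P a) z * b + wirt_bar (?P a) z * cnj b)"
      by (intro smooth_add smooth_mult smooth_const smooth_wirt smooth_wirt_bar sP)
    then show ?thesis
      unfolding Q[OF sP] using smooth_continuous continuous_on_eq_continuous_at[OF open_UNIV] by blast
  qed
  have "frechet_derivative (?P 1) (at z) \<i> = frechet_derivative (?P \<i>) (at z) 1"
    by (rule symmetric_second_derivative[OF diff[OF assms] diff[OF sP] diff[OF sP] c c])
  moreover have "has_wirt (?P a) (wirt (wirt u) z * a + wirt (wirt_bar u) z * cnj a)
     (wirt_bar (wirt u) z * a + wirt_bar (wirt_bar u) z * cnj a) z" for a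
    unfolding P using has_wirt_add[OF has_wirt_cmult[OF smooth_has_wirt[OF smooth_wirt[OF assms]], of a]
        has_wirt_cmult[OF smooth_has_wirt[OF smooth_wirt_bar[OF assms]], of "cnj a"]]
    by (simp add: mult.commute)
  note has_wirtD(1,2)[OF this]
  ultimately show ?thesis
    by (simp add: frechet_derivative_wirt[OF diff[OF sP]] complex_eq_iff algebra_simps)
qed

text \<open>A uniform bound on the integrals of nonnegative approximants passes to the limit and
  also proves that the limit is integrable. It removes the cutoff in the energy estimate and bounds
  the tail of a Taylor series.\<close>

lemma Fatou_integral:
  fixes f :: "'a \<Rightarrow> real"
  assumes int: "\<And>n. integrable M (s n)" and nonneg: "\<And>n x. 0 \<le> s n x"
    and lim: "\<And>x. (\<lambda>n. s n x) \<longlonglongrightarrow> f x" and bound: "\<And>n. (LINT x|M. s n x) \<le> C"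
  shows "integrable M f" "(LINT x|M. f x) \<le> C"
proof -
  have [measurable]: "s n \<in> borel_measurable M" for n
    using int by (rule borel_measurable_integrable)
  have [measurable]: "f \<in> borel_measurable M"
    by (rule borel_measurable_LIMSEQ_metric[OF _ lim]) measurable
  have f0: "0 \<le> f x" for x
    using lim nonneg by (meson LIMSEQ_le_const)
  have "ennreal (f x) = liminf (\<lambda>n. ennreal (s n x))" for x
    using lim[of x] by (intro lim_imp_Liminf[symmetric] tendsto_ennrealI) auto
  then have "(\<integral>\<^sup>+x. ennreal (f x) \<partial>M) \<le> liminf (\<lambda>n. \<integral>\<^sup>+x. ennreal (s n x) \<partial>M)"
    using nn_integral_liminf[of "\<lambda>n x. ennreal (s n x)" M] by simp
  also have "\<dots> = liminf (\<lambda>n. ennreal (LINT x|M. s n x))"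
    using int nonneg by (simp add: nn_integral_eq_integral)
  also have "\<dots> \<le> liminf (\<lambda>n::nat. ennreal C)"
    by (intro Liminf_mono eventuallyI ennreal_leI bound)
  finally have le: "(\<integral>\<^sup>+x. ennreal (f x) \<partial>M) \<le> ennreal C"
    by (simp add: Liminf_const)
  then have "(\<integral>\<^sup>+x. ennreal (f x) \<partial>M) < \<infinity>"
    using ennreal_less_top le_less_trans by (metis infinity_ennreal_def)
  then show int_f: "integrable M f"
    using f0 by (intro integrableI_bounded) auto
  have "0 \<le> C"
    using bound[of 0] nonneg by (meson Bochner_Integration.integral_nonneg order_trans)
  then show "(LINT x|M. f x) \<le> C"
    using le f0 int_f by (simp add: nn_integral_eq_integral)
qed

subsection \<open>Square integrable functions\<close>

lemma L2D: "f \<in> L2 M \<Longrightarrow> f \<in> borel_measurable M" "f \<in> L2 M \<Longrightarrow> integrable M (\<lambda>z. (norm (f z))\<^sup>2)"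
  by (auto simp: L2_def)

lemma L2_bound:
  assumes "f \<in> borel_measurable M" "integrable M g" "\<And>z. (norm (f z))\<^sup>2 \<le> g z"
  shows "f \<in> L2 M"
  unfolding L2_def
proof safe
  show "integrable M (\<lambda>z. (norm (f z))\<^sup>2)"
    using assms(1) by (intro Bochner_Integration.integrable_bound[OF assms(2)])
      (auto intro: order_trans[OF assms(3) abs_ge_self])
qed fact

lemma norm_mult_le_squares: "norm (a * b :: complex) \<le> (norm a)\<^sup>2 + (norm b)\<^sup>2"
proof -
  have "0 \<le> norm a * norm b" by simp
  then show ?thesis
    using sum_squares_bound[of "norm a" "norm b"] unfolding norm_mult by linarith
qed

lemma integrable_L2_mult:
  assumes "f \<in> L2 M" "g \<in> L2 M"
  shows "integrable M (\<lambda>z. f z * g z)"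
proof (rule Bochner_Integration.integrable_bound)
  show "integrable M (\<lambda>z. (norm (f z))\<^sup>2 + (norm (g z))\<^sup>2)"
    using assms by (intro Bochner_Integration.integrable_add L2D)
qed (use assms L2D norm_mult_le_squares in \<open>auto intro!: borel_measurable_times\<close>)

lemma L2_cnj: "f \<in> L2 M \<Longrightarrow> (\<lambda>z. cnj (f z)) \<in> L2 M"
  by (auto simp: L2_def intro!: measurable_compose[OF _ borel_measurable_continuous_onI[OF continuous_on_cnj[OF continuous_on_id]]])

lemma integrable_L2_inner:
  "f \<in> L2 M \<Longrightarrow> g \<in> L2 M \<Longrightarrow> integrable M (\<lambda>z. f z * cnj (g z))"
  by (intro integrable_L2_mult L2_cnj)

lemma L2_add:
  assumes "f \<in> L2 M" "g \<in> L2 M"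
  shows "(\<lambda>z. f z + g z) \<in> L2 M"
proof (rule L2_bound)
  show "integrable M (\<lambda>z. 2 * (norm (f z))\<^sup>2 + 2 * (norm (g z))\<^sup>2)"
    using assms by (intro Bochner_Integration.integrable_add integrable_mult_right L2D)
  fix z
  have "(norm (f z + g z))\<^sup>2 \<le> (norm (f z) + norm (g z))\<^sup>2"
    by (intro power_mono norm_triangle_ineq) auto
  also have "\<dots> \<le> 2 * (norm (f z))\<^sup>2 + 2 * (norm (g z))\<^sup>2"
    using sum_squares_bound[of "norm (f z)" "norm (g z)"] by (simp add: power2_sum)
  finally show "(norm (f z + g z))\<^sup>2 \<le> 2 * (norm (f z))\<^sup>2 + 2 * (norm (g z))\<^sup>2" .
qed (use assms L2D in \<open>auto intro!: borel_measurable_add\<close>)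

lemma L2_cmult: "f \<in> L2 M \<Longrightarrow> (\<lambda>z. c * f z) \<in> L2 M"
  by (auto simp: L2_def norm_mult power_mult_distrib intro!: borel_measurable_times)

lemma L2_minus: "f \<in> L2 M \<Longrightarrow> (\<lambda>z. - f z) \<in> L2 M"
  using L2_cmult[of f M "-1"] by simp

lemma L2_diff: "f \<in> L2 M \<Longrightarrow> g \<in> L2 M \<Longrightarrow> (\<lambda>z. f z - g z) \<in> L2 M"
  using L2_add[OF _ L2_minus] by fastforce

lemma L2_sum: "(\<And>i. i \<in> I \<Longrightarrow> f i \<in> L2 M) \<Longrightarrow> (\<lambda>z. \<Sum>i\<in>I. f i z) \<in> L2 M"
proof (induction I rule: infinite_finite_induct)
  case (insert x F)
  then show ?case by (simp add: L2_add)
qed (auto simp: L2_def)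

lemma l2_inner_add_left:
  "f \<in> L2 M \<Longrightarrow> g \<in> L2 M \<Longrightarrow> h \<in> L2 M \<Longrightarrow>
    l2_inner M (\<lambda>z. f z + g z) h = l2_inner M f h + l2_inner M g h"
  unfolding l2_inner_def distrib_right
  by (intro Bochner_Integration.integral_add integrable_L2_inner)

lemma l2_inner_cmult_left: "l2_inner M (\<lambda>z. c * f z) h = c * l2_inner M f h"
  by (simp add: l2_inner_def mult.assoc)

lemma l2_inner_cnj: "l2_inner M f g = cnj (l2_inner M g f)"
proof -
  have "cnj (l2_inner M g f) = (LINT z|M. cnj (g z * cnj (f z)))"
    unfolding l2_inner_def by (rule Bochner_Integration.integral_cnj[symmetric])
  then show ?thesis by (simp add: l2_inner_def mult.commute)
qed

lemma l2_inner_add_right: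
  "f \<in> L2 M \<Longrightarrow> g \<in> L2 M \<Longrightarrow> h \<in> L2 M \<Longrightarrow>
    l2_inner M h (\<lambda>z. f z + g z) = l2_inner M h f + l2_inner M h g"
  unfolding l2_inner_def complex_cnj_add distrib_left
  by (intro Bochner_Integration.integral_add integrable_L2_inner)

lemma l2_inner_cmult_right: "l2_inner M h (\<lambda>z. c * f z) = cnj c * l2_inner M h f"
  by (simp add: l2_inner_def mult.left_commute)

lemma l2_inner_diff_left:
  "f \<in> L2 M \<Longrightarrow> g \<in> L2 M \<Longrightarrow> h \<in> L2 M \<Longrightarrow>
    l2_inner M (\<lambda>z. f z - g z) h = l2_inner M f h - l2_inner M g h"
  unfolding l2_inner_def left_diff_distrib
  by (intro Bochner_Integration.integral_diff integrable_L2_inner)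

lemma l2_inner_diff_right:
  "f \<in> L2 M \<Longrightarrow> g \<in> L2 M \<Longrightarrow> h \<in> L2 M \<Longrightarrow>
    l2_inner M h (\<lambda>z. f z - g z) = l2_inner M h f - l2_inner M h g"
  unfolding l2_inner_def complex_cnj_diff right_diff_distrib
  by (intro Bochner_Integration.integral_diff integrable_L2_inner)

lemma l2_inner_sum_right:
  assumes "\<And>i. i \<in> I \<Longrightarrow> f i \<in> L2 M" "h \<in> L2 M"
  shows "l2_inner M h (\<lambda>z. \<Sum>i\<in>I. f i z) = (\<Sum>i\<in>I. l2_inner M h (f i))"
  using assms
proof (induction I rule: infinite_finite_induct)
  case (insert x F)
  then show ?case by (simp add: l2_inner_add_right L2_sum)
qed (auto simp: l2_inner_def)

lemma l2_inner_self: "l2_inner M f f = of_real (LINT z|M. (norm (f z))\<^sup>2)"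
  unfolding l2_inner_def integral_complex_of_real[symmetric]
  by (simp add: complex_norm_square[symmetric] del: of_real_power)

lemma l2_norm_less_iff:
  assumes "\<epsilon> > 0"
  shows "l2_norm M f < \<epsilon> \<longleftrightarrow> (LINT z|M. (norm (f z))\<^sup>2) < \<epsilon>\<^sup>2"
  unfolding l2_norm_def
  using assms real_sqrt_less_iff[of "LINT z|M. (norm (f z))\<^sup>2" "\<epsilon>\<^sup>2"] by simp

text \<open>The pointwise bound |x + y|^2 <= 2 |x|^2 + 2 |y|^2 replaces the triangle inequality, so
  that approximation can be done with squared norms throughout.\<close>

lemma integral_norm_add_square_le:
  assumes "f \<in> L2 M" "g \<in> L2 M"
  shows "(LINT z|M. (norm (f z + g z))\<^sup>2) \<le>
    2 * (LINT z|M. (norm (f z))\<^sup>2) + 2 * (LINT z|M. (norm (g z))\<^sup>2)"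
proof -
  have "(LINT z|M. (norm (f z + g z))\<^sup>2) \<le>
      (LINT z|M. 2 * (norm (f z))\<^sup>2 + 2 * (norm (g z))\<^sup>2)"
  proof (rule integral_mono)
    show "integrable M (\<lambda>z. (norm (f z + g z))\<^sup>2)"
      by (intro L2D L2_add assms)
    show "integrable M (\<lambda>z. 2 * (norm (f z))\<^sup>2 + 2 * (norm (g z))\<^sup>2)"
      using assms by (intro Bochner_Integration.integrable_add integrable_mult_right L2D)
    fix z
    have "(norm (f z + g z))\<^sup>2 \<le> (norm (f z) + norm (g z))\<^sup>2"
      by (intro power_mono norm_triangle_ineq) auto
    also have "\<dots> \<le> 2 * (norm (f z))\<^sup>2 + 2 * (norm (g z))\<^sup>2"
      using sum_squares_bound[of "norm (f z)" "norm (g z)"] by (simp add: power2_sum)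
    finally show "(norm (f z + g z))\<^sup>2 \<le> 2 * (norm (f z))\<^sup>2 + 2 * (norm (g z))\<^sup>2" .
  qed
  also have "\<dots> = 2 * (LINT z|M. (norm (f z))\<^sup>2) + 2 * (LINT z|M. (norm (g z))\<^sup>2)"
    using assms by (simp add: L2D)
  finally show ?thesis .
qed

subsection \<open>Integration by parts against the Gaussian weight\<close>

lemma sets_gauss [simp, measurable_cong]: "sets (gauss_measure \<nu>) = sets borel"
  by (simp add: gauss_measure_def)

lemma borel_measurable_gauss:
  "borel_measurable (gauss_measure \<nu>) = (borel_measurable borel :: (complex \<Rightarrow> 'b::topological_space) set)"
  by (simp cong: measurable_cong_sets)

lemma gauss_integrable_iff:
  fixes f :: "complex \<Rightarrow> 'b::{banach, second_countable_topology}"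
  assumes "f \<in> borel_measurable borel"
  shows "integrable (gauss_measure \<nu>) f \<longleftrightarrow>
    integrable lborel (\<lambda>z. exp (- \<nu> * (norm z)\<^sup>2) *\<^sub>R f z)"
  unfolding gauss_measure_def using assms by (intro integrable_density) auto

lemma gauss_integral:
  fixes f :: "complex \<Rightarrow> 'b::{banach, second_countable_topology}"
  assumes "f \<in> borel_measurable borel"
  shows "integral\<^sup>L (gauss_measure \<nu>) f = (LINT z|lborel. exp (- \<nu> * (norm z)\<^sup>2) *\<^sub>R f z)"
  unfolding gauss_measure_def using assms by (intro integral_density) auto

lemma integrable_continuous_compact_support:
  fixes f :: "complex \<Rightarrow> 'b::{banach, second_countable_topology}"
  assumes "continuous_on UNIV f" "\<And>z. R \<le> norm z \<Longrightarrow> f z = 0"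
  shows "integrable lborel f"
proof -
  have "integrable lborel (\<lambda>z. indicator (cball 0 R) z *\<^sub>R f z)"
    using assms(1) by (intro borel_integrable_compact) (auto intro: continuous_on_subset)
  moreover have "(\<lambda>z. indicator (cball 0 R) z *\<^sub>R f z) = f"
    using assms(2) by (auto simp: fun_eq_iff indicator_def)
  ultimately show ?thesis by simp
qed

lemma gauss_integrable_compact_support:
  fixes f :: "complex \<Rightarrow> 'b::{banach, second_countable_topology}"
  assumes "continuous_on UNIV f" "\<And>z. R \<le> norm z \<Longrightarrow> f z = 0"
  shows "integrable (gauss_measure \<nu>) f"
  using assms by (subst gauss_integrable_iff)
    (auto intro!: borel_measurable_continuous_onI integrable_continuous_compact_support[of _ R]
      continuous_intros)

lemma lborel_integral_translate:
  fixes f :: "'a::euclidean_space \<Rightarrow> 'b::{banach, second_countable_topology}"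
  assumes "f \<in> borel_measurable borel"
  shows "(LINT x|lborel. f (c + x)) = (LINT x|lborel. f x)"
    "integrable lborel (\<lambda>x. f (c + x)) \<longleftrightarrow> integrable lborel f"
  using integral_distr[of "(+) c" lborel borel f] integrable_distr_eq[of "(+) c" lborel borel f] assms
  by (simp_all add: lborel_distr_plus)

text \<open>The derivative is taken along the steps 1/(n+1) because dominated convergence is applied
  to a sequence of difference quotients.\<close>

lemma has_vector_derivative_quotient_LIMSEQ:
  fixes g :: "real \<Rightarrow> 'a::real_normed_vector"
  assumes "(g has_vector_derivative D) (at 0)"
  shows "(\<lambda>n. real (Suc n) *\<^sub>R (g (1 / real (Suc n)) - g 0)) \<longlonglongrightarrow> D"
proof -
  have "((\<lambda>h. norm (g (0 + h) - g 0 - h *\<^sub>R D) / norm h) \<longlongrightarrow> 0) (at 0)"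
    using assms by (simp add: has_vector_derivative_def has_derivative_at)
  moreover have "filterlim (\<lambda>n. 1 / real (Suc n)) (at 0) sequentially"
    by (rule filterlim_atI[OF LIMSEQ_Suc[OF lim_1_over_n]]) auto
  ultimately have "(\<lambda>n. norm (g (0 + 1 / real (Suc n)) - g 0 - (1 / real (Suc n)) *\<^sub>R D)
      / norm (1 / real (Suc n))) \<longlonglongrightarrow> 0"
    using filterlim_compose by blast
  moreover have "norm (g (0 + 1 / real (Suc n)) - g 0 - (1 / real (Suc n)) *\<^sub>R D)
      / norm (1 / real (Suc n)) = norm (real (Suc n) *\<^sub>R (g (1 / real (Suc n)) - g 0) - D)" for n
  proof -
    have "real (Suc n) *\<^sub>R (g (1 / real (Suc n)) - g 0) - D =
      real (Suc n) *\<^sub>R (g (0 + 1 / real (Suc n)) - g 0 - (1 / real (Suc n)) *\<^sub>R D)"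
      by (simp add: scaleR_diff_right)
    then show ?thesis by simp
  qed
  ultimately show ?thesis
    by (simp only: tendsto_norm_zero_iff LIM_zero_iff)
qed

text \<open>Integrating the difference quotient gives zero by translation invariance, so no iterated
  integrals are needed.\<close>

lemma integral_directional_derivative_zero:
  fixes U :: "complex \<Rightarrow> complex"
  assumes U: "\<And>z. has_wirt U (a z) (b z) z" and cont: "continuous_on UNIV a" "continuous_on UNIV b"
    and supp: "\<And>z. R \<le> norm z \<Longrightarrow> U z = 0 \<and> a z = 0 \<and> b z = 0"
  shows "(LINT z|lborel. a z * v + b z * cnj v) = 0"
proof -
  let ?D = "\<lambda>z. a z * v + b z * cnj v"
  \<comment> \<open>All steps have length at most \<open>norm v\<close>, so every difference
    quotient of a function supported in the ball of radius R vanishes outside this larger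
    ball.\<close>
  define S where "S = cball (0::complex) (R + norm v)"
  have contD: "continuous_on UNIV ?D" by (intro continuous_intros cont)
  obtain B where B: "\<And>z. norm (?D z) \<le> B"
  proof -
    have "bounded (?D ` cball 0 R)"
      using contD by (intro compact_imp_bounded compact_continuous_image) (auto intro: continuous_on_subset)
    then obtain B where "\<forall>z\<in>cball 0 R. norm (?D z) \<le> B"
      unfolding bounded_iff by auto
    then have "norm (?D z) \<le> max B 0" for z
      using supp[of z] by (cases "norm z \<le> R") (auto simp: max.coboundedI1)
    then show ?thesis using that by blast
  qed
  have diff: "U differentiable (at z)" for z using has_wirtD(3)[OF U] .
  have contU: "continuous_on UNIV U"
    by (simp add: continuous_at_imp_continuous_on diff differentiable_imp_continuous_within)
  have F: "frechet_derivative U (at z) v = ?D z" for z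
    using frechet_derivative_wirt[OF diff] has_wirtD(1,2)[OF U] by simp
  have along: "((\<lambda>\<sigma>. U (z + \<sigma> *\<^sub>R v)) has_vector_derivative ?D (z + \<sigma> *\<^sub>R v)) (at \<sigma>)" for z \<sigma>
    using has_vector_derivative_along[where p = z and a = v and g = U, OF diff] unfolding F .
  let ?s = "\<lambda>n z. real (Suc n) *\<^sub>R (U (z + (1 / real (Suc n)) *\<^sub>R v) - U z)"
  have measU: "U \<in> borel_measurable borel" using contU by (rule borel_measurable_continuous_onI)
  have "(\<lambda>n. LINT z|lborel. ?s n z) \<longlonglongrightarrow> (LINT z|lborel. ?D z)"
  proof (rule integral_dominated_convergence[where w = "\<lambda>z. indicator S z *\<^sub>R B"])
    show "?D \<in> borel_measurable lborel"
      using contD by (simp add: borel_measurable_continuous_onI)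
    show "?s n \<in> borel_measurable lborel" for n
      using measU by measurable
    show "integrable lborel (\<lambda>z. indicator S z *\<^sub>R B)"
      unfolding S_def by (intro borel_integrable_compact) auto
    show "AE z in lborel. (\<lambda>n. ?s n z) \<longlonglongrightarrow> ?D z"
      using has_vector_derivative_quotient_LIMSEQ[OF along[of _ 0, simplified]] by simp
    have "norm (?s n z) \<le> indicator S z *\<^sub>R B" for n z
    proof (cases "z \<in> S")
      case True
      let ?t = "1 / real (Suc n)"
      have "norm (U (z + ?t *\<^sub>R v) - U (z + 0 *\<^sub>R v) - ?t *\<^sub>R 0) \<le> ?t * B"
        by (rule vector_mean_value_bound[where G = "\<lambda>\<sigma>. U (z + \<sigma> *\<^sub>R v)"], simp, rule along)
          (use B in simp)
      then have "real (Suc n) * norm (U (z + ?t *\<^sub>R v) - U z) \<le> real (Suc n) * (?t * B)"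
        by (intro mult_left_mono) auto
      then show ?thesis using True by simp
    next
      case False
      let ?t = "1 / real (Suc n)"
      have far: "R + norm v < norm z" using False by (simp add: S_def)
      have "norm (?t *\<^sub>R v) \<le> norm v"
        by (simp add: field_simps mult_left_le)
      moreover have "norm z \<le> norm (z + ?t *\<^sub>R v) + norm (?t *\<^sub>R v)"
        using norm_triangle_ineq4[of "z + ?t *\<^sub>R v" "?t *\<^sub>R v"] by simp
      ultimately have "R \<le> norm (z + ?t *\<^sub>R v)" using far by linarith
      moreover have "R \<le> norm z" using far norm_ge_zero[of v] by linarith
      ultimately show ?thesis using supp False by simp
    qed
    then show "AE z in lborel. norm (?s n z) \<le> indicator S z *\<^sub>R B" for n by simp
  qed
  moreover have "(LINT z|lborel. ?s n z) = 0" for n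
  proof -
    have i: "integrable lborel U"
      using contU supp by (intro integrable_continuous_compact_support[of _ R]) auto
    let ?c = "(1 / real (Suc n)) *\<^sub>R v"
    have "integrable lborel (\<lambda>z. U (?c + z))" "(LINT z|lborel. U (?c + z)) = (LINT z|lborel. U z)"
      using lborel_integral_translate[OF measU] i by auto
    then show ?thesis using i by (simp add: add.commute)
  qed
  ultimately show ?thesis by (simp add: LIMSEQ_const_iff)
qed

text \<open>The directions 1 and the imaginary unit give two independent linear equations for the
  integrals of a and b, which force both to vanish.\<close>

lemma integral_wirt_bar_zero:
  fixes U :: "complex \<Rightarrow> complex"
  assumes U: "\<And>z. has_wirt U (a z) (b z) z" and cont: "continuous_on UNIV a" "continuous_on UNIV b"
    and supp: "\<And>z. R \<le> norm z \<Longrightarrow> U z = 0 \<and> a z = 0 \<and> b z = 0"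
  shows "(LINT z|lborel. b z) = 0"
proof -
  have i: "integrable lborel a" "integrable lborel b"
    using cont supp by (auto intro!: integrable_continuous_compact_support[of _ R])
  have D: "(LINT z|lborel. a z * v + b z * cnj v) = 0" for v
    by (rule integral_directional_derivative_zero[where R = R, OF U cont]) (use supp in blast)
  have "(LINT z|lborel. a z) + (LINT z|lborel. b z) = 0"
    using D[of 1] i by simp
  moreover have "(LINT z|lborel. a z) * \<i> - (LINT z|lborel. b z) * \<i> = 0"
    using D[of \<i>] i by simp
  then have "(LINT z|lborel. a z) = (LINT z|lborel. b z)"
    by (simp flip: left_diff_distrib)
  ultimately show ?thesis by simp
qed

text \<open>The square of this cutoff is once continuously differentiable, and its gradient is bounded by
  a multiple of the cutoff itself, which lets the error term be absorbed in the energy bound.\<close>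

definition cutoff :: "real \<Rightarrow> complex \<Rightarrow> real" where
  "cutoff R z = max 0 (1 - (norm z)\<^sup>2 / R\<^sup>2)"

lemma cutoff_bounds: "0 \<le> cutoff R z" "cutoff R z \<le> 1"
  by (auto simp: cutoff_def)

lemma cutoff_eq_0: "0 < R \<Longrightarrow> R \<le> norm z \<Longrightarrow> cutoff R z = 0"
  by (simp add: cutoff_def field_simps power_mono)

lemma continuous_on_cutoff: "0 < R \<Longrightarrow> continuous_on UNIV (cutoff R)"
  unfolding cutoff_def [abs_def] by (intro continuous_intros) auto

lemma cutoff_mult_norm_le:
  assumes "1 \<le> R"
  shows "2 * cutoff R z * norm z / R\<^sup>2 \<le> 2 / R * cutoff R z"
proof (cases "norm z \<le> R")
  case True
  have "cutoff R z * norm z \<le> cutoff R z * R"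
    using True cutoff_bounds by (intro mult_left_mono)
  then have "2 * cutoff R z * norm z / R\<^sup>2 \<le> 2 * (cutoff R z * R) / R\<^sup>2"
    using assms by (intro divide_right_mono) auto
  then show ?thesis using assms by (simp add: power2_eq_square)
next
  case False
  then show ?thesis using assms cutoff_eq_0[of R z] by simp
qed

lemma cutoff_LIMSEQ: "(\<lambda>n. cutoff (real (Suc n)) z) \<longlonglongrightarrow> 1"
proof -
  have "(\<lambda>n. max 0 (1 - (norm z)\<^sup>2 * (1 / real (Suc n))\<^sup>2)) \<longlonglongrightarrow> max 0 (1 - (norm z)\<^sup>2 * 0\<^sup>2)"
    by (intro tendsto_intros LIMSEQ_Suc[OF lim_1_over_n])
  then show ?thesis by (simp add: cutoff_def power_divide)
qed

text \<open>Squaring removes the kink of the positive part: at 0 the difference quotient is bounded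
  by |h|.\<close>

lemma has_derivative_max_square:
  "((\<lambda>t. (max 0 t)\<^sup>2) has_real_derivative 2 * max 0 t) (at t)"
proof (cases t "0::real" rule: linorder_cases)
  case less
  have "((\<lambda>t. 0) has_real_derivative 2 * max 0 t) (at t)"
    using less by (auto intro!: derivative_eq_intros)
  then show ?thesis
    by (rule has_field_derivative_transform_within_open[where S = "{..<0}"]) (use less in auto)
next
  case equal
  have "((\<lambda>h. (max 0 h)\<^sup>2 / h) \<longlongrightarrow> 0) (at (0::real))"
  proof (rule Lim_null_comparison)
    show "((\<lambda>h::real. \<bar>h\<bar>) \<longlongrightarrow> 0) (at 0)"
      using tendsto_rabs[OF tendsto_ident_at, of 0 UNIV] by simp
    show "\<forall>\<^sub>F h::real in at 0. norm ((max 0 h)\<^sup>2 / h) \<le> \<bar>h\<bar>"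
      by (rule always_eventually) (auto simp: max_def power2_eq_square)
  qed
  then show ?thesis using equal by (simp add: DERIV_def)
next
  case greater
  have "((\<lambda>t. t\<^sup>2) has_real_derivative 2 * max 0 t) (at t)"
    using greater by (auto intro!: derivative_eq_intros)
  then show ?thesis
    by (rule has_field_derivative_transform_within_open[where S = "{0<..}"]) (use greater in auto)
qed

text \<open>This is \<open>wirt_bar\<close> of the squared cutoff. It keeps one factor
  \<open>cutoff R z\<close>, which is what the energy estimate absorbs.\<close>

definition cutoff_bar :: "real \<Rightarrow> complex \<Rightarrow> complex" where
  "cutoff_bar R z = - of_real (2 * cutoff R z / R\<^sup>2) * z"

lemma norm_cutoff_bar_le: "1 \<le> R \<Longrightarrow> norm (cutoff_bar R z) \<le> 2 / R * cutoff R z"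
  using cutoff_mult_norm_le[of R z] cutoff_bounds[of R z]
  by (simp add: cutoff_bar_def norm_mult norm_divide norm_power)

lemma has_wirt_cutoff_square:
  assumes "0 < R"
  shows "has_wirt (\<lambda>z. of_real ((cutoff R z)\<^sup>2)) (cnj (cutoff_bar R z)) (cutoff_bar R z) z"
proof -
  have "((\<lambda>z. z \<bullet> z) has_derivative (\<lambda>h. 2 * (z \<bullet> h))) (at z)"
    by (auto intro!: derivative_eq_intros simp: inner_commute)
  then have "((\<lambda>z. 1 - (1 / R\<^sup>2) * (z \<bullet> z)) has_derivative (\<lambda>h. 0 - (1 / R\<^sup>2) * (2 * (z \<bullet> h)))) (at z)"
    by (intro has_derivative_diff has_derivative_const has_derivative_mult_right)
  then have "((\<lambda>z. 1 - (norm z)\<^sup>2 / R\<^sup>2) has_derivative (\<lambda>h. - (2 * (z \<bullet> h) / R\<^sup>2))) (at z)"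
    by (simp add: power2_norm_eq_inner)
  then have "((\<lambda>z. (max 0 (1 - (norm z)\<^sup>2 / R\<^sup>2))\<^sup>2) has_derivative
      (\<lambda>h. 2 * cutoff R z * - (2 * (z \<bullet> h) / R\<^sup>2))) (at z)"
    unfolding cutoff_def
    by (rule has_derivative_compose[OF _ has_derivative_max_square[unfolded has_field_derivative_def]])
  then have "((\<lambda>z. of_real ((cutoff R z)\<^sup>2) :: complex) has_derivative
      (\<lambda>h. of_real (2 * cutoff R z * - (2 * (z \<bullet> h) / R\<^sup>2)))) (at z)"
    unfolding cutoff_def by (rule bounded_linear.has_derivative[OF bounded_linear_of_real])
  moreover have "(\<lambda>h. of_real (2 * cutoff R z * - (2 * (z \<bullet> h) / R\<^sup>2))) =
      (\<lambda>h. cnj (cutoff_bar R z) * h + cutoff_bar R z * cnj h)"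
    using assms
    by (intro ext) (simp add: cutoff_bar_def complex_eq_iff inner_complex_def field_simps)
  ultimately show ?thesis by (simp add: has_wirt_def)
qed

lemma has_wirt_gauss:
  "has_wirt (\<lambda>z. of_real (exp (- \<nu> * (norm z)\<^sup>2)))
    (- of_real \<nu> * cnj z * of_real (exp (- \<nu> * (norm z)\<^sup>2)))
    (- of_real \<nu> * z * of_real (exp (- \<nu> * (norm z)\<^sup>2))) z"
proof -
  have e: "complex_of_real (exp (- \<nu> * (norm z)\<^sup>2)) = exp (- of_real \<nu> * (z * cnj z))" for z
    unfolding complex_norm_square[symmetric] exp_of_real[symmetric] by simp
  have "has_wirt (\<lambda>z. - of_real \<nu> * (z * cnj z)) (- of_real \<nu> * (1 * cnj z + z * 0))
      (- of_real \<nu> * (0 * cnj z + z * 1)) z"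
    by (intro has_wirt_cmult has_wirt_mult has_wirt_ident has_wirt_cnj_ident)
  from has_wirt_chain[OF this DERIV_exp] show ?thesis
    unfolding e by (simp add: algebra_simps)
qed

text \<open>The formal adjoint of \<open>wirt_bar\<close> for the weight \<open>exp (- \<nu> |z|\<^sup>2)\<close>.\<close>

definition creation :: "real \<Rightarrow> (complex \<Rightarrow> complex) \<Rightarrow> complex \<Rightarrow> complex" where
  "creation \<nu> v z = - wirt v z + of_real \<nu> * cnj z * v z"

lemma continuous_on_creation:
  assumes "Ck (Suc 0) v"
  shows "continuous_on UNIV (creation \<nu> v)"
proof -
  have "continuous_on UNIV v" "continuous_on UNIV (wirt v)"
    using assms Ck_mono[OF assms] by simp_all
  then show ?thesis
    unfolding creation_def [abs_def] by (intro continuous_intros)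
qed

text \<open>The \<open>wirt_bar\<close> derivative of cutoff^2 u cnj v times the weight integrates
  to zero. The parts where it falls on cnj v and on the weight combine into the conjugate of
  \<open>creation \<nu> v\<close>; the part where it falls on the cutoff is the error term.\<close>

lemma gauss_integration_by_parts:
  fixes u v :: "complex \<Rightarrow> complex"
  assumes u: "Ck (Suc 0) u" and v: "Ck (Suc 0) v" and R: "0 < R"
  shows "(LINT z|gauss_measure \<nu>. of_real ((cutoff R z)\<^sup>2) * (wirt_bar u z * cnj (v z))) =
    (LINT z|gauss_measure \<nu>. of_real ((cutoff R z)\<^sup>2) * (u z * cnj (creation \<nu> v z))) -
    (LINT z|gauss_measure \<nu>. cutoff_bar R z * (u z * cnj (v z)))"
proof -
  let ?w = "\<lambda>z. complex_of_real (exp (- \<nu> * (norm z)\<^sup>2))"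
  let ?e = "\<lambda>z. complex_of_real ((cutoff R z)\<^sup>2)"
  have cu: "continuous_on UNIV u" "continuous_on UNIV v" "continuous_on UNIV (wirt u)"
    "continuous_on UNIV (wirt_bar u)" "continuous_on UNIV (wirt v)" "continuous_on UNIV (wirt_bar v)"
    using u v Ck_mono[OF u] Ck_mono[OF v] by simp_all
  have cc: "continuous_on UNIV (cutoff R)" "continuous_on UNIV (cutoff_bar R)"
    using R continuous_on_cutoff[OF R] unfolding cutoff_bar_def [abs_def]
    by (auto intro!: continuous_intros)
  note cont = cu cc continuous_on_creation[OF v, of \<nu>]
  have zero: "cutoff R z = 0" "cutoff_bar R z = 0" if "R \<le> norm z" for z
    using cutoff_eq_0[OF R that] by (auto simp: cutoff_bar_def)
  let ?U = "\<lambda>z. ?e z * ((u z * cnj (v z)) * ?w z)"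
  let ?P = "\<lambda>z. (wirt u z * cnj (v z) + u z * cnj (wirt_bar v z)) * ?w z + u z * cnj (v z) * (- of_real \<nu> * cnj z * ?w z)"
  let ?Q = "\<lambda>z. (wirt_bar u z * cnj (v z) + u z * cnj (wirt v z)) * ?w z + u z * cnj (v z) * (- of_real \<nu> * z * ?w z)"
  have hw: "has_wirt ?U (cnj (cutoff_bar R z) * ((u z * cnj (v z)) * ?w z) + ?e z * ?P z)
      (cutoff_bar R z * ((u z * cnj (v z)) * ?w z) + ?e z * ?Q z) z" for z
    by (intro has_wirt_mult has_wirt_cutoff_square R has_wirt_cnj has_wirt_gauss Ck_SucD[OF u] Ck_SucD[OF v])
  have "(LINT z|lborel. cutoff_bar R z * ((u z * cnj (v z)) * ?w z) + ?e z * ?Q z) = 0"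
    by (rule integral_wirt_bar_zero[OF hw, of R]) (auto intro!: continuous_intros cont simp: zero)
  also have "(\<lambda>z. cutoff_bar R z * ((u z * cnj (v z)) * ?w z) + ?e z * ?Q z) =
    (\<lambda>z. exp (- \<nu> * (norm z)\<^sup>2) *\<^sub>R (cutoff_bar R z * (u z * cnj (v z)) +
       ?e z * (wirt_bar u z * cnj (v z)) - ?e z * (u z * cnj (creation \<nu> v z))))"
    by (intro ext) (simp add: creation_def scaleR_conv_of_real algebra_simps)
  also have "(LINT z|lborel. \<dots> z) = (LINT z|gauss_measure \<nu>. cutoff_bar R z * (u z * cnj (v z)) +
       ?e z * (wirt_bar u z * cnj (v z)) - ?e z * (u z * cnj (creation \<nu> v z)))"
    by (rule gauss_integral[symmetric])
      (intro borel_measurable_continuous_onI continuous_intros cont)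
  also have "\<dots> = (LINT z|gauss_measure \<nu>. cutoff_bar R z * (u z * cnj (v z))) +
       (LINT z|gauss_measure \<nu>. ?e z * (wirt_bar u z * cnj (v z))) -
       (LINT z|gauss_measure \<nu>. ?e z * (u z * cnj (creation \<nu> v z)))"
  proof -
    have "integrable (gauss_measure \<nu>) (\<lambda>z. cutoff_bar R z * (u z * cnj (v z)))"
      by (rule gauss_integrable_compact_support[of _ R]) (auto intro!: continuous_intros cont simp: zero)
    moreover have "integrable (gauss_measure \<nu>) (\<lambda>z. ?e z * (wirt_bar u z * cnj (v z)))"
      by (rule gauss_integrable_compact_support[of _ R]) (auto intro!: continuous_intros cont simp: zero)
    moreover have "integrable (gauss_measure \<nu>) (\<lambda>z. ?e z * (u z * cnj (creation \<nu> v z)))"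
      by (rule gauss_integrable_compact_support[of _ R]) (auto intro!: continuous_intros cont simp: zero)
    ultimately show ?thesis by simp
  qed
  finally show ?thesis by (simp add: algebra_simps eq_diff_eq)
qed

lemma continuous_on_cutoff_bar: "0 < R \<Longrightarrow> continuous_on UNIV (cutoff_bar R)"
  using continuous_on_cutoff[of R] unfolding cutoff_bar_def [abs_def]
  by (auto intro!: continuous_intros)

text \<open>A Caccioppoli estimate: it is what makes an eigenfunction that is merely square integrable
  have square integrable images under the ladder operators.\<close>

lemma cutoff_energy_bound:
  fixes p u r F H :: "complex \<Rightarrow> complex"
  assumes cont: "continuous_on UNIV p" "continuous_on UNIV u" "continuous_on UNIV r"
      "continuous_on UNIV F" "continuous_on UNIV H"
    and L2: "u \<in> L2 (gauss_measure \<nu>)" "r \<in> L2 (gauss_measure \<nu>)"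
    and energy: "\<And>R. 1 \<le> R \<Longrightarrow>
      (LINT z|gauss_measure \<nu>. of_real ((cutoff R z)\<^sup>2) * (p z * cnj (p z))) =
      (LINT z|gauss_measure \<nu>. of_real ((cutoff R z)\<^sup>2) * F z) -
      (LINT z|gauss_measure \<nu>. cutoff_bar R z * H z)"
    and F: "\<And>z. norm (F z) \<le> norm (u z) * norm (r z)"
    and H: "\<And>z. norm (H z) \<le> norm (u z) * norm (p z)"
  shows "p \<in> L2 (gauss_measure \<nu>)"
proof -
  let ?M = "gauss_measure \<nu>"
  \<comment> \<open>The constants come from |u| |r| <= (|u|^2 + |r|^2) / 2 and, with c the cutoff, 2
    c |u| |p| <= 2 |u|^2 + c^2 |p|^2 / 2. Thus 5/2 = 1/2 + 2, and half of the energy itself remains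
    on the right.\<close>
  define C where "C = (LINT z|?M. (norm (r z))\<^sup>2 / 2 + 5 / 2 * (norm (u z))\<^sup>2)"
  have intC: "integrable ?M (\<lambda>z. (norm (r z))\<^sup>2 / 2 + 5 / 2 * (norm (u z))\<^sup>2)"
    using L2 by (intro Bochner_Integration.integrable_add integrable_divide integrable_mult_right L2D)
  have zero: "cutoff R z = 0" "cutoff_bar R z = 0" if "1 \<le> R" "R \<le> norm z" for R z
    using cutoff_eq_0[of R z] that by (auto simp: cutoff_bar_def)
  have contb: "continuous_on UNIV (cutoff R)" "continuous_on UNIV (cutoff_bar R)" if "1 \<le> R" for R
    using that by (auto intro: continuous_on_cutoff continuous_on_cutoff_bar)
  have int: "integrable ?M (\<lambda>z. (cutoff R z)\<^sup>2 * (norm (p z))\<^sup>2)" if "1 \<le> R" for R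
    by (rule gauss_integrable_compact_support[of _ R])
      (auto intro!: continuous_intros cont contb that simp: zero that)
  have bound: "(LINT z|?M. (cutoff R z)\<^sup>2 * (norm (p z))\<^sup>2) \<le> 2 * C" if R: "1 \<le> R" for R
  proof -
    let ?J = "LINT z|?M. (cutoff R z)\<^sup>2 * (norm (p z))\<^sup>2"
    have i1: "integrable ?M (\<lambda>z. norm (of_real ((cutoff R z)\<^sup>2) * F z))"
      by (rule gauss_integrable_compact_support[of _ R])
        (auto intro!: continuous_intros cont contb R simp: zero R)
    have i2: "integrable ?M (\<lambda>z. norm (cutoff_bar R z * H z))"
      by (rule gauss_integrable_compact_support[of _ R])
        (auto intro!: continuous_intros cont contb R simp: zero R)
    have "(LINT z|?M. of_real ((cutoff R z)\<^sup>2) * (p z * cnj (p z))) = complex_of_real ?J"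
      unfolding integral_complex_of_real[symmetric]
      by (simp add: complex_norm_square[symmetric] del: of_real_power)
    moreover have "0 \<le> ?J" by simp
    ultimately have "?J = norm (LINT z|?M. of_real ((cutoff R z)\<^sup>2) * (p z * cnj (p z)))"
      by simp
    also have "\<dots> \<le> norm (LINT z|?M. of_real ((cutoff R z)\<^sup>2) * F z) +
        norm (LINT z|?M. cutoff_bar R z * H z)"
      unfolding energy[OF R] by (rule norm_triangle_ineq4)
    also have "\<dots> \<le> (LINT z|?M. norm (of_real ((cutoff R z)\<^sup>2) * F z)) +
        (LINT z|?M. norm (cutoff_bar R z * H z))"
      by (intro add_mono integral_norm_bound)
    also have "\<dots> = (LINT z|?M. norm (of_real ((cutoff R z)\<^sup>2) * F z) + norm (cutoff_bar R z * H z))"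
      using i1 i2 by simp
    also have "\<dots> \<le> (LINT z|?M. ((norm (r z))\<^sup>2 / 2 + 5 / 2 * (norm (u z))\<^sup>2) +
        1 / 2 * ((cutoff R z)\<^sup>2 * (norm (p z))\<^sup>2))"
    proof (rule integral_mono)
      show "integrable ?M (\<lambda>z. norm (of_real ((cutoff R z)\<^sup>2) * F z) + norm (cutoff_bar R z * H z))"
        using i1 i2 by (rule Bochner_Integration.integrable_add)
      show "integrable ?M (\<lambda>z. ((norm (r z))\<^sup>2 / 2 + 5 / 2 * (norm (u z))\<^sup>2) +
          1 / 2 * ((cutoff R z)\<^sup>2 * (norm (p z))\<^sup>2))"
        by (intro Bochner_Integration.integrable_add[OF intC] integrable_mult_right int R)
      fix z
      let ?c = "cutoff R z"
      have c: "0 \<le> ?c" "?c \<le> 1" by (rule cutoff_bounds)+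
      have "norm (of_real (?c\<^sup>2) * F z) \<le> 1 * (norm (u z) * norm (r z))"
        unfolding norm_mult using c F by (intro mult_mono) (auto simp: power_le_one norm_power)
      moreover have "2 * (norm (u z) * norm (r z)) \<le> (norm (u z))\<^sup>2 + (norm (r z))\<^sup>2"
        using sum_squares_bound[of "norm (u z)" "norm (r z)"] by simp
      moreover have "norm (cutoff_bar R z * H z) \<le> (2 * ?c) * (norm (u z) * norm (p z))"
      proof -
        have "2 / R * ?c \<le> 2 * ?c" using R c by (intro mult_right_mono) (auto simp: field_simps)
        then have "norm (cutoff_bar R z) \<le> 2 * ?c" using norm_cutoff_bar_le[OF R, of z] by linarith
        then show ?thesis unfolding norm_mult using H c by (intro mult_mono) auto
      qed
      moreover have "(2 * ?c) * (norm (u z) * norm (p z)) \<le>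
          2 * (norm (u z))\<^sup>2 + 1 / 2 * (?c\<^sup>2 * (norm (p z))\<^sup>2)"
        using sum_squares_bound[of "2 * norm (u z)" "?c * norm (p z)"]
        by (simp add: power_mult_distrib algebra_simps)
      ultimately show "norm (of_real (?c\<^sup>2) * F z) + norm (cutoff_bar R z * H z) \<le>
          ((norm (r z))\<^sup>2 / 2 + 5 / 2 * (norm (u z))\<^sup>2) + 1 / 2 * (?c\<^sup>2 * (norm (p z))\<^sup>2)"
        by linarith
    qed
    also have "\<dots> = C + 1 / 2 * ?J"
      unfolding C_def
      using intC int[OF R] by (subst Bochner_Integration.integral_add) (auto simp del: integral_divide_zero)
    \<comment> \<open>The chain reads J <= C + J/2; the compact support of the cutoff makes J the
      integral of an integrable function, so J/2 can be absorbed.\<close>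
    finally show ?thesis by linarith
  qed
  \<comment> \<open>The bound does not depend on R, so the cutoff can be released.\<close>
  have "integrable ?M (\<lambda>z. (norm (p z))\<^sup>2)"
  proof (rule Fatou_integral(1)[where C = "2 * C" and s = "\<lambda>n z. (cutoff (real (Suc n)) z)\<^sup>2 * (norm (p z))\<^sup>2"])
    show "(\<lambda>n. (cutoff (real (Suc n)) z)\<^sup>2 * (norm (p z))\<^sup>2) \<longlonglongrightarrow> (norm (p z))\<^sup>2" for z
      using tendsto_mult[OF tendsto_power[OF cutoff_LIMSEQ[of z], of 2] tendsto_const[of "(norm (p z))\<^sup>2"]] by simp
  qed (use bound int in auto)
  moreover have "p \<in> borel_measurable ?M"
    using cont(1) by (simp add: borel_measurable_gauss borel_measurable_continuous_onI)
  ultimately show ?thesis by (simp add: L2_def)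
qed

section \<open>Square integrability of ladder images and adjointness on the whole plane\<close>

lemma smooth_creation: "smooth u \<Longrightarrow> smooth (creation \<nu> u)"
  unfolding creation_def [abs_def]
  by (intro smooth_add smooth_minus smooth_mult smooth_const smooth_cnj_ident smooth_wirt)

text \<open>Integrating by parts with v = \<open>wirt_bar u\<close> turns the energy of
  \<open>wirt_bar u\<close> into the pairing of u with \<open>creation \<nu> (wirt_bar u)\<close>,
  as the energy estimate requires.\<close>

lemma wirt_bar_L2:
  assumes "smooth u" "u \<in> L2 (gauss_measure \<nu>)" "creation \<nu> (wirt_bar u) \<in> L2 (gauss_measure \<nu>)"
  shows "wirt_bar u \<in> L2 (gauss_measure \<nu>)"
proof (rule cutoff_energy_bound[where F = "\<lambda>z. u z * cnj (creation \<nu> (wirt_bar u) z)"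
      and H = "\<lambda>z. u z * cnj (wirt_bar u z)" and u = u and r = "creation \<nu> (wirt_bar u)"])
  show "(LINT z|gauss_measure \<nu>. of_real ((cutoff R z)\<^sup>2) * (wirt_bar u z * cnj (wirt_bar u z))) =
      (LINT z|gauss_measure \<nu>. of_real ((cutoff R z)\<^sup>2) * (u z * cnj (creation \<nu> (wirt_bar u) z))) -
      (LINT z|gauss_measure \<nu>. cutoff_bar R z * (u z * cnj (wirt_bar u z)))" if "1 \<le> R" for R
    using that by (intro gauss_integration_by_parts smooth_Ck smooth_wirt_bar assms) auto
qed (use assms in \<open>auto intro!: smooth_continuous smooth_minus smooth_mult smooth_cnj smooth_wirt_bar smooth_creation
  simp: norm_mult mult.commute\<close>)

text \<open>Here \<open>creation \<nu> u\<close> is the first function and u the second in the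
  integration by parts. The energy then stands on the right-hand side, so the boundary term changes
  sign; hence the minus in H.\<close>

lemma creation_L2:
  assumes "smooth u" "u \<in> L2 (gauss_measure \<nu>)" "wirt_bar (creation \<nu> u) \<in> L2 (gauss_measure \<nu>)"
  shows "creation \<nu> u \<in> L2 (gauss_measure \<nu>)"
proof (rule cutoff_energy_bound[where F = "\<lambda>z. wirt_bar (creation \<nu> u) z * cnj (u z)"
      and H = "\<lambda>z. - (creation \<nu> u z * cnj (u z))" and u = u and r = "wirt_bar (creation \<nu> u)"])
  show "(LINT z|gauss_measure \<nu>. of_real ((cutoff R z)\<^sup>2) * (creation \<nu> u z * cnj (creation \<nu> u z))) =
      (LINT z|gauss_measure \<nu>. of_real ((cutoff R z)\<^sup>2) * (wirt_bar (creation \<nu> u) z * cnj (u z))) -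
      (LINT z|gauss_measure \<nu>. cutoff_bar R z * - (creation \<nu> u z * cnj (u z)))" if "1 \<le> R" for R
  proof -
    have "0 < R" using that by simp
    then show ?thesis
      using gauss_integration_by_parts[OF smooth_Ck[OF smooth_creation[OF assms(1)]] smooth_Ck[OF assms(1)],
          of R \<nu>]
      by (simp del: of_real_power)
  qed
qed (use assms in \<open>auto intro!: smooth_continuous smooth_minus smooth_mult smooth_cnj smooth_wirt_bar smooth_creation
  simp: norm_mult mult.commute\<close>)

text \<open>The limit of the integration by parts formula as R grows. Square integrability supplies
  integrable majorants for the two main terms, and \<open>norm (cutoff_bar R z)\<close> is at most
  2/R, so the error term disappears.\<close>

lemma l2_inner_creation:
  fixes u v :: "complex \<Rightarrow> complex"
  assumes u: "smooth u" and v: "smooth v"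
    and L2: "u \<in> L2 (gauss_measure \<nu>)" "v \<in> L2 (gauss_measure \<nu>)"
      "wirt_bar u \<in> L2 (gauss_measure \<nu>)" "creation \<nu> v \<in> L2 (gauss_measure \<nu>)"
  shows "l2_inner (gauss_measure \<nu>) (wirt_bar u) v = l2_inner (gauss_measure \<nu>) u (creation \<nu> v)"
proof -
  let ?M = "gauss_measure \<nu>"
  let ?R = "\<lambda>n. real (Suc n)"
  have meas: "f \<in> borel_measurable ?M" if "smooth f" for f
    using that by (simp add: borel_measurable_gauss borel_measurable_continuous_onI smooth_continuous)
  have contb: "continuous_on UNIV (cutoff (?R n))" "continuous_on UNIV (cutoff_bar (?R n))" for n
    by (auto intro: continuous_on_cutoff continuous_on_cutoff_bar)
  have lim: "(\<lambda>n. LINT z|?M. of_real ((cutoff (?R n) z)\<^sup>2) * (f z * cnj (g z))) \<longlonglongrightarrow> l2_inner ?M f g"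
    if fg: "smooth f" "smooth g" "f \<in> L2 ?M" "g \<in> L2 ?M" for f g
    unfolding l2_inner_def
  proof (rule integral_dominated_convergence[where w = "\<lambda>z. norm (f z * cnj (g z))"])
    show "(\<lambda>z. f z * cnj (g z)) \<in> borel_measurable ?M"
      by (intro meas smooth_mult smooth_cnj fg)
    show "(\<lambda>z. of_real ((cutoff (?R n) z)\<^sup>2) * (f z * cnj (g z))) \<in> borel_measurable ?M" for n
      unfolding borel_measurable_gauss
      by (intro borel_measurable_continuous_onI continuous_intros contb smooth_continuous fg)
    show "integrable ?M (\<lambda>z. norm (f z * cnj (g z)))"
      by (intro integrable_norm integrable_L2_inner fg)
    have "(\<lambda>n. of_real ((cutoff (?R n) z)\<^sup>2) * (f z * cnj (g z))) \<longlonglongrightarrow> of_real (1\<^sup>2) * (f z * cnj (g z))" for z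
      by (intro tendsto_mult tendsto_const tendsto_of_real tendsto_power cutoff_LIMSEQ)
    then show "AE z in ?M. (\<lambda>n. of_real ((cutoff (?R n) z)\<^sup>2) * (f z * cnj (g z))) \<longlonglongrightarrow> f z * cnj (g z)"
      by simp
    have "norm (of_real ((cutoff (?R n) z)\<^sup>2) * (f z * cnj (g z))) \<le> 1 * norm (f z * cnj (g z))" for n z
      unfolding norm_mult[of "of_real _"]
      using cutoff_bounds[of "?R n" z] by (intro mult_right_mono) (auto simp: power_le_one norm_power)
    then show "AE z in ?M. norm (of_real ((cutoff (?R n) z)\<^sup>2) * (f z * cnj (g z))) \<le> norm (f z * cnj (g z))" for n
      by simp
  qed
  have "(\<lambda>n. LINT z|?M. cutoff_bar (?R n) z * (u z * cnj (v z))) \<longlonglongrightarrow> (LINT z|?M. 0)"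
  proof (rule integral_dominated_convergence[where w = "\<lambda>z. 2 * norm (u z * cnj (v z))"])
    show "(\<lambda>z. cutoff_bar (?R n) z * (u z * cnj (v z))) \<in> borel_measurable ?M" for n
      unfolding borel_measurable_gauss
      by (intro borel_measurable_continuous_onI continuous_intros contb smooth_continuous u v)
    show "integrable ?M (\<lambda>z. 2 * norm (u z * cnj (v z)))"
      by (intro integrable_mult_right integrable_norm integrable_L2_inner L2)
    have b: "norm (cutoff_bar (?R n) z) \<le> 2 * (1 / ?R n)" for n z
      using norm_cutoff_bar_le[of "?R n" z] mult_left_mono[OF cutoff_bounds(2), of "2 / ?R n" "?R n" z]
      by simp
    have "(\<lambda>n. cutoff_bar (?R n) z * (u z * cnj (v z))) \<longlonglongrightarrow> 0 * (u z * cnj (v z))" for z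
    proof (intro tendsto_mult tendsto_const)
      show "(\<lambda>n. cutoff_bar (?R n) z) \<longlonglongrightarrow> 0"
      proof (rule Lim_null_comparison[OF always_eventually])
        show "\<forall>n. norm (cutoff_bar (?R n) z) \<le> 2 * (1 / ?R n)" using b by blast
        show "(\<lambda>n. 2 * (1 / ?R n)) \<longlonglongrightarrow> 0"
          using tendsto_mult_right_zero[OF LIMSEQ_Suc[OF lim_1_over_n]] .
      qed
    qed
    then show "AE z in ?M. (\<lambda>n. cutoff_bar (?R n) z * (u z * cnj (v z))) \<longlonglongrightarrow> 0"
      by simp
    have "norm (cutoff_bar (?R n) z * (u z * cnj (v z))) \<le> 2 * norm (u z * cnj (v z))" for n z
    proof -
      have "2 * (1 / ?R n) \<le> 2" by (simp add: field_simps)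
      then have "norm (cutoff_bar (?R n) z) \<le> 2" using b[of n z] by linarith
      then show ?thesis
        unfolding norm_mult[of "cutoff_bar _ _"] by (intro mult_right_mono) auto
    qed
    then show "AE z in ?M. norm (cutoff_bar (?R n) z * (u z * cnj (v z))) \<le> 2 * norm (u z * cnj (v z))" for n
      by simp
  qed simp
  then have "(\<lambda>n. LINT z|?M. of_real ((cutoff (?R n) z)\<^sup>2) * (wirt_bar u z * cnj (v z)))
      \<longlonglongrightarrow> l2_inner ?M u (creation \<nu> v) - (LINT z|?M. 0)"
    unfolding gauss_integration_by_parts[OF smooth_Ck[OF u] smooth_Ck[OF v] of_nat_0_less_iff[THEN iffD2, OF zero_less_Suc]]
    by (intro tendsto_diff lim u v smooth_creation L2)
  moreover have "(\<lambda>n. LINT z|?M. of_real ((cutoff (?R n) z)\<^sup>2) * (wirt_bar u z * cnj (v z)))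
      \<longlonglongrightarrow> l2_inner ?M (wirt_bar u) v"
    by (intro lim smooth_wirt_bar u v L2)
  ultimately show ?thesis using LIMSEQ_unique by fastforce
qed

text \<open>A nonempty open set is not Lebesgue null, so for a continuous function vanishing almost
  everywhere is vanishing. This gives definiteness on spaces of actual functions.\<close>

lemma continuous_gauss_norm_zero:
  assumes "continuous_on UNIV f" "f \<in> L2 (gauss_measure \<nu>)"
    "(LINT z|gauss_measure \<nu>. (norm (f z))\<^sup>2) = 0"
  shows "f = (\<lambda>_. 0)"
proof -
  have meas: "(\<lambda>z. (norm (f z))\<^sup>2) \<in> borel_measurable borel"
    using assms(1) by (intro borel_measurable_continuous_onI continuous_intros)
  let ?h = "\<lambda>z. exp (- \<nu> * (norm z)\<^sup>2) * (norm (f z))\<^sup>2"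
  have "integrable lborel ?h"
    using L2D(2)[OF assms(2)] gauss_integrable_iff[OF meas] by simp
  moreover have "(LINT z|lborel. ?h z) = 0"
    using assms(3) gauss_integral[OF meas] by simp
  ultimately have "AE z in lborel. ?h z = 0"
    by (simp add: integral_nonneg_eq_0_iff_AE)
  then have "AE z in lborel. f z = 0" by simp
  moreover have op: "open {z. f z \<noteq> 0}"
    using assms(1) by (intro open_Collect_neq) auto
  ultimately have "{z. f z \<noteq> 0} \<in> null_sets lborel"
    by (subst (asm) AE_iff_null_sets[symmetric, of "{z. f z \<noteq> 0}", simplified]) auto
  then have "negligible {z. f z \<noteq> 0}"
    using negligible_iff_null_sets null_sets_completionI by blast
  then show ?thesis
    using open_not_negligible[OF op] by auto
qed

subsection \<open>The ladder of eigenspaces\<close>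

lemma magnetic_laplacian_eq: "magnetic_laplacian \<nu> F = creation \<nu> (wirt_bar F)"
  by (simp add: fun_eq_iff magnetic_laplacian_def creation_def)

lemma fockD:
  assumes "F \<in> fock_space \<nu> n"
  shows "smooth F" "F \<in> L2 (gauss_measure \<nu>)"
    "creation \<nu> (wirt_bar F) = (\<lambda>z. of_nat n * of_real \<nu> * F z)"
  using assms by (auto simp: fock_space_def magnetic_laplacian_eq fun_eq_iff)

lemma fockI:
  assumes "smooth F" "F \<in> L2 (gauss_measure \<nu>)"
    "\<And>z. creation \<nu> (wirt_bar F) z = of_nat n * of_real \<nu> * F z"
  shows "F \<in> fock_space \<nu> n"
  using assms by (auto simp: fock_space_def magnetic_laplacian_eq)

lemma wirt_bar_cmult: "smooth u \<Longrightarrow> wirt_bar (\<lambda>z. c * u z) = (\<lambda>z. c * wirt_bar u z)"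
  using has_wirtD(2)[OF has_wirt_cmult[OF smooth_has_wirt]] by blast

lemma wirt_bar_add: "smooth u \<Longrightarrow> smooth v \<Longrightarrow> wirt_bar (\<lambda>z. u z + v z) = (\<lambda>z. wirt_bar u z + wirt_bar v z)"
  using has_wirtD(2)[OF has_wirt_add[OF smooth_has_wirt smooth_has_wirt]] by blast

lemma creation_cmult: "smooth u \<Longrightarrow> creation \<nu> (\<lambda>z. c * u z) = (\<lambda>z. c * creation \<nu> u z)"
  using has_wirtD(1)[OF has_wirt_cmult[OF smooth_has_wirt[of u], of c]]
  by (simp add: fun_eq_iff creation_def algebra_simps)

lemma creation_add:
  "smooth u \<Longrightarrow> smooth v \<Longrightarrow> creation \<nu> (\<lambda>z. u z + v z) = (\<lambda>z. creation \<nu> u z + creation \<nu> v z)"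
  using has_wirtD(1)[OF has_wirt_add[OF smooth_has_wirt[of u] smooth_has_wirt[of v]]]
  by (simp add: fun_eq_iff creation_def algebra_simps)

text \<open>The two derivatives commute, so the only contribution to the commutator is
  \<open>wirt_bar\<close> acting on the factor \<open>cnj z\<close>.\<close>

lemma wirt_bar_creation:
  assumes u: "smooth u"
  shows "wirt_bar (creation \<nu> u) z = creation \<nu> (wirt_bar u) z + of_real \<nu> * u z"
proof -
  have "has_wirt (\<lambda>z. - wirt u z + of_real \<nu> * (cnj z * u z))
      (- wirt (wirt u) z + of_real \<nu> * (0 * u z + cnj z * wirt u z))
      (- wirt_bar (wirt u) z + of_real \<nu> * (1 * u z + cnj z * wirt_bar u z)) z"
    by (intro has_wirt_add has_wirt_minus has_wirt_cmult has_wirt_mult has_wirt_cnj_ident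
        smooth_has_wirt smooth_wirt u)
  from has_wirtD(2)[OF this] show ?thesis
    unfolding creation_def [abs_def]
    by (simp add: smooth_wirt_commute[OF u] algebra_simps)
qed

lemma wirt_bar_creation_fock:
  assumes "u \<in> fock_space \<nu> n"
  shows "wirt_bar (creation \<nu> u) = (\<lambda>z. of_nat (Suc n) * of_real \<nu> * u z)"
  using wirt_bar_creation[OF fockD(1)[OF assms]] fockD(3)[OF assms]
  by (simp add: fun_eq_iff algebra_simps)

lemma creation_fock:
  assumes u: "u \<in> fock_space \<nu> n"
  shows "creation \<nu> u \<in> fock_space \<nu> (Suc n)"
proof (rule fockI)
  show "smooth (creation \<nu> u)" by (intro smooth_creation fockD[OF u])
  \<comment> \<open>\<open>creation_L2\<close> asks for \<open>wirt_bar (creation \<nu> u)\<close>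
    in L2; by the commutation relation this is a multiple of u.\<close>
  show "creation \<nu> u \<in> L2 (gauss_measure \<nu>)"
    by (intro creation_L2 fockD[OF u]) (simp only: wirt_bar_creation_fock[OF u] L2_cmult fockD[OF u])
  show "creation \<nu> (wirt_bar (creation \<nu> u)) z = of_nat (Suc n) * of_real \<nu> * creation \<nu> u z" for z
    unfolding wirt_bar_creation_fock[OF u] creation_cmult[OF fockD(1)[OF u]] ..
qed

lemma l2_inner_creation_fock:
  assumes u: "u \<in> fock_space \<nu> n" and v: "v \<in> fock_space \<nu> n"
  shows "l2_inner (gauss_measure \<nu>) (creation \<nu> u) (creation \<nu> v) =
    of_nat (Suc n) * of_real \<nu> * l2_inner (gauss_measure \<nu>) u v"
proof -
  have "l2_inner (gauss_measure \<nu>) (creation \<nu> u) (creation \<nu> v) =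
      l2_inner (gauss_measure \<nu>) (wirt_bar (creation \<nu> u)) v"
    using fockD[OF u] fockD[OF v] fockD[OF creation_fock[OF u]] fockD[OF creation_fock[OF v]]
    by (intro l2_inner_creation[symmetric]) (auto simp only: wirt_bar_creation_fock[OF u] intro!: L2_cmult)
  then show ?thesis
    by (simp only: wirt_bar_creation_fock[OF u] l2_inner_cmult_left)
qed

lemma fock_cmult: "u \<in> fock_space \<nu> n \<Longrightarrow> (\<lambda>z. c * u z) \<in> fock_space \<nu> n"
  using fockD[of u \<nu> n]
  by (intro fockI smooth_cmult L2_cmult)
    (simp_all add: wirt_bar_cmult creation_cmult smooth_wirt_bar)

lemma fock_add:
  "u \<in> fock_space \<nu> n \<Longrightarrow> v \<in> fock_space \<nu> n \<Longrightarrow> (\<lambda>z. u z + v z) \<in> fock_space \<nu> n"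
  using fockD[of u \<nu> n] fockD[of v \<nu> n]
  by (intro fockI smooth_add L2_add)
    (simp_all add: wirt_bar_add creation_add smooth_wirt_bar distrib_left)

lemma wirt_bar_fock:
  assumes F: "F \<in> fock_space \<nu> (Suc n)"
  shows "wirt_bar F \<in> fock_space \<nu> n"
proof (rule fockI)
  note D = fockD[OF F]
  show "smooth (wirt_bar F)" by (intro smooth_wirt_bar D)
  show "wirt_bar F \<in> L2 (gauss_measure \<nu>)"
    by (intro wirt_bar_L2 D) (simp only: D(3) L2_cmult D(2))
  fix z
  \<comment> \<open>The eigenvalue equation differentiated by \<open>wirt_bar\<close>; commuting the
    two operators then lowers the eigenvalue by nu.\<close>
  have "wirt_bar (creation \<nu> (wirt_bar F)) z = of_nat (Suc n) * of_real \<nu> * wirt_bar F z"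
    unfolding D(3) wirt_bar_cmult[OF D(1)] ..
  then show "creation \<nu> (wirt_bar (wirt_bar F)) z = of_nat n * of_real \<nu> * wirt_bar F z"
    unfolding wirt_bar_creation[OF smooth_wirt_bar[OF D(1)]] by (simp add: algebra_simps)
qed

text \<open>The squared norm of \<open>wirt_bar F\<close> equals the pairing of F with
  \<open>creation \<nu> (wirt_bar F)\<close>, which is zero at the lowest eigenvalue. Hence
  \<open>wirt_bar F\<close> = 0, and these are the Cauchy-Riemann equations.\<close>

lemma fock_0_iff:
  "F \<in> fock_space \<nu> 0 \<longleftrightarrow> F holomorphic_on UNIV \<and> F \<in> L2 (gauss_measure \<nu>)"
proof
  assume F: "F \<in> fock_space \<nu> 0"
  note D = fockD[OF F]
  have z: "creation \<nu> (wirt_bar F) = (\<lambda>_. 0)" using D(3) by simp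
  have L: "wirt_bar F \<in> L2 (gauss_measure \<nu>)"
    by (intro wirt_bar_L2 D) (simp add: z L2_def)
  have "l2_inner (gauss_measure \<nu>) (wirt_bar F) (wirt_bar F) =
      l2_inner (gauss_measure \<nu>) F (creation \<nu> (wirt_bar F))"
    by (intro l2_inner_creation D L smooth_wirt_bar) (simp add: z L2_def)
  also have "\<dots> = 0" by (simp add: z l2_inner_def)
  finally have "wirt_bar F = (\<lambda>_. 0)"
    by (intro continuous_gauss_norm_zero[where \<nu> = \<nu>] L smooth_continuous smooth_wirt_bar D)
      (simp add: l2_inner_self)
  then have "(F has_field_derivative wirt F z) (at z)" for z
    using smooth_has_wirt[OF D(1), of z]
    by (simp add: has_wirt_def has_field_derivative_def mult_commute_abs)
  then show "F holomorphic_on UNIV \<and> F \<in> L2 (gauss_measure \<nu>)"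
    using D(2) by (auto simp: holomorphic_on_open)
next
  assume F: "F holomorphic_on UNIV \<and> F \<in> L2 (gauss_measure \<nu>)"
  have "wirt_bar F = (\<lambda>_. 0)"
    using has_wirtD(2)[OF has_wirt_holomorphic[OF holomorphic_derivI[of F UNIV]]] F by auto
  moreover have "creation \<nu> (\<lambda>_. 0) z = 0" for z
    using has_wirtD(1)[OF has_wirt_const] by (simp add: creation_def)
  ultimately show "F \<in> fock_space \<nu> 0"
    using F by (intro fockI smooth_holomorphic) auto
qed

lemma creation_funpow_fock: "g \<in> fock_space \<nu> 0 \<Longrightarrow> (creation \<nu> ^^ n) g \<in> fock_space \<nu> n"
  by (induction n) (auto intro: creation_fock)

lemma l2_inner_creation_funpow:
  assumes "f \<in> fock_space \<nu> 0" "g \<in> fock_space \<nu> 0"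
  shows "l2_inner (gauss_measure \<nu>) ((creation \<nu> ^^ n) f) ((creation \<nu> ^^ n) g) =
    of_real (\<nu> ^ n * fact n) * l2_inner (gauss_measure \<nu>) f g"
proof (induction n)
  case (Suc n)
  then show ?case
    using l2_inner_creation_fock[OF creation_funpow_fock[OF assms(1)] creation_funpow_fock[OF assms(2)]]
    by (simp add: algebra_simps)
qed simp

text \<open>At level n+1 the eigenvalue equation itself writes F as the creation operator applied to
  \<open>wirt_bar F\<close> divided by (n+1) nu, and that function lies one level lower.\<close>

lemma creation_funpow_surj:
  assumes "\<nu> \<noteq> 0" "F \<in> fock_space \<nu> n"
  shows "\<exists>g\<in>fock_space \<nu> 0. F = (creation \<nu> ^^ n) g"
  using assms(2)
proof (induction n arbitrary: F)
  case (Suc n)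
  let ?c = "1 / (of_nat (Suc n) * of_real \<nu>)"
  have "(\<lambda>z. ?c * wirt_bar F z) \<in> fock_space \<nu> n"
    by (intro fock_cmult wirt_bar_fock Suc.prems)
  then obtain g where g: "g \<in> fock_space \<nu> 0" "(\<lambda>z. ?c * wirt_bar F z) = (creation \<nu> ^^ n) g"
    using Suc.IH by blast
  have "creation \<nu> (\<lambda>z. ?c * wirt_bar F z) = (\<lambda>z. ?c * (of_nat (Suc n) * of_real \<nu> * F z))"
    unfolding creation_cmult[OF smooth_wirt_bar[OF fockD(1)[OF Suc.prems]]] fockD(3)[OF Suc.prems] ..
  also have "\<dots> = F" using assms(1) of_nat_neq_0[of n, where 'a=complex] by (auto simp del: of_nat_Suc)
  finally show ?case using g by (metis funpow.simps(2) comp_apply)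
qed auto

lemma creation_funpow_smooth: "smooth u \<Longrightarrow> smooth ((creation \<nu> ^^ n) u)"
  by (induction n) (auto intro: smooth_creation)

lemma creation_funpow_linear:
  assumes "smooth f" "smooth g"
  shows "(creation \<nu> ^^ n) (\<lambda>z. a * f z + b * g z) =
    (\<lambda>z. a * (creation \<nu> ^^ n) f z + b * (creation \<nu> ^^ n) g z)"
proof (induction n)
  case (Suc n)
  then show ?case
    using assms by (simp add: creation_add creation_cmult smooth_cmult creation_funpow_smooth)
qed simp

subsection \<open>Gaussian moments and the integral kernel\<close>

lemma power_le_fact_mult_exp:
  fixes x :: real
  assumes "0 \<le> x"
  shows "x ^ k \<le> fact k * exp x"
proof -
  have "(\<Sum>n\<in>{k}. x ^ n /\<^sub>R fact n) \<le> (\<Sum>n. x ^ n /\<^sub>R fact n)"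
    using assms by (intro sum_le_suminf summable_exp_generic) auto
  then have "x ^ k / fact k \<le> exp x"
    by (simp add: exp_def divide_inverse mult.commute)
  then show ?thesis by (simp add: field_simps)
qed

lemma nn_integral_gaussian:
  assumes "0 < a"
  shows "(\<integral>\<^sup>+x. ennreal (exp (- a * x\<^sup>2)) \<partial>lborel) = ennreal (sqrt (pi / a))"
proof -
  \<comment> \<open>Variance 1/(2a) makes the normal density a constant multiple of exp(-a
    x^2).\<close>
  define \<sigma> where "\<sigma> = 1 / sqrt (2 * a)"
  have \<sigma>: "0 < \<sigma>" "\<sigma>\<^sup>2 = 1 / (2 * a)"
    using assms by (auto simp: \<sigma>_def power_divide)
  have "has_bochner_integral lborel (\<lambda>x. normal_density 0 \<sigma> x * (x - 0) ^ (2 * 0)) 1"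
    using normal_moment_even[OF \<sigma>(1), of 0 0] by simp
  then have "has_bochner_integral lborel (\<lambda>x. sqrt (pi / a) * (normal_density 0 \<sigma> x * (x - 0) ^ (2 * 0))) (sqrt (pi / a) * 1)"
    by (rule has_bochner_integral_mult_right)
  moreover have "sqrt (pi / a) * (normal_density 0 \<sigma> x * (x - 0) ^ (2 * 0)) = exp (- a * x\<^sup>2)" for x
    using assms by (simp add: normal_density_def \<sigma>(2) real_sqrt_divide)
  ultimately have "has_bochner_integral lborel (\<lambda>x. exp (- a * x\<^sup>2)) (sqrt (pi / a))"
    by simp
  then show ?thesis
    by (simp add: has_bochner_integral_iff nn_integral_eq_integral)
qed

text \<open>Two rates are allowed because |exp(gamma z^2)|^2 changes the Gaussian with opposite
  signs along the real and imaginary axes.\<close>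

lemma gaussian_complex_integral:
  assumes "0 < a" "0 < b"
  shows "has_bochner_integral lborel (\<lambda>z. exp (- a * (Re z)\<^sup>2 - b * (Im z)\<^sup>2)) (pi / sqrt (a * b))"
proof (rule has_bochner_integral_nn_integral)
  let ?f = "\<lambda>c x. ennreal (exp (- (if c = (1::complex) then a else b) * x\<^sup>2))"
  have ne: "\<i> \<noteq> (1::complex)" by (simp add: complex_eq_iff)
  have "(\<integral>\<^sup>+z. (\<Prod>c\<in>Basis. ?f c (z \<bullet> c)) \<partial>lborel) = (\<Prod>c\<in>Basis. \<integral>\<^sup>+x. ?f c x \<partial>lborel)"
    by (rule nn_integral_lborel_prod) auto
  also have "\<dots> = ennreal (sqrt (pi / a)) * ennreal (sqrt (pi / b))"
    using ne nn_integral_gaussian[OF assms(1)] nn_integral_gaussian[OF assms(2)]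
    by (simp add: Basis_complex_def)
  also have "\<dots> = ennreal (pi / sqrt (a * b))"
    using assms by (simp add: ennreal_mult[symmetric] real_sqrt_divide real_sqrt_mult)
  also have "(\<lambda>z. \<Prod>c\<in>Basis. ?f c (z \<bullet> c)) = (\<lambda>z. ennreal (exp (- a * (Re z)\<^sup>2 - b * (Im z)\<^sup>2)))"
    using ne by (simp add: Basis_complex_def inner_complex_def ennreal_mult[symmetric] exp_add[symmetric] fun_eq_iff)
  finally show "(\<integral>\<^sup>+z. ennreal (exp (- a * (Re z)\<^sup>2 - b * (Im z)\<^sup>2)) \<partial>lborel) = ennreal (pi / sqrt (a * b))" .
  show "(\<lambda>z. exp (- a * (Re z)\<^sup>2 - b * (Im z)\<^sup>2)) \<in> borel_measurable lborel"
    by (simp add: borel_measurable_continuous_onI continuous_intros)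
qed (use assms in auto)

lemma gaussian_radial_integral:
  assumes "0 < \<nu>"
  shows "has_bochner_integral lborel (\<lambda>z::complex. exp (- \<nu> * (norm z)\<^sup>2)) (pi / \<nu>)"
proof -
  have "(\<lambda>z::complex. exp (- \<nu> * (norm z)\<^sup>2)) = (\<lambda>z. exp (- \<nu> * (Re z)\<^sup>2 - \<nu> * (Im z)\<^sup>2))"
    by (simp add: fun_eq_iff cmod_power2 algebra_simps)
  then show ?thesis
    using gaussian_complex_integral[OF assms assms] assms by simp
qed

lemma L2_norm_le:
  assumes "g \<in> L2 M" "f \<in> borel_measurable M" "\<And>z. norm (f z) \<le> norm (g z)"
  shows "f \<in> L2 M"
  using L2D(2)[OF assms(1)] by (intro L2_bound[OF assms(2)]) (auto intro: power_mono assms(3))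

lemma power_L2:
  assumes "0 < \<nu>"
  shows "(\<lambda>z. z ^ k) \<in> L2 (gauss_measure \<nu>)"
proof -
  have meas: "(\<lambda>z::complex. (norm (z ^ k))\<^sup>2) \<in> borel_measurable borel"
    by (intro borel_measurable_continuous_onI continuous_intros)
  \<comment> \<open>From x^k <= k! exp x at x = nu |z|^2 / 2: half of the Gaussian is spent on the
    power.\<close>
  let ?C = "fact k * (2 / \<nu>) ^ k"
  have "integrable lborel (\<lambda>z::complex. ?C * exp (- (\<nu> / 2) * (norm z)\<^sup>2))"
    using gaussian_radial_integral[of "\<nu> / 2"] assms
    by (intro integrable_mult_right) (simp add: has_bochner_integral_iff)
  then have "integrable lborel (\<lambda>z::complex. exp (- \<nu> * (norm z)\<^sup>2) *\<^sub>R (norm (z ^ k))\<^sup>2)"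
  proof (rule Bochner_Integration.integrable_bound)
    show "(\<lambda>z::complex. exp (- \<nu> * (norm z)\<^sup>2) *\<^sub>R (norm (z ^ k))\<^sup>2) \<in> borel_measurable lborel"
      using meas by simp
    have "norm (exp (- \<nu> * (norm z)\<^sup>2) *\<^sub>R (norm (z ^ k))\<^sup>2) \<le> ?C * exp (- (\<nu> / 2) * (norm z)\<^sup>2)"
      for z :: complex
    proof -
      let ?x = "\<nu> / 2 * (norm z)\<^sup>2"
      have "?x ^ k \<le> fact k * exp ?x" using assms by (intro power_le_fact_mult_exp) auto
      then have "(2 / \<nu>) ^ k * ?x ^ k \<le> (2 / \<nu>) ^ k * (fact k * exp ?x)"
        using assms by (intro mult_left_mono) auto
      also have "(2 / \<nu>) ^ k * ?x ^ k = (norm (z ^ k))\<^sup>2"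
        using assms by (simp add: power_mult_distrib[symmetric] norm_power power_mult[symmetric] mult.commute)
      finally have "exp (- \<nu> * (norm z)\<^sup>2) * (norm (z ^ k))\<^sup>2 \<le>
          exp (- \<nu> * (norm z)\<^sup>2) * ((2 / \<nu>) ^ k * (fact k * exp ?x))"
        by (intro mult_left_mono) auto
      also have "\<dots> = ?C * (exp (- \<nu> * (norm z)\<^sup>2) * exp ?x)" by (simp add: algebra_simps)
      also have "exp (- \<nu> * (norm z)\<^sup>2) * exp ?x = exp (- (\<nu> / 2) * (norm z)\<^sup>2)"
        unfolding exp_add[symmetric] by (simp add: field_simps)
      finally show ?thesis by simp
    qed
    then show "AE z in lborel. norm (exp (- \<nu> * (norm z)\<^sup>2) *\<^sub>R (norm (z ^ k))\<^sup>2) \<le>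
        norm (?C * exp (- (\<nu> / 2) * (norm (z::complex))\<^sup>2))"
      using assms by (simp add: abs_mult)
  qed
  then have "integrable (gauss_measure \<nu>) (\<lambda>z. (norm (z ^ k))\<^sup>2)"
    using gauss_integrable_iff[OF meas] by blast
  moreover have "(\<lambda>z::complex. z ^ k) \<in> borel_measurable borel"
    by (intro borel_measurable_continuous_onI continuous_intros)
  ultimately show ?thesis by (simp add: L2_def borel_measurable_gauss)
qed

lemma const_L2: "0 < \<nu> \<Longrightarrow> (\<lambda>_. c) \<in> L2 (gauss_measure \<nu>)"
  using L2_cmult[OF power_L2[of \<nu> 0], of c] by simp

lemma cnj_mult_L2:
  assumes "0 < \<nu>" "continuous_on UNIV p" "(\<lambda>z. z * p z) \<in> L2 (gauss_measure \<nu>)"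
  shows "(\<lambda>z. cnj z * p z) \<in> L2 (gauss_measure \<nu>)"
  by (rule L2_norm_le[OF assms(3)])
    (auto simp: borel_measurable_gauss norm_mult intro!: borel_measurable_continuous_onI continuous_intros assms)

lemma wirt_holomorphic:
  assumes "p holomorphic_on UNIV"
  shows "wirt p = deriv p" "wirt_bar p = (\<lambda>_. 0)"
  using has_wirtD[OF has_wirt_holomorphic[OF holomorphic_derivI[OF assms open_UNIV UNIV_I]]] by auto

text \<open>On the Fock space the adjoint of differentiation is multiplication by nu z:
  \<open>wirt_bar\<close> annihilates p, so p is orthogonal to \<open>creation \<nu> q\<close>,
  which is nu cnj z q minus the derivative of q.\<close>

lemma l2_inner_deriv:
  assumes \<nu>: "0 < \<nu>" and p: "p holomorphic_on UNIV" "p \<in> L2 (gauss_measure \<nu>)"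
    and q: "q holomorphic_on UNIV" "q \<in> L2 (gauss_measure \<nu>)" "deriv q \<in> L2 (gauss_measure \<nu>)"
      "(\<lambda>z. z * q z) \<in> L2 (gauss_measure \<nu>)"
  shows "l2_inner (gauss_measure \<nu>) p (deriv q) = of_real \<nu> * l2_inner (gauss_measure \<nu>) (\<lambda>z. z * p z) q"
proof -
  let ?M = "gauss_measure \<nu>"
  have cq: "(\<lambda>z. cnj z * q z) \<in> L2 ?M"
    using \<nu> q by (intro cnj_mult_L2 holomorphic_on_imp_continuous_on)
  have cr: "creation \<nu> q = (\<lambda>z. of_real \<nu> * (cnj z * q z) - deriv q z)"
    by (simp add: fun_eq_iff creation_def wirt_holomorphic[OF q(1)])
  have L: "(\<lambda>z. of_real \<nu> * (cnj z * q z)) \<in> L2 ?M" by (intro L2_cmult cq)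
  have "l2_inner ?M (wirt_bar p) q = l2_inner ?M p (creation \<nu> q)"
    using p q L by (intro l2_inner_creation)
      (auto simp: smooth_holomorphic wirt_holomorphic cr const_L2 \<nu> intro!: L2_diff)
  also have "l2_inner ?M (wirt_bar p) q = 0"
    by (simp add: wirt_holomorphic(2)[OF p(1)] l2_inner_def)
  also have "l2_inner ?M p (creation \<nu> q) =
      of_real \<nu> * l2_inner ?M p (\<lambda>z. cnj z * q z) - l2_inner ?M p (deriv q)"
    unfolding cr by (simp add: l2_inner_diff_right[OF L q(3) p(2)] l2_inner_cmult_right)
  also have "l2_inner ?M p (\<lambda>z. cnj z * q z) = l2_inner ?M (\<lambda>z. z * p z) q"
    by (simp add: l2_inner_def mult_ac)
  finally show ?thesis by simp
qed

text \<open>The case q = z^j of the adjointness of differentiation and multiplication. For j = 0 the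
  truncated exponent j - 1 is harmless because of the factor j.\<close>

lemma gauss_moment_step:
  assumes \<nu>: "0 < \<nu>" and p: "p holomorphic_on UNIV" "p \<in> L2 (gauss_measure \<nu>)"
  shows "l2_inner (gauss_measure \<nu>) (\<lambda>z. z * p z) (\<lambda>z. z ^ j) =
    of_nat j / of_real \<nu> * l2_inner (gauss_measure \<nu>) p (\<lambda>z. z ^ (j - 1))"
proof -
  have d: "deriv (\<lambda>z::complex. z ^ j) = (\<lambda>z. of_nat j * z ^ (j - 1))"
    by (intro ext DERIV_imp_deriv) (auto intro!: derivative_eq_intros)
  have "l2_inner (gauss_measure \<nu>) p (deriv (\<lambda>z. z ^ j)) =
      of_real \<nu> * l2_inner (gauss_measure \<nu>) (\<lambda>z. z * p z) (\<lambda>z. z ^ j)"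
    using power_L2[OF \<nu>, of "Suc j"]
    by (intro l2_inner_deriv assms holomorphic_intros power_L2) (auto simp: d L2_cmult power_L2 \<nu>)
  then show ?thesis
    using \<nu> by (simp add: d l2_inner_cmult_right field_simps)
qed

lemma l2_inner_one_power:
  assumes \<nu>: "0 < \<nu>"
  shows "l2_inner (gauss_measure \<nu>) (\<lambda>_. 1) (\<lambda>z. z ^ n) = (if n = 0 then of_real (pi / \<nu>) else 0)"
proof (cases n)
  case 0
  have "(LINT z|gauss_measure \<nu>. (1::real)) = pi / \<nu>"
    using gaussian_radial_integral[OF \<nu>] by (subst gauss_integral) (auto simp: has_bochner_integral_iff)
  then have "(LINT z|gauss_measure \<nu>. complex_of_real 1) = of_real (pi / \<nu>)"
    unfolding integral_complex_of_real by simp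
  then show ?thesis using 0 by (simp add: l2_inner_def)
next
  case (Suc m)
  have "l2_inner (gauss_measure \<nu>) (\<lambda>z. z * z ^ m) (\<lambda>z. z ^ 0) = 0"
    using gauss_moment_step[OF \<nu> _ power_L2[OF \<nu>], of m 0] by (simp add: holomorphic_intros)
  then show ?thesis
    using Suc l2_inner_cnj[of "gauss_measure \<nu>" "\<lambda>_. 1" "\<lambda>z. z ^ n"] by simp
qed

text \<open>Removing the constant term of the power series and dividing by \<open>z\<close> lowers the index of the
  moment, which leaves only the integral of the weight itself.\<close>

lemma gauss_moment_power_series:
  assumes \<nu>: "0 < \<nu>" and h: "\<And>z. (\<lambda>k. a k * z ^ k) sums h z" "h \<in> L2 (gauss_measure \<nu>)"
  shows "l2_inner (gauss_measure \<nu>) h (\<lambda>z. z ^ n) = of_real (pi * fact n / \<nu> ^ Suc n) * a n"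
  using h
proof (induction n arbitrary: a h)
  let ?M = "gauss_measure \<nu>"
  {
    fix a h n assume h: "\<And>z. (\<lambda>k. a k * z ^ k) sums h z" "h \<in> L2 ?M"
    \<comment> \<open>This is (h(z) - a 0) / z, given by its series so that it is entire without a
      special value at 0.\<close>
    define q where "q z = (\<Sum>k. a (Suc k) * z ^ k)" for z
    have tail: "(\<lambda>k. a (Suc k) * z ^ Suc k) sums (h z - a 0)" for z
      using sums_Suc_iff[of "\<lambda>k. a k * z ^ k"] h(1)[of z] by simp
    have summ: "summable (\<lambda>k. a (Suc k) * z ^ k)" for z
    proof (cases "z = 0")
      case True
      then show ?thesis using summable_finite[of "{0}" "\<lambda>k. a (Suc k) * z ^ k"] by simp
    next
      case False
      then show ?thesis
        using summable_mult[OF sums_summable[OF tail[of z]], of "1 / z"] by simp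
    qed
    have hq: "h z = a 0 + z * q z" for z
    proof -
      have "(\<lambda>k. z * (a (Suc k) * z ^ k)) sums (z * q z)"
        unfolding q_def by (intro sums_mult summable_sums summ)
      then show ?thesis using sums_unique2[OF tail[of z], of "z * q z"] by (simp add: mult_ac diff_eq_eq add.commute)
    qed
    have "(q has_field_derivative (\<Sum>n. diffs (\<lambda>k. a (Suc k)) n * z ^ n)) (at z)" for z
      unfolding q_def [abs_def] using termdiffs_strong_converges_everywhere[OF summ] .
    then have q: "q holomorphic_on UNIV" by (auto simp: holomorphic_on_open)
    then have cq: "continuous_on UNIV q" by (rule holomorphic_on_imp_continuous_on)
    have "bounded (q ` cball 0 1)"
      using cq by (intro compact_imp_bounded compact_continuous_image) (auto intro: continuous_on_subset)
    then obtain B where B: "\<forall>z\<in>cball 0 1. norm (q z) \<le> B"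
      unfolding bounded_iff by auto
    have dL2: "(\<lambda>z. h z - a 0) \<in> L2 ?M" by (intro L2_diff h const_L2 \<nu>)
    \<comment> \<open>Inside the unit disc q is bounded by compactness; outside it |q| is at most |z
      q| = |h - a 0|.\<close>
    have qL2: "q \<in> L2 ?M"
    proof (rule L2_bound)
      show "q \<in> borel_measurable ?M"
        using cq by (simp add: borel_measurable_gauss borel_measurable_continuous_onI)
      show "integrable ?M (\<lambda>z. (norm (complex_of_real B))\<^sup>2 + (norm (h z - a 0))\<^sup>2)"
        by (intro Bochner_Integration.integrable_add L2D(2) dL2 const_L2 \<nu>)
      show "(norm (q z))\<^sup>2 \<le> (norm (complex_of_real B))\<^sup>2 + (norm (h z - a 0))\<^sup>2" for z
      proof (cases "norm z \<le> 1")
        case True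
        then have "norm (q z) \<le> norm (complex_of_real B)" using B by force
        then show ?thesis by (intro add_increasing2 power_mono) auto
      next
        case False
        then have "norm (q z) \<le> norm (h z - a 0)"
          using mult_right_mono[of 1 "norm z" "norm (q z)"] by (simp add: hq norm_mult)
        then show ?thesis by (intro add_increasing power_mono) auto
      qed
    qed
    have "l2_inner ?M h (\<lambda>z. z ^ n) = l2_inner ?M (\<lambda>z. a 0 * 1 + (h z - a 0)) (\<lambda>z. z ^ n)"
      by simp
    also have "\<dots> = l2_inner ?M (\<lambda>z. a 0 * 1) (\<lambda>z. z ^ n) + l2_inner ?M (\<lambda>z. h z - a 0) (\<lambda>z. z ^ n)"
      by (intro l2_inner_add_left dL2 power_L2 L2_cmult const_L2 \<nu>)
    also have "l2_inner ?M (\<lambda>z. h z - a 0) (\<lambda>z. z ^ n) =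
        of_nat n / of_real \<nu> * l2_inner ?M q (\<lambda>z. z ^ (n - 1))"
      using gauss_moment_step[OF \<nu> q qL2, of n] by (simp add: hq)
    finally have "l2_inner ?M h (\<lambda>z. z ^ n) = a 0 * (if n = 0 then of_real (pi / \<nu>) else 0) +
        of_nat n / of_real \<nu> * l2_inner ?M q (\<lambda>z. z ^ (n - 1))"
      by (simp only: l2_inner_cmult_left l2_inner_one_power[OF \<nu>])
    moreover have "\<And>z. (\<lambda>k. a (Suc k) * z ^ k) sums q z"
      unfolding q_def using summ by (rule summable_sums)
    ultimately have "\<exists>q. (\<forall>z. (\<lambda>k. a (Suc k) * z ^ k) sums q z) \<and> q \<in> L2 ?M \<and>
      l2_inner ?M h (\<lambda>z. z ^ n) = a 0 * (if n = 0 then of_real (pi / \<nu>) else 0) +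
        of_nat n / of_real \<nu> * l2_inner ?M q (\<lambda>z. z ^ (n - 1))"
      using qL2 by blast
  }
  note step = this
  {
    case 0
    then show ?case using step[of a h 0] by auto
  next
    case (Suc n)
    obtain q where q: "\<And>z. (\<lambda>k. a (Suc k) * z ^ k) sums q z" "q \<in> L2 ?M"
      "l2_inner ?M h (\<lambda>z. z ^ Suc n) = of_nat (Suc n) / of_real \<nu> * l2_inner ?M q (\<lambda>z. z ^ n)"
      using step[OF Suc.prems, of "Suc n"] by auto
    show ?case
      unfolding q(3) Suc.IH[OF q(1,2)] using \<nu> by (simp add: field_simps)
  }
qed

text \<open>\<open>wirt\<close> treats \<open>cnj z\<close> as a constant, so this factor can be
  pulled out of all iterates.\<close>

lemma creation_funpow_cnj_mult:
  assumes "smooth u"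
  shows "(creation \<nu> ^^ n) (\<lambda>z. cnj z * u z) = (\<lambda>z. cnj z * (creation \<nu> ^^ n) u z)"
proof (induction n)
  case (Suc n)
  let ?v = "(creation \<nu> ^^ n) u"
  have "has_wirt (\<lambda>z. cnj z * ?v z) (0 * ?v z + cnj z * wirt ?v z) (1 * ?v z + cnj z * wirt_bar ?v z) z" for z
    by (intro has_wirt_mult has_wirt_cnj_ident smooth_has_wirt creation_funpow_smooth assms)
  note w = has_wirtD(1)[OF this]
  have "creation \<nu> (\<lambda>z. cnj z * ?v z) = (\<lambda>z. cnj z * creation \<nu> ?v z)"
    unfolding creation_def[of _ "\<lambda>z. cnj z * ?v z", abs_def] creation_def[of _ ?v] w
    by (simp add: algebra_simps)
  then show ?case by (simp only: funpow.simps comp_apply Suc)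
qed simp

section \<open>From the transform kernel to powers of the creation operator\<close>

lemma holomorphic_on_translate:
  assumes "q holomorphic_on UNIV"
  shows "(\<lambda>\<xi>. q (z + \<xi>)) holomorphic_on UNIV"
proof -
  have "(\<lambda>\<xi>. z + \<xi>) holomorphic_on UNIV" by (intro holomorphic_intros)
  then show ?thesis
    using holomorphic_on_compose[of "\<lambda>\<xi>. z + \<xi>" UNIV q] assms by (simp add: o_def surj_plus)
qed

text \<open>With \<open>cnj z\<close> frozen as a parameter, \<open>creation \<nu> g\<close> at z is
  minus the derivative at xi = 0 of exp(- nu cnj z xi) g(z + xi). The iterates are then higher
  derivatives of this one entire function, which makes them Taylor coefficients.\<close>

lemma creation_funpow_holomorphic:
  assumes "g holomorphic_on UNIV"
  shows "(creation \<nu> ^^ n) g z =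
    (-1) ^ n * (deriv ^^ n) (\<lambda>\<xi>. exp (- (of_real \<nu> * cnj z) * \<xi>) * g (z + \<xi>)) 0"
  using assms
proof (induction n arbitrary: g)
  case (Suc n)
  note g = Suc.prems
  have g': "deriv g holomorphic_on UNIV" using g by (simp add: holomorphic_deriv)
  let ?c = "of_real \<nu> * cnj z"
  let ?E = "\<lambda>g \<xi>. exp (- ?c * \<xi>) * g (z + \<xi>)"
  have hol: "?E q holomorphic_on UNIV" if "q holomorphic_on UNIV" for q
    by (intro holomorphic_intros holomorphic_on_translate that)
  have sg: "smooth g" "smooth (deriv g)" using g g' smooth_holomorphic by auto
  \<comment> \<open>\<open>creation \<nu> g\<close> need not be holomorphic, but it is a holomorphic
    function plus \<open>cnj z\<close> times another. Peeling off the innermost application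
    therefore keeps the induction among holomorphic functions.\<close>
  have "creation \<nu> g = (\<lambda>z. of_real \<nu> * (cnj z * g z) + (-1) * deriv g z)"
    by (simp add: fun_eq_iff creation_def wirt_holomorphic[OF g])
  then have "(creation \<nu> ^^ Suc n) g z = of_real \<nu> * (cnj z * (creation \<nu> ^^ n) g z) + (-1) * (creation \<nu> ^^ n) (deriv g) z"
    using creation_funpow_linear[OF smooth_mult[OF smooth_cnj_ident sg(1)] sg(2)]
    by (simp only: funpow_Suc_right comp_apply creation_funpow_cnj_mult[OF sg(1)])
  also have "\<dots> = (-1) ^ n * (?c * (deriv ^^ n) (?E g) 0 - (deriv ^^ n) (?E (deriv g)) 0)"
    unfolding Suc.IH[OF g] Suc.IH[OF g'] by (simp add: algebra_simps)
  also have "?c * (deriv ^^ n) (?E g) 0 = (deriv ^^ n) (\<lambda>\<xi>. ?c * ?E g \<xi>) 0"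
    by (rule higher_deriv_cmult[symmetric, OF hol[OF g] UNIV_I open_UNIV])
  also have "\<dots> - (deriv ^^ n) (?E (deriv g)) 0 = (deriv ^^ n) (\<lambda>\<xi>. ?c * ?E g \<xi> - ?E (deriv g) \<xi>) 0"
    by (rule higher_deriv_diff[symmetric, OF _ hol[OF g'] open_UNIV UNIV_I]) (intro holomorphic_intros hol g)
  also have "(\<lambda>\<xi>. ?c * ?E g \<xi> - ?E (deriv g) \<xi>) = (\<lambda>\<xi>. - 1 * deriv (?E g) \<xi>)"
  proof
    fix \<xi>
    have "((\<lambda>\<xi>. z + \<xi>) has_field_derivative 1) (at \<xi>)"
      by (auto intro!: derivative_eq_intros)
    then have "((\<lambda>\<xi>. g (z + \<xi>)) has_field_derivative deriv g (z + \<xi>)) (at \<xi>)"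
      using DERIV_chain'[of "\<lambda>\<xi>. z + \<xi>" 1 \<xi> UNIV g, OF _ holomorphic_derivI[OF g open_UNIV UNIV_I]]
      by simp
    then have "(?E g has_field_derivative (- ?c * exp (- ?c * \<xi>)) * g (z + \<xi>) + deriv g (z + \<xi>) * exp (- ?c * \<xi>)) (at \<xi>)"
      by (intro DERIV_mult) (auto intro!: derivative_eq_intros)
    from DERIV_imp_deriv[OF this] show "?c * ?E g \<xi> - ?E (deriv g) \<xi> = - 1 * deriv (?E g) \<xi>"
      by (simp add: algebra_simps)
  qed
  also have "(deriv ^^ n) (\<lambda>\<xi>. - 1 * deriv (?E g) \<xi>) 0 = - 1 * (deriv ^^ n) (deriv (?E g)) 0"
    by (rule higher_deriv_cmult[OF holomorphic_deriv[OF hol[OF g] open_UNIV] UNIV_I open_UNIV])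
  finally show ?case by (simp add: funpow_Suc_right del: funpow.simps)
qed simp

text \<open>Up to the factor exp(- nu |z|^2 / 2) this is the unitary Weyl translation: the
  exponential compensates the change of the Gaussian weight under the shift by z.\<close>

lemma translated_L2:
  assumes "g \<in> L2 (gauss_measure \<nu>)"
  shows "(\<lambda>\<xi>. exp (- (of_real \<nu> * cnj z) * \<xi>) * g (z + \<xi>)) \<in> L2 (gauss_measure \<nu>)"
proof -
  have [measurable]: "g \<in> borel_measurable borel"
    using L2D(1)[OF assms] by (simp add: borel_measurable_gauss)
  have [measurable]: "(\<lambda>\<xi>::complex. exp (- (of_real \<nu> * cnj z) * \<xi>)) \<in> borel_measurable borel"
    by (intro borel_measurable_continuous_onI continuous_intros)
  let ?h = "\<lambda>\<xi>. exp (- (of_real \<nu> * cnj z) * \<xi>) * g (z + \<xi>)"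
  let ?G = "\<lambda>\<xi>. exp (- \<nu> * (norm \<xi>)\<^sup>2) *\<^sub>R (norm (g \<xi>))\<^sup>2"
  have hm: "?h \<in> borel_measurable borel" by measurable
  have Gm: "?G \<in> borel_measurable borel" by measurable
  have "integrable lborel ?G"
    using L2D(2)[OF assms] by (subst (asm) gauss_integrable_iff) auto
  then have "integrable lborel (\<lambda>\<xi>. exp (\<nu> * (norm z)\<^sup>2) * ?G (z + \<xi>))"
    using lborel_integral_translate(2)[OF Gm, of z] by (intro integrable_mult_right) simp
  also have "(\<lambda>\<xi>. exp (\<nu> * (norm z)\<^sup>2) * ?G (z + \<xi>)) = (\<lambda>\<xi>. exp (- \<nu> * (norm \<xi>)\<^sup>2) *\<^sub>R (norm (?h \<xi>))\<^sup>2)"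
  proof
    fix \<xi>
    have "\<nu> * (norm z)\<^sup>2 - \<nu> * (norm (z + \<xi>))\<^sup>2 = - \<nu> * (norm \<xi>)\<^sup>2 + 2 * Re (- (of_real \<nu> * cnj z) * \<xi>)"
      unfolding cmod_power2 by (simp add: algebra_simps power2_eq_square)
    then have "exp (\<nu> * (norm z)\<^sup>2) * exp (- \<nu> * (norm (z + \<xi>))\<^sup>2) =
        exp (- \<nu> * (norm \<xi>)\<^sup>2) * (exp (Re (- (of_real \<nu> * cnj z) * \<xi>)))\<^sup>2"
      by (simp add: exp_add[symmetric] exp_double[symmetric])
    then show "exp (\<nu> * (norm z)\<^sup>2) * ?G (z + \<xi>) = exp (- \<nu> * (norm \<xi>)\<^sup>2) *\<^sub>R (norm (?h \<xi>))\<^sup>2"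
      by (simp only: norm_mult norm_exp_eq_Re power_mult_distrib real_scaleR_def mult.assoc[symmetric])
  qed
  finally have "integrable (gauss_measure \<nu>) (\<lambda>\<xi>. (norm (?h \<xi>))\<^sup>2)"
    by (subst gauss_integrable_iff) (use hm in auto)
  then show ?thesis using hm by (simp add: L2_def borel_measurable_gauss)
qed

text \<open>The kernel of the transform once exp(alpha xi^2) is moved to f. For n = 0, up to the
  factor nu/pi, it is the reproducing kernel of the Fock space times the weight.\<close>

definition fock_kernel :: "real \<Rightarrow> nat \<Rightarrow> complex \<Rightarrow> complex \<Rightarrow> complex" where
  "fock_kernel \<nu> n z \<xi> = exp (- of_real (\<nu> * (norm \<xi>)\<^sup>2) + of_real \<nu> * cnj \<xi> * z) * (cnj z - cnj \<xi>) ^ n"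

lemma fock_kernel_integral:
  assumes \<nu>: "0 < \<nu>" and g: "g holomorphic_on UNIV" "g \<in> L2 (gauss_measure \<nu>)"
  shows "integrable lborel (\<lambda>\<xi>. fock_kernel \<nu> n z \<xi> * g \<xi>)"
    and "(LINT \<xi>|lborel. fock_kernel \<nu> n z \<xi> * g \<xi>) = of_real (pi / \<nu> ^ Suc n) * (creation \<nu> ^^ n) g z"
proof -
  let ?M = "gauss_measure \<nu>"
  let ?h = "\<lambda>\<xi>. exp (- (of_real \<nu> * cnj z) * \<xi>) * g (z + \<xi>)"
  have cg: "continuous_on UNIV g" using g holomorphic_on_imp_continuous_on by blast
  have hol: "?h holomorphic_on UNIV"
    by (intro holomorphic_intros holomorphic_on_translate g)
  have hL2: "?h \<in> L2 ?M" by (rule translated_L2[OF g(2)])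
  have shift: "fock_kernel \<nu> n z (z + \<xi>) * g (z + \<xi>) =
      exp (- \<nu> * (norm \<xi>)\<^sup>2) *\<^sub>R ((-1) ^ n * (?h \<xi> * cnj (\<xi> ^ n)))" for \<xi>
  proof -
    have "complex_of_real (norm w ^ 2) = w * cnj w" for w using complex_norm_square by simp
    then have "- of_real (\<nu> * (norm (z + \<xi>))\<^sup>2) + of_real \<nu> * cnj (z + \<xi>) * z =
        of_real (- \<nu> * (norm \<xi>)\<^sup>2) + (- (of_real \<nu> * cnj z) * \<xi>)"
      by (simp add: algebra_simps del: of_real_power)
    then have "exp (- of_real (\<nu> * (norm (z + \<xi>))\<^sup>2) + of_real \<nu> * cnj (z + \<xi>) * z) =
        of_real (exp (- \<nu> * (norm \<xi>)\<^sup>2)) * exp (- (of_real \<nu> * cnj z) * \<xi>)"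
      by (simp only: exp_add exp_of_real)
    moreover have "(cnj z - cnj (z + \<xi>)) ^ n = (-1) ^ n * cnj (\<xi> ^ n)"
      by (simp add: power_minus[of "cnj \<xi>"])
    ultimately show ?thesis
      unfolding fock_kernel_def by (simp add: scaleR_conv_of_real mult_ac)
  qed
  have km: "(\<lambda>\<xi>. fock_kernel \<nu> n z \<xi> * g \<xi>) \<in> borel_measurable borel"
    unfolding fock_kernel_def
    by (intro borel_measurable_continuous_onI continuous_intros cg)
  have hm: "(\<lambda>\<xi>. (-1) ^ n * (?h \<xi> * cnj (\<xi> ^ n))) \<in> borel_measurable borel"
    by (intro borel_measurable_continuous_onI continuous_intros holomorphic_on_imp_continuous_on[OF hol])
  have "integrable ?M (\<lambda>\<xi>. (-1) ^ n * (?h \<xi> * cnj (\<xi> ^ n)))"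
    by (intro integrable_mult_right integrable_L2_inner hL2 power_L2 \<nu>)
  then have "integrable lborel (\<lambda>\<xi>. fock_kernel \<nu> n z (z + \<xi>) * g (z + \<xi>))"
    unfolding shift using gauss_integrable_iff[OF hm] by blast
  then show "integrable lborel (\<lambda>\<xi>. fock_kernel \<nu> n z \<xi> * g \<xi>)"
    using lborel_integral_translate(2)[OF km] by blast
  have "(\<lambda>k. (deriv ^^ k) ?h 0 / fact k * \<xi> ^ k) sums ?h \<xi>" for \<xi>
    using holomorphic_power_series[of ?h 0 "norm \<xi> + 1" \<xi>] hol
    by (auto intro: holomorphic_on_subset)
  \<comment> \<open>The factorial in the moment cancels the one in the Taylor coefficient.\<close>
  from gauss_moment_power_series[OF \<nu> this hL2]
  have mom: "l2_inner ?M ?h (\<lambda>\<xi>. \<xi> ^ n) = of_real (pi / \<nu> ^ Suc n) * (deriv ^^ n) ?h 0"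
    by simp
  have "(LINT \<xi>|lborel. fock_kernel \<nu> n z \<xi> * g \<xi>) = (LINT \<xi>|lborel. fock_kernel \<nu> n z (z + \<xi>) * g (z + \<xi>))"
    using lborel_integral_translate(1)[OF km, of z] by simp
  also have "\<dots> = (LINT \<xi>|?M. (-1) ^ n * (?h \<xi> * cnj (\<xi> ^ n)))"
    unfolding shift using gauss_integral[OF hm] by simp
  also have "\<dots> = (-1) ^ n * l2_inner ?M ?h (\<lambda>\<xi>. \<xi> ^ n)"
    unfolding l2_inner_def by (rule integral_mult_right_zero)
  \<comment> \<open>The sign (-1)^n produced by the translation is the one in
    \<open>creation_funpow_holomorphic\<close>.\<close>
  also have "\<dots> = of_real (pi / \<nu> ^ Suc n) * (creation \<nu> ^^ n) g z"
    unfolding mom creation_funpow_holomorphic[OF g(1)] by (simp only: mult_ac)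
  finally show "(LINT \<xi>|lborel. fock_kernel \<nu> n z \<xi> * g \<xi>) = of_real (pi / \<nu> ^ Suc n) * (creation \<nu> ^^ n) g z" .
qed

subsection \<open>Hermite polynomials\<close>

text \<open>Extended by zero beyond k = m div 2, so that sums for different m can run over a common
  range.\<close>

definition hermite_term :: "nat \<Rightarrow> nat \<Rightarrow> complex \<Rightarrow> complex" where
  "hermite_term m k z =
     (if 2 * k \<le> m then (-1) ^ k / fact k * ((2 * z) ^ (m - 2 * k) / fact (m - 2 * k)) else 0)"

lemma hermite_eq_sum:
  assumes "m \<le> K"
  shows "hermite m z = fact m * (\<Sum>k\<le>K. hermite_term m k z)"
proof -
  have "(\<Sum>k\<le>K. hermite_term m k z) = (\<Sum>k\<le>m div 2. hermite_term m k z)"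
    using assms by (intro sum.mono_neutral_right) (auto simp: hermite_term_def)
  also have "\<dots> = (\<Sum>k\<le>m div 2. (-1) ^ k / fact k * ((2 * z) ^ (m - 2 * k) / fact (m - 2 * k)))"
    by (intro sum.cong) (auto simp: hermite_term_def)
  finally show ?thesis by (simp add: hermite_def)
qed

lemma hermite_0: "hermite 0 z = 1"
  by (simp add: hermite_def)

lemma hermite_1: "hermite (Suc 0) z = 2 * z"
  by (simp add: hermite_def)

lemma hermite_term_rec:
  "of_nat (Suc (Suc m) - 2 * k) * hermite_term (Suc (Suc m)) k z = 2 * z * hermite_term (Suc m) k z"
proof (cases "2 * k \<le> Suc m")
  case True
  then obtain d where d: "Suc m = 2 * k + d" using le_Suc_ex by blast
  then have "Suc (Suc m) = 2 * k + Suc d" by simp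
  then show ?thesis unfolding hermite_term_def d using of_nat_neq_0[of d, where 'a=complex]
    by (simp add: field_simps del: of_nat_Suc)
next
  case False
  \<comment> \<open>If 2 k = m + 2 the factor on the left is zero, if 2 k is larger the term is; the
    right-hand term is zero in both cases.\<close>
  then show ?thesis by (auto simp: hermite_term_def)
qed

lemma hermite_term_shift:
  "2 * of_nat (Suc k) * hermite_term (Suc (Suc m)) (Suc k) z = - 2 * hermite_term m k z"
proof (cases "2 * k \<le> m")
  case True
  then show ?thesis using of_nat_neq_0[of k, where 'a=complex]
    by (simp add: hermite_term_def field_simps del: of_nat_Suc)
next
  case False
  then show ?thesis by (simp add: hermite_term_def)
qed

text \<open>Write m + 2 = (m + 2 - 2 k) + 2 k in front of the k-th term. The first part lowers the
  power of z and gives the terms of index m + 1; the second lowers k and gives those of index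
  m.\<close>

lemma hermite_rec:
  "hermite (Suc (Suc m)) z = 2 * z * hermite (Suc m) z - 2 * of_nat (Suc m) * hermite m z"
proof -
  let ?t = "hermite_term (Suc (Suc m))"
  let ?K = "Suc (Suc (Suc m))"
  have split: "of_nat (Suc (Suc m)) * ?t k z = 2 * z * hermite_term (Suc m) k z + 2 * of_nat k * ?t k z" for k
  proof (cases "2 * k \<le> Suc (Suc m)")
    case True
    then have "(of_nat (Suc (Suc m)) :: complex) = of_nat (Suc (Suc m) - 2 * k) + 2 * of_nat k"
      by (simp add: of_nat_diff)
    then show ?thesis by (simp only: distrib_right hermite_term_rec)
  qed (simp add: hermite_term_def)
  have "of_nat (Suc (Suc m)) * (\<Sum>k\<le>?K. ?t k z) =
      2 * z * (\<Sum>k\<le>?K. hermite_term (Suc m) k z) + (\<Sum>k\<le>?K. 2 * of_nat k * ?t k z)"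
    by (simp only: sum_distrib_left split sum.distrib)
  \<comment> \<open>The term k = 0 vanishes, so the index can be shifted.\<close>
  also have "(\<Sum>k\<le>?K. 2 * of_nat k * ?t k z) = (\<Sum>k\<le>Suc (Suc m). 2 * of_nat (Suc k) * ?t (Suc k) z)"
    by (subst sum.atMost_Suc_shift) simp
  also have "\<dots> = - 2 * (\<Sum>k\<le>Suc (Suc m). hermite_term m k z)"
    by (simp only: hermite_term_shift sum_distrib_left)
  finally have main: "of_nat (Suc (Suc m)) * (\<Sum>k\<le>?K. ?t k z) = 2 * z * (\<Sum>k\<le>?K. hermite_term (Suc m) k z)
      + - 2 * (\<Sum>k\<le>Suc (Suc m). hermite_term m k z)" .
  have "hermite (Suc (Suc m)) z = fact (Suc m) * (of_nat (Suc (Suc m)) * (\<Sum>k\<le>?K. ?t k z))"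
    unfolding hermite_eq_sum[OF le_SucI[OF order_refl], of "Suc (Suc m)" z] fact_Suc[of "Suc m"]
    by (simp only: mult_ac)
  also have "\<dots> = 2 * z * (fact (Suc m) * (\<Sum>k\<le>?K. hermite_term (Suc m) k z))
      - 2 * of_nat (Suc m) * (fact m * (\<Sum>k\<le>Suc (Suc m). hermite_term m k z))"
    unfolding main fact_Suc[of m] by (simp add: algebra_simps del: sum.atMost_Suc of_nat_Suc)
  also have "\<dots> = 2 * z * hermite (Suc m) z - 2 * of_nat (Suc m) * hermite m z"
    by (subst (1 2) hermite_eq_sum[symmetric]) auto
  finally show ?thesis .
qed

lemma hermite_term_deriv:
  "(hermite_term (Suc m) k has_field_derivative 2 * hermite_term m k z) (at z)"
proof (cases "2 * k \<le> m")
  case True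
  then have e: "Suc m - 2 * k = Suc (m - 2 * k)" by simp
  let ?d = "m - 2 * k"
  have "((\<lambda>z::complex. 2 * z) has_field_derivative 2) (at z)"
    by (auto intro!: derivative_eq_intros)
  from DERIV_cmult[OF DERIV_cdivide[OF DERIV_power[OF this, of "Suc ?d"], of "fact (Suc ?d)"], of "(-1) ^ k / fact k"]
  have "((\<lambda>z. (-1) ^ k / fact k * ((2 * z) ^ Suc ?d / fact (Suc ?d))) has_field_derivative
      (-1) ^ k / fact k * (of_nat (Suc ?d) * (2 * (2 * z) ^ ?d) / fact (Suc ?d))) (at z)"
    by (simp del: of_nat_Suc power_Suc fact_Suc)
  also have "(-1) ^ k / fact k * (of_nat (Suc ?d) * (2 * (2 * z) ^ ?d) / fact (Suc ?d)) =
      2 * ((-1) ^ k / fact k * ((2 * z) ^ ?d / fact ?d))"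
    using of_nat_neq_0[of ?d, where 'a=complex] unfolding fact_Suc
    by (simp add: field_simps del: of_nat_Suc)
  finally have "((\<lambda>z. (-1) ^ k / fact k * ((2 * z) ^ Suc ?d / fact (Suc ?d))) has_field_derivative
      2 * ((-1) ^ k / fact k * ((2 * z) ^ ?d / fact ?d))) (at z)" .
  then show ?thesis using True unfolding hermite_term_def e by simp
next
  case False
  then have "hermite_term (Suc m) k = (\<lambda>z. if 2 * k = Suc m then (-1) ^ k / fact k else 0)"
    by (auto simp: hermite_term_def fun_eq_iff)
  then show ?thesis using False by (simp add: hermite_term_def)
qed

lemma hermite_deriv:
  "(hermite m has_field_derivative 2 * of_nat m * hermite (m - 1) z) (at z)"
proof (cases m)
  case 0
  then show ?thesis by (simp add: hermite_0 [abs_def])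
next
  case (Suc l)
  have h: "hermite (Suc l) = (\<lambda>z. fact (Suc l) * (\<Sum>k\<le>Suc l. hermite_term (Suc l) k z))"
    using hermite_eq_sum[of "Suc l" "Suc l"] by blast
  have "((\<lambda>z. fact (Suc l) * (\<Sum>k\<le>Suc l. hermite_term (Suc l) k z)) has_field_derivative
      fact (Suc l) * (\<Sum>k\<le>Suc l. 2 * hermite_term l k z)) (at z)"
    by (intro DERIV_cmult DERIV_sum hermite_term_deriv)
  also have "fact (Suc l) * (\<Sum>k\<le>Suc l. 2 * hermite_term l k z) = 2 * of_nat (Suc l) * hermite l z"
    by (simp only: hermite_eq_sum[OF le_SucI[OF order_refl], of l z] fact_Suc sum_distrib_left[symmetric] mult_ac)
  finally show ?thesis using Suc h by simp
qed

text \<open>One formula for all m: at m = 0 the truncated index m - 1 stands behind a zero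
  factor.\<close>

lemma hermite_Suc: "hermite (Suc m) z = 2 * z * hermite m z - 2 * of_nat m * hermite (m - 1) z"
  by (cases m) (simp_all add: hermite_0 hermite_1 hermite_rec)

lemma hermite_poly: "\<exists>p. hermite m = poly p"
proof (induction m rule: less_induct)
  case (less m)
  show ?case
  proof (cases m)
    case 0
    then show ?thesis by (intro exI[of _ 1]) (auto simp: hermite_0 [abs_def])
  next
    case (Suc l)
    obtain p where "hermite l = poly p" using less.IH[of l] Suc by blast
    moreover obtain q where "hermite (l - 1) = poly q" using less.IH[of "l - 1"] Suc by fastforce
    ultimately    have "hermite m = poly ([:0, 2:] * p - smult (2 * of_nat l) q)"
      using Suc by (simp add: fun_eq_iff hermite_Suc)
    then show ?thesis by blast
  qed
qed

subsection \<open>Orthogonality of the Hermite functions\<close>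

lemma poly_L2: "0 < \<nu> \<Longrightarrow> poly q \<in> L2 (gauss_measure \<nu>)"
  using L2_sum[of "{..degree q}" "\<lambda>i z. coeff q i * z ^ i" "gauss_measure \<nu>"]
  by (simp add: poly_altdef [abs_def] L2_cmult power_L2)

text \<open>The growth exp(2 c |z|^2) is moved into the weight, whose rate drops from nu to nu - 2
  c. The conditions of the form 2 c < nu below keep this rate positive.\<close>

lemma gauss_exp_bound:
  assumes "q \<in> L2 (gauss_measure (\<nu> - 2 * c))"
  shows "integrable (gauss_measure \<nu>) (\<lambda>z. (exp (c * (norm z)\<^sup>2) * norm (q z))\<^sup>2)"
proof -
  have q: "q \<in> borel_measurable borel" using L2D(1)[OF assms] by (simp add: borel_measurable_gauss)
  have "integrable lborel (\<lambda>z. exp (- (\<nu> - 2 * c) * (norm z)\<^sup>2) *\<^sub>R (norm (q z))\<^sup>2)"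
    using L2D(2)[OF assms] q by (subst (asm) gauss_integrable_iff) auto
  also have "(\<lambda>z. exp (- (\<nu> - 2 * c) * (norm z)\<^sup>2) *\<^sub>R (norm (q z))\<^sup>2) =
      (\<lambda>z. exp (- \<nu> * (norm z)\<^sup>2) *\<^sub>R (exp (c * (norm z)\<^sup>2) * norm (q z))\<^sup>2)"
  proof
    fix z :: complex
    have "- (\<nu> - 2 * c) * (norm z)\<^sup>2 = - \<nu> * (norm z)\<^sup>2 + 2 * (c * (norm z)\<^sup>2)"
      by (simp add: algebra_simps)
    then have "exp (- (\<nu> - 2 * c) * (norm z)\<^sup>2) = exp (- \<nu> * (norm z)\<^sup>2) * (exp (c * (norm z)\<^sup>2))\<^sup>2"
      by (simp only: exp_add exp_double)
    then show "exp (- (\<nu> - 2 * c) * (norm z)\<^sup>2) *\<^sub>R (norm (q z))\<^sup>2 =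
        exp (- \<nu> * (norm z)\<^sup>2) *\<^sub>R (exp (c * (norm z)\<^sup>2) * norm (q z))\<^sup>2"
      by (simp add: power_mult_distrib)
  qed
  finally show ?thesis
    using q by (subst gauss_integrable_iff) auto
qed

lemma norm_exp_square_le:
  fixes z :: complex
  shows "norm (exp (of_real c * z\<^sup>2)) \<le> exp (\<bar>c\<bar> * (norm z)\<^sup>2)"
proof -
  have "Re (of_real c * z\<^sup>2) \<le> norm (of_real c * z\<^sup>2)" by (rule complex_Re_le_cmod)
  then show ?thesis by (simp add: norm_exp_eq_Re norm_mult norm_power)
qed

definition gauss_poly :: "real \<Rightarrow> complex poly \<Rightarrow> complex \<Rightarrow> complex" where
  "gauss_poly c q z = exp (of_real c * z\<^sup>2) * poly q z"

lemma gauss_poly_holomorphic: "gauss_poly c q holomorphic_on UNIV"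
  unfolding gauss_poly_def [abs_def] by (intro holomorphic_intros)

lemma gauss_poly_L2:
  assumes "0 \<le> c" "2 * c < \<nu>"
  shows "gauss_poly c q \<in> L2 (gauss_measure \<nu>)"
proof (rule L2_bound)
  show "gauss_poly c q \<in> borel_measurable (gauss_measure \<nu>)"
    using holomorphic_on_imp_continuous_on[OF gauss_poly_holomorphic]
    by (simp add: borel_measurable_gauss borel_measurable_continuous_onI)
  show "integrable (gauss_measure \<nu>) (\<lambda>z. (exp (c * (norm z)\<^sup>2) * norm (poly q z))\<^sup>2)"
    using assms by (intro gauss_exp_bound poly_L2) auto
  show "(norm (gauss_poly c q z))\<^sup>2 \<le> (exp (c * (norm z)\<^sup>2) * norm (poly q z))\<^sup>2" for z
    using norm_exp_square_le[of c z] assms unfolding gauss_poly_def norm_mult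
    by (intro power_mono mult_right_mono) auto
qed

definition hermite_fun :: "real \<Rightarrow> nat \<Rightarrow> complex \<Rightarrow> complex" where
  "hermite_fun \<gamma> m z = exp (of_real \<gamma> * z\<^sup>2) * hermite m z"

lemma hermite_fun_gauss_poly: "\<exists>q. hermite_fun \<gamma> m = gauss_poly \<gamma> q"
  using hermite_poly[of m] by (auto simp: hermite_fun_def gauss_poly_def fun_eq_iff)

lemma hermite_fun_holomorphic: "hermite_fun \<gamma> m holomorphic_on UNIV"
  using hermite_fun_gauss_poly gauss_poly_holomorphic by metis

lemma hermite_fun_L2: "0 \<le> \<gamma> \<Longrightarrow> 2 * \<gamma> < \<nu> \<Longrightarrow> hermite_fun \<gamma> m \<in> L2 (gauss_measure \<nu>)"
  using hermite_fun_gauss_poly gauss_poly_L2 by metis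

lemma hermite_fun_times_L2:
  assumes "0 \<le> \<gamma>" "2 * \<gamma> < \<nu>"
  shows "(\<lambda>z. z * hermite_fun \<gamma> m z) \<in> L2 (gauss_measure \<nu>)"
proof -
  obtain q where "hermite_fun \<gamma> m = gauss_poly \<gamma> q" using hermite_fun_gauss_poly by blast
  then have "(\<lambda>z. z * hermite_fun \<gamma> m z) = gauss_poly \<gamma> ([:0, 1:] * q)"
    by (simp add: gauss_poly_def fun_eq_iff)
  then show ?thesis using gauss_poly_L2[OF assms] by metis
qed

lemma hermite_fun_deriv:
  "deriv (hermite_fun \<gamma> m) = (\<lambda>z. (2 * of_real \<gamma>) * (z * hermite_fun \<gamma> m z) + (2 * of_nat m) * hermite_fun \<gamma> (m - 1) z)"
proof
  fix z :: complex
  have "((\<lambda>z. exp (of_real \<gamma> * z\<^sup>2)) has_field_derivative exp (of_real \<gamma> * z\<^sup>2) * (of_real \<gamma> * (2 * z))) (at z)"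
    by (auto intro!: derivative_eq_intros)
  from DERIV_mult[OF this hermite_deriv[of m z]]
  have "(hermite_fun \<gamma> m has_field_derivative exp (of_real \<gamma> * z\<^sup>2) * (of_real \<gamma> * (2 * z)) * hermite m z +
      2 * of_nat m * hermite (m - 1) z * exp (of_real \<gamma> * z\<^sup>2)) (at z)"
    unfolding hermite_fun_def [abs_def] .
  from DERIV_imp_deriv[OF this]
  show "deriv (hermite_fun \<gamma> m) z = (2 * of_real \<gamma>) * (z * hermite_fun \<gamma> m z) + (2 * of_nat m) * hermite_fun \<gamma> (m - 1) z"
    by (simp add: hermite_fun_def algebra_simps)
qed

text \<open>Eliminating index m - 1 between the three-term recursion and the formula for the
  derivative leaves a raising operator of first order.\<close>

lemma hermite_fun_Suc:
  "hermite_fun \<gamma> (Suc m) = (\<lambda>z. (2 + 2 * of_real \<gamma>) * (z * hermite_fun \<gamma> m z) - deriv (hermite_fun \<gamma> m) z)"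
  unfolding hermite_fun_deriv by (auto simp: fun_eq_iff hermite_fun_def hermite_Suc algebra_simps)

text \<open>The condition on \<open>\<gamma>\<close> makes the raising operator \<open>(2 + 2 \<gamma>) z - \<partial>\<^sub>z\<close> a multiple of the adjoint of
  the lowering operator \<open>\<partial>\<^sub>z - 2 \<gamma> z\<close>.\<close>

lemma hermite_fun_inner_Suc:
  assumes \<gamma>: "0 \<le> \<gamma>" "2 * \<gamma> < \<nu>" "\<nu>\<^sup>2 = 4 * \<gamma> * (1 + \<gamma>)"
  shows "l2_inner (gauss_measure \<nu>) (hermite_fun \<gamma> (Suc m)) (hermite_fun \<gamma> k) =
    of_real (4 * (1 + \<gamma>) / \<nu> * k) * l2_inner (gauss_measure \<nu>) (hermite_fun \<gamma> m) (hermite_fun \<gamma> (k - 1))"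
proof -
  let ?M = "gauss_measure \<nu>"
  let ?f = "hermite_fun \<gamma>"
  let ?z = "\<lambda>m z. z * ?f m z"
  have \<nu>: "0 < \<nu>" using \<gamma> by linarith
  note L = hermite_fun_L2[OF \<gamma>(1,2)] hermite_fun_times_L2[OF \<gamma>(1,2)]
  have dL: "deriv (?f m) \<in> L2 ?M" for m
    unfolding hermite_fun_deriv by (intro L2_add L2_cmult L)
  have adj: "l2_inner ?M (?f i) (deriv (?f j)) = of_real \<nu> * l2_inner ?M (?z i) (?f j)" for i j
    by (intro l2_inner_deriv \<nu> hermite_fun_holomorphic L dL)
  have "l2_inner ?M (deriv (?f m)) (?f k) = cnj (l2_inner ?M (?f k) (deriv (?f m)))"
    by (rule l2_inner_cnj)
  also have "\<dots> = of_real \<nu> * cnj (l2_inner ?M (?z k) (?f m))"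
    unfolding adj by simp
  also have "cnj (l2_inner ?M (?z k) (?f m)) = l2_inner ?M (?f m) (?z k)"
    by (rule l2_inner_cnj[symmetric])
  finally have d1: "l2_inner ?M (deriv (?f m)) (?f k) = of_real \<nu> * l2_inner ?M (?f m) (?z k)" .
  have "l2_inner ?M (?f m) (deriv (?f k)) =
      2 * of_real \<gamma> * l2_inner ?M (?f m) (?z k) + 2 * of_nat k * l2_inner ?M (?f m) (?f (k - 1))"
    unfolding hermite_fun_deriv
    by (subst l2_inner_add_right) (auto simp: l2_inner_cmult_right intro!: L2_cmult L)
  then have d2: "of_real \<nu> * l2_inner ?M (?z m) (?f k) =
      2 * of_real \<gamma> * l2_inner ?M (?f m) (?z k) + 2 * of_nat k * l2_inner ?M (?f m) (?f (k - 1))"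
    unfolding adj .
  have "l2_inner ?M (?f (Suc m)) (?f k) =
      (2 + 2 * of_real \<gamma>) * l2_inner ?M (?z m) (?f k) - l2_inner ?M (deriv (?f m)) (?f k)"
    unfolding hermite_fun_Suc
    by (subst l2_inner_diff_left) (auto simp: l2_inner_cmult_left intro!: L2_cmult L dL)
  note Suc_eq = this
  have "of_real \<nu> * l2_inner ?M (?f (Suc m)) (?f k) =
      (2 + 2 * of_real \<gamma>) * (of_real \<nu> * l2_inner ?M (?z m) (?f k)) - of_real (\<nu>\<^sup>2) * l2_inner ?M (?f m) (?z k)"
    unfolding Suc_eq d1 by (simp add: algebra_simps power2_eq_square)
  \<comment> \<open>After inserting \<open>d2\<close> the pairing of \<open>?f m\<close> with
    \<open>?z k\<close> has coefficient 2 gamma (2 + 2 gamma) - nu^2, which is zero by the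
    assumption on gamma.\<close>
  also have "\<dots> = 4 * (1 + of_real \<gamma>) * of_nat k * l2_inner ?M (?f m) (?f (k - 1))"
    unfolding d2 \<gamma>(3) by (simp add: algebra_simps)
  finally show ?thesis using \<nu> by (simp add: field_simps)
qed

text \<open>\<open>hermite_fun_inner_Suc\<close> lowers both indices, and its factor k kills the
  pairing if k reaches 0 first. What remains is the squared norm of exp(gamma z^2), a Gaussian
  integral with rates nu - 2 gamma and nu + 2 gamma.\<close>

lemma hermite_fun_inner:
  assumes \<gamma>: "0 \<le> \<gamma>" "2 * \<gamma> < \<nu>" "\<nu>\<^sup>2 = 4 * \<gamma> * (1 + \<gamma>)"
  shows "l2_inner (gauss_measure \<nu>) (hermite_fun \<gamma> j) (hermite_fun \<gamma> k) =
    (if j = k then of_real ((4 * (1 + \<gamma>) / \<nu>) ^ j * fact j * (pi / sqrt (\<nu>\<^sup>2 - 4 * \<gamma>\<^sup>2))) else 0)"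
proof (induction j arbitrary: k)
  let ?M = "gauss_measure \<nu>"
  let ?f = "hermite_fun \<gamma>"
  case 0
  show ?case
  proof (cases k)
    case 0
    have "exp (- \<nu> * (norm z)\<^sup>2) *\<^sub>R (norm (?f 0 z))\<^sup>2 =
        exp (- (\<nu> - 2 * \<gamma>) * (Re z)\<^sup>2 - (\<nu> + 2 * \<gamma>) * (Im z)\<^sup>2)" for z
    proof -
      have "Re (of_real \<gamma> * z\<^sup>2) = \<gamma> * ((Re z)\<^sup>2 - (Im z)\<^sup>2)"
        by (simp add: power2_eq_square)
      then have "(norm (?f 0 z))\<^sup>2 = exp (2 * (\<gamma> * ((Re z)\<^sup>2 - (Im z)\<^sup>2)))"
        by (simp only: hermite_fun_def hermite_0 mult_1_right norm_exp_eq_Re exp_double)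
      then show ?thesis
        unfolding cmod_power2 by (simp add: exp_add[symmetric] algebra_simps)
    qed
    moreover have "continuous_on UNIV (\<lambda>z. (norm (?f 0 z))\<^sup>2)"
      by (intro continuous_intros holomorphic_on_imp_continuous_on hermite_fun_holomorphic)
    ultimately have "(LINT z|?M. (norm (?f 0 z))\<^sup>2) = pi / sqrt ((\<nu> - 2 * \<gamma>) * (\<nu> + 2 * \<gamma>))"
      using gaussian_complex_integral[of "\<nu> - 2 * \<gamma>" "\<nu> + 2 * \<gamma>"] \<gamma>
      by (simp add: gauss_integral borel_measurable_continuous_onI has_bochner_integral_iff)
    also have "(\<nu> - 2 * \<gamma>) * (\<nu> + 2 * \<gamma>) = \<nu>\<^sup>2 - 4 * \<gamma>\<^sup>2"
      by (simp add: algebra_simps power2_eq_square)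
    finally show ?thesis using 0 by (simp add: l2_inner_self)
  next
    case (Suc l)
    then show ?thesis
      using hermite_fun_inner_Suc[OF \<gamma>, of l 0] l2_inner_cnj[of ?M "?f 0" "?f k"] by simp
  qed
next
  case (Suc j)
  show ?case
  proof (cases k)
    case 0
    then show ?thesis using hermite_fun_inner_Suc[OF \<gamma>, of j 0] by simp
  next
    case (Suc l)
    then show ?thesis
      using hermite_fun_inner_Suc[OF \<gamma>, of j k] Suc.IH[of l] by (simp add: algebra_simps)
  qed
qed

subsection \<open>Density\<close>

definition l2_approx :: "complex measure \<Rightarrow> (complex \<Rightarrow> complex) set \<Rightarrow> (complex \<Rightarrow> complex) \<Rightarrow> bool" where
  "l2_approx M S g \<longleftrightarrow> (\<forall>\<epsilon>>0. \<exists>f\<in>S. (LINT z|M. (norm (g z - f z))\<^sup>2) < \<epsilon>)"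

lemma l2_approx_trans:
  assumes g: "l2_approx M S g" and S: "\<And>f. f \<in> S \<Longrightarrow> l2_approx M T f"
    and L: "g \<in> L2 M" "S \<subseteq> L2 M" "T \<subseteq> L2 M"
  shows "l2_approx M T g"
  unfolding l2_approx_def
proof (intro allI impI)
  fix \<epsilon> :: real assume "\<epsilon> > 0"
  \<comment> \<open>A quarter, since the squared triangle inequality doubles each of the two
    errors.\<close>
  then have "\<epsilon> / 4 > 0" by simp
  then obtain f where f: "f \<in> S" "(LINT z|M. (norm (g z - f z))\<^sup>2) < \<epsilon> / 4"
    using g unfolding l2_approx_def by blast
  obtain h where h: "h \<in> T" "(LINT z|M. (norm (f z - h z))\<^sup>2) < \<epsilon> / 4"
    using S[OF f(1)] \<open>\<epsilon> / 4 > 0\<close> unfolding l2_approx_def by blast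
  have "f \<in> L2 M" "h \<in> L2 M" using f h L by auto
  then have "(LINT z|M. (norm ((g z - f z) + (f z - h z)))\<^sup>2) \<le>
      2 * (LINT z|M. (norm (g z - f z))\<^sup>2) + 2 * (LINT z|M. (norm (f z - h z))\<^sup>2)"
    by (intro integral_norm_add_square_le L2_diff L)
  then show "\<exists>h\<in>T. (LINT z|M. (norm (g z - h z))\<^sup>2) < \<epsilon>"
    using f h by (intro bexI[of _ h]) auto
qed

text \<open>The n-th moment is the n-th Taylor coefficient times the squared norm pi n! / nu^(n+1)
  of z^n, so pairing with a section of the series gives a sum of squares.\<close>

lemma gauss_power_inner_sum:
  assumes \<nu>: "0 < \<nu>" and h: "\<And>z. (\<lambda>k. a k * z ^ k) sums h z" "h \<in> L2 (gauss_measure \<nu>)"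
    and "finite A"
  shows "l2_inner (gauss_measure \<nu>) h (\<lambda>z. \<Sum>n\<in>A. a n * z ^ n) =
    of_real (\<Sum>n\<in>A. (norm (a n))\<^sup>2 * (pi * fact n / \<nu> ^ Suc n))"
proof -
  have "l2_inner (gauss_measure \<nu>) h (\<lambda>z. \<Sum>n\<in>A. a n * z ^ n) =
      (\<Sum>n\<in>A. l2_inner (gauss_measure \<nu>) h (\<lambda>z. a n * z ^ n))"
    by (intro l2_inner_sum_right h L2_cmult power_L2 \<nu>)
  also have "\<dots> = (\<Sum>n\<in>A. of_real ((norm (a n))\<^sup>2 * (pi * fact n / \<nu> ^ Suc n)))"
  proof (intro sum.cong refl)
    fix n
    have "l2_inner (gauss_measure \<nu>) h (\<lambda>z. a n * z ^ n) = of_real (pi * fact n / \<nu> ^ Suc n) * (a n * cnj (a n))"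
      unfolding l2_inner_cmult_right gauss_moment_power_series[OF \<nu> h] by (simp only: mult_ac)
    then show "l2_inner (gauss_measure \<nu>) h (\<lambda>z. a n * z ^ n) = of_real ((norm (a n))\<^sup>2 * (pi * fact n / \<nu> ^ Suc n))"
      by (simp only: complex_norm_square[symmetric] of_real_mult mult_ac)
  qed
  finally show ?thesis by simp
qed

lemma gauss_power_norm_sum:
  assumes \<nu>: "0 < \<nu>" and A: "finite A"
  shows "(LINT z|gauss_measure \<nu>. (norm (\<Sum>n\<in>A. a n * z ^ n))\<^sup>2) =
    (\<Sum>n\<in>A. (norm (a n))\<^sup>2 * (pi * fact n / \<nu> ^ Suc n))"
proof -
  let ?b = "\<lambda>n. if n \<in> A then a n else 0"
  let ?p = "\<lambda>z. \<Sum>n\<in>A. a n * z ^ n"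
  have "(\<lambda>k. ?b k * z ^ k) sums ?p z" for z
    using sums_finite[of A "\<lambda>k. ?b k * z ^ k"] A by auto
  moreover have "?p \<in> L2 (gauss_measure \<nu>)"
    by (intro L2_sum L2_cmult power_L2 \<nu>)
  ultimately have "l2_inner (gauss_measure \<nu>) ?p (\<lambda>z. \<Sum>n\<in>A. ?b n * z ^ n) =
      of_real (\<Sum>n\<in>A. (norm (?b n))\<^sup>2 * (pi * fact n / \<nu> ^ Suc n))"
    using gauss_power_inner_sum[OF \<nu>, of ?b ?p A] A by blast
  also have "(\<lambda>z. \<Sum>n\<in>A. ?b n * z ^ n) = ?p"
    by (intro ext sum.cong) auto
  also have "(\<Sum>n\<in>A. (norm (?b n))\<^sup>2 * (pi * fact n / \<nu> ^ Suc n)) = (\<Sum>n\<in>A. (norm (a n))\<^sup>2 * (pi * fact n / \<nu> ^ Suc n))"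
    by (intro sum.cong) auto
  finally show ?thesis
    unfolding l2_inner_self using of_real_eq_iff[where 'a=complex] by blast
qed

text \<open>Bessel's inequality makes the squared norms of the Taylor terms summable. The Taylor
  series converges pointwise, so Fatou bounds the squared error of a partial sum by the tail of that
  series; completeness of the space does not enter.\<close>

lemma polynomials_dense:
  assumes \<nu>: "0 < \<nu>" and g: "g \<in> fock_space \<nu> 0"
  shows "l2_approx (gauss_measure \<nu>) (range (gauss_poly 0)) g"
  unfolding l2_approx_def
proof (intro allI impI)
  fix \<epsilon> :: real assume \<epsilon>: "\<epsilon> > 0"
  let ?M = "gauss_measure \<nu>"
  have hol: "g holomorphic_on UNIV" and gL: "g \<in> L2 ?M" using g fock_0_iff by auto
  define a where "a k = (deriv ^^ k) g 0 / fact k" for k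
  have sums: "(\<lambda>k. a k * z ^ k) sums g z" for z
    using holomorphic_power_series[of g 0 "norm z + 1" z] hol
    by (auto simp: a_def intro: holomorphic_on_subset)
  define b where "b n = (norm (a n))\<^sup>2 * (pi * fact n / \<nu> ^ Suc n)" for n
  have b0: "0 \<le> b n" for n using \<nu> by (simp add: b_def)
  have bessel: "(\<Sum>n<N. b n) \<le> (LINT z|?M. (norm (g z))\<^sup>2)" for N
  proof -
    let ?p = "\<lambda>z. \<Sum>n<N. a n * z ^ n"
    have pL: "?p \<in> L2 ?M" by (intro L2_sum L2_cmult power_L2 \<nu>)
    have gp: "l2_inner ?M g ?p = of_real (\<Sum>n<N. b n)"
      unfolding b_def by (rule gauss_power_inner_sum[OF \<nu> sums gL]) simp
    have pg: "l2_inner ?M ?p g = of_real (\<Sum>n<N. b n)"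
      using l2_inner_cnj[of ?M ?p g] gp by simp
    have pp: "l2_inner ?M ?p ?p = of_real (\<Sum>n<N. b n)"
      unfolding l2_inner_self b_def using gauss_power_norm_sum[OF \<nu>, of "{..<N}" a] by simp
    have "l2_inner ?M (\<lambda>z. g z - ?p z) (\<lambda>z. g z - ?p z) =
        l2_inner ?M g (\<lambda>z. g z - ?p z) - l2_inner ?M ?p (\<lambda>z. g z - ?p z)"
      by (intro l2_inner_diff_left L2_diff gL pL)
    also have "\<dots> = l2_inner ?M g g - of_real (\<Sum>n<N. b n)"
      by (simp only: l2_inner_diff_right[OF gL pL gL] l2_inner_diff_right[OF gL pL pL] gp pg pp) simp
    finally have "complex_of_real (LINT z|?M. (norm (g z - ?p z))\<^sup>2) =
        of_real ((LINT z|?M. (norm (g z))\<^sup>2) - (\<Sum>n<N. b n))"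
      by (simp only: l2_inner_self of_real_diff)
    then have "(LINT z|?M. (norm (g z - ?p z))\<^sup>2) = (LINT z|?M. (norm (g z))\<^sup>2) - (\<Sum>n<N. b n)"
      by (simp only: of_real_eq_iff)
    moreover have "0 \<le> (LINT z|?M. (norm (g z - ?p z))\<^sup>2)" by simp
    ultimately show ?thesis by linarith
  qed
  have summ: "summable b"
    by (rule summableI_nonneg_bounded[OF b0 bessel])
  then obtain N where N: "norm (\<Sum>k. b (k + N)) < \<epsilon>"
    using suminf_exist_split[OF \<epsilon> summ] by blast
  have "(LINT z|?M. (norm (g z - (\<Sum>n<N. a n * z ^ n)))\<^sup>2) \<le> (\<Sum>k. b (k + N))"
  \<comment> \<open>The sections from N to N + m converge pointwise to the error, and by
    orthogonality their squared norms are sections of the tail.\<close>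
  proof (rule Fatou_integral(2)[where s = "\<lambda>m z. (norm (\<Sum>n\<in>{N..<N + m}. a n * z ^ n))\<^sup>2"])
    show "integrable ?M (\<lambda>z. (norm (\<Sum>n\<in>{N..<N + m}. a n * z ^ n))\<^sup>2)" for m
      by (intro L2D L2_sum L2_cmult power_L2 \<nu>)
    fix z
    have "(\<lambda>m. (\<Sum>n<m + N. a n * z ^ n) - (\<Sum>n<N. a n * z ^ n)) \<longlonglongrightarrow> g z - (\<Sum>n<N. a n * z ^ n)"
      using sums[of z] unfolding sums_def by (intro tendsto_diff tendsto_const LIMSEQ_ignore_initial_segment)
    moreover have "(\<Sum>n<m + N. a n * z ^ n) - (\<Sum>n<N. a n * z ^ n) = (\<Sum>n\<in>{N..<N + m}. a n * z ^ n)" for m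
      using sum.atLeastLessThan_concat[of 0 N "N + m" "\<lambda>n. a n * z ^ n"]
      by (simp add: lessThan_atLeast0 add.commute algebra_simps)
    ultimately show "(\<lambda>m. (norm (\<Sum>n\<in>{N..<N + m}. a n * z ^ n))\<^sup>2) \<longlonglongrightarrow> (norm (g z - (\<Sum>n<N. a n * z ^ n)))\<^sup>2"
      by (intro tendsto_power tendsto_norm) simp
  next
    fix m
    have "(LINT z|?M. (norm (\<Sum>n\<in>{N..<N + m}. a n * z ^ n))\<^sup>2) = (\<Sum>n\<in>{N..<N + m}. b n)"
      unfolding b_def by (rule gauss_power_norm_sum[OF \<nu>]) simp
    also have "\<dots> = (\<Sum>k<m. b (k + N))"
      using sum.shift_bounds_nat_ivl[of b 0 N m] by (simp add: lessThan_atLeast0 add.commute)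
    also have "\<dots> \<le> (\<Sum>k. b (k + N))"
      using summ b0 by (intro sum_le_suminf) (auto simp: summable_iff_shift)
    finally show "(LINT z|?M. (norm (\<Sum>n\<in>{N..<N + m}. a n * z ^ n))\<^sup>2) \<le> (\<Sum>k. b (k + N))" .
  qed simp
  moreover have "(\<lambda>z. \<Sum>n<N. a n * z ^ n) = gauss_poly 0 (\<Sum>n<N. monom (a n) n)"
    by (simp add: gauss_poly_def poly_sum poly_monom fun_eq_iff)
  ultimately show "\<exists>f\<in>range (gauss_poly 0). (LINT z|?M. (norm (g z - f z))\<^sup>2) < \<epsilon>"
    using N by (intro bexI[of _ "gauss_poly 0 (\<Sum>n<N. monom (a n) n)"]) (auto simp: fun_eq_iff)
qed

text \<open>The remainder is dominated term by term by that of exp(|x|). The bound is uniform in J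
  and serves as a majorant for dominated convergence.\<close>

lemma norm_exp_minus_partial_sum_le:
  fixes x :: complex
  shows "norm (exp x - (\<Sum>j<J. x ^ j / fact j)) \<le> exp (norm x)"
proof -
  have s: "(\<lambda>j. y ^ j / fact j) sums exp y" for y :: "'b::{real_normed_field,banach}"
    using exp_converges[of y] by (simp add: scaleR_conv_of_real divide_inverse mult.commute)
  have "(\<lambda>j. x ^ (j + J) / fact (j + J)) sums (exp x - (\<Sum>j<J. x ^ j / fact j))"
    using sums_split_initial_segment[OF s] .
  moreover have n: "(\<lambda>j. norm x ^ (j + J) / fact (j + J)) sums (exp (norm x) - (\<Sum>j<J. norm x ^ j / fact j))"
    using sums_split_initial_segment[OF s] .
  ultimately have "norm (exp x - (\<Sum>j<J. x ^ j / fact j)) \<le> exp (norm x) - (\<Sum>j<J. norm x ^ j / fact j)"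
    using norm_suminf_le[of "\<lambda>j. x ^ (j + J) / fact (j + J)" "\<lambda>j. norm x ^ (j + J) / fact (j + J)"]
    by (simp add: sums_iff norm_divide norm_power)
  also have "\<dots> \<le> exp (norm x)" by (simp add: sum_nonneg)
  finally show ?thesis .
qed

text \<open>Write exp(c z^2) = exp((c + \<delta>) z^2) exp(- \<delta> z^2) and expand the second
  factor. The remainder costs another exp(\<delta> |z|^2), so the majorant grows like exp((c + 2
  \<delta>) |z|^2); this is the origin of the strict hypothesis.\<close>

lemma gauss_poly_step:
  assumes c: "0 \<le> c" "0 \<le> \<delta>" "2 * (c + 2 * \<delta>) < \<nu>"
  shows "l2_approx (gauss_measure \<nu>) (range (gauss_poly (c + \<delta>))) (gauss_poly c q)"
  unfolding l2_approx_def
proof (intro allI impI)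
  fix \<epsilon> :: real assume \<epsilon>: "\<epsilon> > 0"
  let ?M = "gauss_measure \<nu>"
  let ?x = "\<lambda>z. - of_real \<delta> * z\<^sup>2 :: complex"
  let ?T = "\<lambda>J z. \<Sum>j<J. ?x z ^ j / fact j"
  define P where "P J = q * (\<Sum>j<J. smult (1 / fact j) ((monom (- of_real \<delta>) 2) ^ j))" for J
  have P: "gauss_poly (c + \<delta>) (P J) z = exp (of_real (c + \<delta>) * z\<^sup>2) * (poly q z * ?T J z)" for J z
    by (simp add: gauss_poly_def P_def poly_sum poly_power poly_monom)
  have e: "gauss_poly c q z = exp (of_real (c + \<delta>) * z\<^sup>2) * (poly q z * exp (?x z))" for z
  proof -
    have "exp (of_real c * z\<^sup>2) = exp (of_real (c + \<delta>) * z\<^sup>2) * exp (?x z)"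
      unfolding exp_add[symmetric] by (simp add: algebra_simps)
    then show ?thesis by (simp add: gauss_poly_def mult_ac)
  qed
  have diff: "gauss_poly c q z - gauss_poly (c + \<delta>) (P J) z =
      exp (of_real (c + \<delta>) * z\<^sup>2) * poly q z * (exp (?x z) - ?T J z)" for J z
    unfolding P e by (simp add: algebra_simps)
  have bound: "norm (gauss_poly c q z - gauss_poly (c + \<delta>) (P J) z) \<le>
      exp ((c + 2 * \<delta>) * (norm z)\<^sup>2) * norm (poly q z)" for J z
  proof -
    have "norm (gauss_poly c q z - gauss_poly (c + \<delta>) (P J) z) =
        norm (exp (of_real (c + \<delta>) * z\<^sup>2)) * norm (poly q z) * norm (exp (?x z) - ?T J z)"
      unfolding diff norm_mult ..
    also have "\<dots> \<le> exp (\<bar>c + \<delta>\<bar> * (norm z)\<^sup>2) * norm (poly q z) * exp (norm (?x z))"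
      by (intro mult_mono norm_exp_square_le norm_exp_minus_partial_sum_le) auto
    also have "\<dots> = exp ((c + \<delta>) * (norm z)\<^sup>2) * exp (\<delta> * (norm z)\<^sup>2) * norm (poly q z)"
      using c by (simp add: norm_mult norm_power mult_ac)
    also have "exp ((c + \<delta>) * (norm z)\<^sup>2) * exp (\<delta> * (norm z)\<^sup>2) = exp ((c + 2 * \<delta>) * (norm z)\<^sup>2)"
      unfolding exp_add[symmetric] by (simp add: algebra_simps)
    finally show ?thesis .
  qed
  have cont: "continuous_on UNIV (gauss_poly a r)" for a r
    by (rule holomorphic_on_imp_continuous_on[OF gauss_poly_holomorphic])
  have "(\<lambda>J. LINT z|?M. (norm (gauss_poly c q z - gauss_poly (c + \<delta>) (P J) z))\<^sup>2) \<longlonglongrightarrow> (LINT z|?M. 0)"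
  proof (rule integral_dominated_convergence[where w = "\<lambda>z. (exp ((c + 2 * \<delta>) * (norm z)\<^sup>2) * norm (poly q z))\<^sup>2"])
    show "(\<lambda>z. (norm (gauss_poly c q z - gauss_poly (c + \<delta>) (P J) z))\<^sup>2) \<in> borel_measurable ?M" for J
      unfolding borel_measurable_gauss
      by (intro borel_measurable_continuous_onI continuous_intros cont)
    show "integrable ?M (\<lambda>z. (exp ((c + 2 * \<delta>) * (norm z)\<^sup>2) * norm (poly q z))\<^sup>2)"
      using c by (intro gauss_exp_bound poly_L2) auto
    have "(\<lambda>J. norm (gauss_poly c q z - gauss_poly (c + \<delta>) (P J) z) ^ 2) \<longlonglongrightarrow> (norm (exp (of_real (c + \<delta>) * z\<^sup>2) * poly q z * (exp (?x z) - exp (?x z)))) ^ 2" for z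
      unfolding diff
    proof (intro tendsto_intros)
      have "(\<lambda>j. ?x z ^ j / fact j) sums exp (?x z)"
        using exp_converges[of "?x z"] by (simp add: scaleR_conv_of_real divide_inverse mult.commute)
      then show "(\<lambda>J. ?T J z) \<longlonglongrightarrow> exp (?x z)" by (simp add: sums_def)
    qed
    then show "AE z in ?M. (\<lambda>J. (norm (gauss_poly c q z - gauss_poly (c + \<delta>) (P J) z))\<^sup>2) \<longlonglongrightarrow> 0"
      by simp
    show "AE z in ?M. norm ((norm (gauss_poly c q z - gauss_poly (c + \<delta>) (P J) z))\<^sup>2) \<le>
        (exp ((c + 2 * \<delta>) * (norm z)\<^sup>2) * norm (poly q z))\<^sup>2" for J
      using power_mono[OF bound norm_ge_zero, of _ J 2] by simp
  qed simp
  then have "(\<lambda>J. LINT z|?M. (norm (gauss_poly c q z - gauss_poly (c + \<delta>) (P J) z))\<^sup>2) \<longlonglongrightarrow> 0"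
    by simp
  then have "\<forall>\<^sub>F J in sequentially. (LINT z|?M. (norm (gauss_poly c q z - gauss_poly (c + \<delta>) (P J) z))\<^sup>2) < \<epsilon>"
    using \<epsilon> by (rule order_tendstoD)
  then obtain J where "(LINT z|?M. (norm (gauss_poly c q z - gauss_poly (c + \<delta>) (P J) z))\<^sup>2) < \<epsilon>"
    by (auto simp: eventually_sequentially)
  then show "\<exists>f\<in>range (gauss_poly (c + \<delta>)). (LINT z|?M. (norm (gauss_poly c q z - f z))\<^sup>2) < \<epsilon>"
    by blast
qed

text \<open>The expansion of \<open>exp (- \<gamma> z\<^sup>2)\<close> converges in norm only for small \<open>\<gamma>\<close>, hence the passage
  from exponent \<open>0\<close> to exponent \<open>\<gamma>\<close> in many small steps.\<close>

lemma gauss_poly_dense: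
  assumes \<gamma>: "0 \<le> \<gamma>" "2 * \<gamma> < \<nu>" and g: "g \<in> fock_space \<nu> 0"
  shows "l2_approx (gauss_measure \<nu>) (range (gauss_poly \<gamma>)) g"
proof -
  have \<nu>: "0 < \<nu>" using \<gamma> by linarith
  \<comment> \<open>The inequality says 2 gamma + 2 gamma / N < nu: the steps are so small that even
    the last one satisfies the hypothesis of \<open>gauss_poly_step\<close>.\<close>
  obtain N :: nat where N: "2 * \<gamma> / (\<nu> - 2 * \<gamma>) < real N" using reals_Archimedean2 by blast
  then have N0: "0 < real N" using \<gamma> by (smt (verit) divide_nonneg_pos mult_nonneg_nonneg)
  define \<delta> where "\<delta> = \<gamma> / real N"
  have \<delta>: "0 \<le> \<delta>" "2 * \<gamma> + 2 * \<delta> < \<nu>" "real N * \<delta> = \<gamma>"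
    using N N0 \<gamma> by (auto simp: \<delta>_def field_simps)
  have "i \<le> N \<Longrightarrow> l2_approx (gauss_measure \<nu>) (range (gauss_poly (real i * \<delta>))) g" for i
  proof (induction i)
    case 0
    then show ?case using polynomials_dense[OF \<nu> g] by simp
  next
    case (Suc i)
    have le: "real (Suc i) * \<delta> \<le> \<gamma>"
      using mult_right_mono[of "real (Suc i)" "real N" \<delta>] Suc.prems \<delta> by simp
    have i: "real (Suc i) * \<delta> = real i * \<delta> + \<delta>" by (simp add: algebra_simps)
    have L: "range (gauss_poly (real j * \<delta>)) \<subseteq> L2 (gauss_measure \<nu>)" if "j \<le> Suc i" for j
    proof -
      have "real j * \<delta> \<le> \<gamma>"
        using that le mult_right_mono[of "real j" "real (Suc i)" \<delta>] \<delta>(1) by simp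
      then show ?thesis using \<gamma> \<delta>(1) by (auto intro!: gauss_poly_L2)
    qed
    show ?case
    proof (rule l2_approx_trans[OF Suc.IH])
      fix f assume "f \<in> range (gauss_poly (real i * \<delta>))"
      then obtain q where f: "f = gauss_poly (real i * \<delta>) q" by blast
      \<comment> \<open>A step from x ends at x + \<delta>, at most gamma; its majorant needs only
        one further \<delta>.\<close>
      have "2 * (x + 2 * \<delta>) < \<nu>" if "x + \<delta> \<le> \<gamma>" for x
      proof -
        have "2 * (x + 2 * \<delta>) = 2 * (x + \<delta>) + 2 * \<delta>" by simp
        also have "\<dots> \<le> 2 * \<gamma> + 2 * \<delta>" using that by simp
        finally show ?thesis using \<delta>(2) by simp
      qed
      then have "2 * (real i * \<delta> + 2 * \<delta>) < \<nu>" using le unfolding i .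
      then show "l2_approx (gauss_measure \<nu>) (range (gauss_poly (real (Suc i) * \<delta>))) f"
        unfolding f i using \<delta>(1) by (intro gauss_poly_step) auto
    next
      show "range (gauss_poly (real i * \<delta>)) \<subseteq> L2 (gauss_measure \<nu>)"
        "range (gauss_poly (real (Suc i) * \<delta>)) \<subseteq> L2 (gauss_measure \<nu>)"
        by (rule L, simp)+
    qed (use Suc.prems fockD(2)[OF g] in auto)
  qed
  from this[of N] show ?thesis by (simp add: \<delta>(3))
qed

text \<open>The linear span, encoded by coefficients on an initial segment because
  \<open>orthonormal_basis\<close> asks for approximants of this shape.\<close>

definition finite_combination :: "(nat \<Rightarrow> 'a \<Rightarrow> complex) \<Rightarrow> ('a \<Rightarrow> complex) \<Rightarrow> bool" where
  "finite_combination e f \<longleftrightarrow> (\<exists>N c. f = (\<lambda>z. \<Sum>m<N. c m * e m z))"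

lemma finite_combination_unit: "finite_combination e (\<lambda>z. c * e m z)"
  unfolding finite_combination_def
proof (intro exI)
  show "(\<lambda>z. c * e m z) = (\<lambda>z. \<Sum>k<Suc m. (if k = m then c else 0) * e k z)"
    by (auto simp: fun_eq_iff if_distrib[of "\<lambda>x. x * _"] cong: if_cong)
qed

lemma finite_combination_add:
  assumes "finite_combination e f" "finite_combination e g"
  shows "finite_combination e (\<lambda>z. f z + g z)"
proof -
  obtain N c M d where f: "f = (\<lambda>z. \<Sum>m<N. c m * e m z)" and g: "g = (\<lambda>z. \<Sum>m<M. d m * e m z)"
    using assms unfolding finite_combination_def by blast
  let ?K = "max N M"
  have ext: "(\<Sum>m<n. b m * e m z) = (\<Sum>m<?K. (if m < n then b m else 0) * e m z)"
    if "n \<le> ?K" for n b z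
    using that by (intro sum.mono_neutral_cong_left) auto
  have "(\<lambda>z. f z + g z) = (\<lambda>z. \<Sum>m<?K. ((if m < N then c m else 0) + (if m < M then d m else 0)) * e m z)"
    unfolding f g by (simp only: ext[of N c] ext[of M d] max.cobounded1 max.cobounded2 distrib_right sum.distrib)
  then show ?thesis unfolding finite_combination_def by (intro exI)
qed

lemma finite_combination_sum:
  fixes N :: nat
  assumes "\<And>m. m < N \<Longrightarrow> finite_combination e (f m)"
  shows "finite_combination e (\<lambda>z. \<Sum>m<N. f m z)"
  using assms
proof (induction N)
  case 0
  show ?case unfolding finite_combination_def by (intro exI[of _ 0]) simp
next
  case (Suc N)
  then show ?case by (simp add: finite_combination_add)
qed

text \<open>\<open>pCons\<close> multiplies by z, and the recursion read backwards expresses z times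
  a Hermite polynomial through its two neighbours.\<close>

lemma poly_hermite_combination: "finite_combination hermite (poly q)"
proof (induction q)
  case 0
  show ?case unfolding finite_combination_def by (intro exI[of _ 0]) (simp add: fun_eq_iff)
next
  case (pCons a q)
  obtain N c where q: "poly q = (\<lambda>z. \<Sum>m<N. c m * hermite m z)"
    using pCons.IH unfolding finite_combination_def by blast
  have zH: "z * hermite m z = 1 / 2 * hermite (Suc m) z + of_nat m * hermite (m - 1) z" for m z
    by (simp add: hermite_Suc algebra_simps)
  have "z * poly q z = (\<Sum>m<N. c m * (z * hermite m z))" for z
    unfolding q sum_distrib_left by (intro sum.cong) (simp_all only: mult_ac)
  then have "poly (pCons a q) = (\<lambda>z. a * hermite 0 z + (\<Sum>m<N. (c m / 2) * hermite (Suc m) z + (c m * of_nat m) * hermite (m - 1) z))"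
    by (simp add: fun_eq_iff hermite_0 zH algebra_simps)
  then show ?case
    by (simp only:) (intro finite_combination_add finite_combination_sum finite_combination_unit)
qed

lemma hermite_fun_dense:
  assumes "0 \<le> \<gamma>" "2 * \<gamma> < \<nu>" "g \<in> fock_space \<nu> 0" "0 < \<epsilon>"
  shows "\<exists>N c. (LINT z|gauss_measure \<nu>. (norm (g z - (\<Sum>m<N. c m * hermite_fun \<gamma> m z)))\<^sup>2) < \<epsilon>"
proof -
  obtain q where q: "(LINT z|gauss_measure \<nu>. (norm (g z - gauss_poly \<gamma> q z))\<^sup>2) < \<epsilon>"
    using gauss_poly_dense[OF assms(1-3)] assms(4) unfolding l2_approx_def by blast
  obtain N c where "poly q = (\<lambda>z. \<Sum>m<N. c m * hermite m z)"
    using poly_hermite_combination[of q] unfolding finite_combination_def by blast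
  then have "gauss_poly \<gamma> q = (\<lambda>z. \<Sum>m<N. c m * hermite_fun \<gamma> m z)"
    by (simp add: gauss_poly_def hermite_fun_def fun_eq_iff sum_distrib_left mult_ac)
  then show ?thesis using q by auto
qed

subsection \<open>The transform\<close>

definition normalized_creation :: "real \<Rightarrow> nat \<Rightarrow> (complex \<Rightarrow> complex) \<Rightarrow> complex \<Rightarrow> complex" where
  "normalized_creation \<nu> n g z = of_real (1 / sqrt (\<nu> ^ n * fact n)) * (creation \<nu> ^^ n) g z"

lemma normalized_creation_linear:
  assumes "smooth f" "smooth g"
  shows "normalized_creation \<nu> n (\<lambda>z. a * f z + b * g z) =
    (\<lambda>z. a * normalized_creation \<nu> n f z + b * normalized_creation \<nu> n g z)"
  unfolding normalized_creation_def [abs_def] creation_funpow_linear[OF assms]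
  by (simp add: algebra_simps)

lemma normalized_creation_fock: "g \<in> fock_space \<nu> 0 \<Longrightarrow> normalized_creation \<nu> n g \<in> fock_space \<nu> n"
  unfolding normalized_creation_def [abs_def] by (intro fock_cmult creation_funpow_fock)

lemma l2_inner_normalized_creation:
  assumes "0 < \<nu>" "f \<in> fock_space \<nu> 0" "g \<in> fock_space \<nu> 0"
  shows "l2_inner (gauss_measure \<nu>) (normalized_creation \<nu> n f) (normalized_creation \<nu> n g) =
    l2_inner (gauss_measure \<nu>) f g"
proof -
  let ?K = "1 / sqrt (\<nu> ^ n * fact n)"
  have pos: "0 < \<nu> ^ n * fact n" using assms(1) by simp
  have "1 / sqrt x * (1 / sqrt x * x) = 1" if "0 < x" for x
    using that by simp
  from this[OF pos] have K: "?K * (?K * (\<nu> ^ n * fact n)) = 1" .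
  have "l2_inner (gauss_measure \<nu>) (normalized_creation \<nu> n f) (normalized_creation \<nu> n g) =
      of_real ?K * (of_real ?K * (of_real (\<nu> ^ n * fact n) * l2_inner (gauss_measure \<nu>) f g))"
    unfolding normalized_creation_def [abs_def] l2_inner_cmult_left l2_inner_cmult_right
      l2_inner_creation_funpow[OF assms(2,3)] complex_cnj_complex_of_real ..
  also have "\<dots> = of_real (?K * (?K * (\<nu> ^ n * fact n))) * l2_inner (gauss_measure \<nu>) f g"
    by (simp only: of_real_mult mult.assoc)
  finally show ?thesis unfolding K by simp
qed

lemma norm_normalized_creation:
  assumes "0 < \<nu>" "f \<in> fock_space \<nu> 0"
  shows "(LINT z|gauss_measure \<nu>. (norm (normalized_creation \<nu> n f z))\<^sup>2) = (LINT z|gauss_measure \<nu>. (norm (f z))\<^sup>2)"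
  using l2_inner_normalized_creation[OF assms assms(2), of n] unfolding l2_inner_self
  by (simp only: of_real_eq_iff)

lemma normalized_creation_bij:
  assumes \<nu>: "0 < \<nu>"
  shows "bij_betw (normalized_creation \<nu> n) (fock_space \<nu> 0) (fock_space \<nu> n)"
proof (rule bij_betw_imageI)
  show "inj_on (normalized_creation \<nu> n) (fock_space \<nu> 0)"
  proof (rule inj_onI)
    fix f g assume f: "f \<in> fock_space \<nu> 0" and g: "g \<in> fock_space \<nu> 0"
      and eq: "normalized_creation \<nu> n f = normalized_creation \<nu> n g"
    let ?h = "\<lambda>z. 1 * f z + (-1) * g z"
    have h: "?h \<in> fock_space \<nu> 0" by (intro fock_add fock_cmult f g)
    have "normalized_creation \<nu> n ?h = (\<lambda>_. 0)"
      using normalized_creation_linear[of f g \<nu> n 1 "-1"] fockD(1)[OF f] fockD(1)[OF g] eq by simp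
    then have "(LINT z|gauss_measure \<nu>. (norm (?h z))\<^sup>2) = 0"
      using norm_normalized_creation[OF \<nu> h, of n] by simp
    then have "?h = (\<lambda>_. 0)"
      using fockD[OF h] by (intro continuous_gauss_norm_zero smooth_continuous)
    then show "f = g" by (simp add: fun_eq_iff)
  qed
  show "normalized_creation \<nu> n ` fock_space \<nu> 0 = fock_space \<nu> n"
  proof (intro equalityI subsetI)
    fix F assume "F \<in> fock_space \<nu> n"
    then obtain g where g: "g \<in> fock_space \<nu> 0" "F = (creation \<nu> ^^ n) g"
      using creation_funpow_surj \<nu> by (metis less_irrefl)
    \<comment> \<open>This constant undoes the normalization; the zero summand below fits the
      two-term form of \<open>creation_funpow_linear\<close>.\<close>
    let ?c = "of_real (sqrt (\<nu> ^ n * fact n)) :: complex"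
    have "smooth g" using g fockD by blast
    then have "(creation \<nu> ^^ n) (\<lambda>z. ?c * g z + 0 * g z) = (\<lambda>z. ?c * (creation \<nu> ^^ n) g z + 0 * (creation \<nu> ^^ n) g z)"
      by (intro creation_funpow_linear)
    then have "F = normalized_creation \<nu> n (\<lambda>z. ?c * g z)"
      using g \<nu> by (simp add: normalized_creation_def fun_eq_iff)
    then show "F \<in> normalized_creation \<nu> n ` fock_space \<nu> 0"
      using fock_cmult[OF g(1)] by blast
  qed (auto intro: normalized_creation_fock)
qed

text \<open>Smoothness is proved in the same induction because linearity is available only for
  smooth arguments.\<close>

lemma normalized_creation_sum:
  fixes N :: nat
  assumes "smooth g" "\<And>m. smooth (e m)"
  shows "normalized_creation \<nu> n (\<lambda>z. g z - (\<Sum>m<N. c m * e m z)) =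
      (\<lambda>z. normalized_creation \<nu> n g z - (\<Sum>m<N. c m * normalized_creation \<nu> n (e m) z))
    \<and> smooth (\<lambda>z. g z - (\<Sum>m<N. c m * e m z))"
proof (induction N)
  case 0
  then show ?case using assms by simp
next
  case (Suc N)
  have eq: "(\<lambda>z. g z - (\<Sum>m<Suc N. c m * e m z)) =
      (\<lambda>z. 1 * (g z - (\<Sum>m<N. c m * e m z)) + (- c N) * e N z)"
    by (simp add: fun_eq_iff)
  have sm: "smooth (\<lambda>z. g z - (\<Sum>m<N. c m * e m z))" using Suc by blast
  show ?case
    unfolding eq normalized_creation_linear[OF sm assms(2)] Suc[THEN conjunct1]
    by (intro conjI smooth_add smooth_cmult sm assms(2)) (simp add: fun_eq_iff)
qed

subsection \<open>The isometry with the Fock space\<close>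

text \<open>With a = alpha this is the isometry onto the Gaussian side, with - alpha its inverse;
  with - gamma it intertwines \<open>creation\<close> and \<open>nabla\<close>.\<close>

definition chirp :: "real \<Rightarrow> (complex \<Rightarrow> complex) \<Rightarrow> complex \<Rightarrow> complex" where
  "chirp a f z = exp (of_real a * z\<^sup>2) * f z"

lemma chirp_chirp: "chirp a (chirp b f) = chirp (a + b) f"
  by (simp add: fun_eq_iff chirp_def exp_add[symmetric] mult.assoc[symmetric] distrib_right)

lemma chirp_0: "chirp 0 f = f"
  by (simp add: fun_eq_iff chirp_def)

lemma chirp_cancel: "chirp a (chirp (- a) f) = f" "chirp (- a) (chirp a f) = f"
  by (simp_all add: chirp_chirp chirp_0)

lemma chirp_linear: "chirp a (\<lambda>z. b * f z + c * g z) = (\<lambda>z. b * chirp a f z + c * chirp a g z)"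
  by (simp add: fun_eq_iff chirp_def algebra_simps)

lemma chirp_holomorphic: "f holomorphic_on UNIV \<Longrightarrow> chirp a f holomorphic_on UNIV"
  unfolding chirp_def [abs_def] by (intro holomorphic_intros)

lemma chirp_measurable:
  assumes "f \<in> borel_measurable borel"
  shows "chirp a f \<in> borel_measurable borel"
proof -
  have "(\<lambda>z. exp (of_real a * z\<^sup>2) :: complex) \<in> borel_measurable borel"
    by (intro borel_measurable_continuous_onI continuous_intros)
  then show ?thesis
    unfolding chirp_def [abs_def] using assms by (rule borel_measurable_times)
qed

text \<open>The weight factors as the Gaussian times |exp(alpha z^2)|^2, because alpha z^2 and its
  conjugate add up to twice the real part.\<close>

lemma omega_eq: "omega s z = exp (- nu s * (norm z)\<^sup>2) * (norm (exp (of_real (alpha s) * z\<^sup>2)))\<^sup>2"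
proof -
  have "Re (of_real (alpha s) * (z\<^sup>2 + (cnj z)\<^sup>2)) = 2 * Re (of_real (alpha s) * z\<^sup>2)"
    by (simp add: power2_eq_square algebra_simps)
  then show ?thesis
    unfolding omega_def norm_exp_eq_Re exp_double[symmetric] exp_add[symmetric] by simp
qed

lemma omega_measurable: "omega s \<in> borel_measurable borel"
  unfolding omega_def [abs_def] by (intro borel_measurable_continuous_onI continuous_intros)

lemma borel_measurable_omega:
  "borel_measurable (omega_measure s) = (borel_measurable borel :: (complex \<Rightarrow> 'b::topological_space) set)"
  by (simp add: omega_measure_def cong: measurable_cong_sets)

lemma L2_omega_iff: "f \<in> L2 (omega_measure s) \<longleftrightarrow> chirp (alpha s) f \<in> L2 (gauss_measure (nu s))"
proof (cases "f \<in> borel_measurable borel")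
  case True
  have "integrable (omega_measure s) (\<lambda>z. (norm (f z))\<^sup>2) \<longleftrightarrow>
      integrable lborel (\<lambda>z. omega s z *\<^sub>R (norm (f z))\<^sup>2)"
    unfolding omega_measure_def using True omega_measurable
    by (intro integrable_density) (auto simp: omega_eq)
  also have "(\<lambda>z. omega s z *\<^sub>R (norm (f z))\<^sup>2) =
      (\<lambda>z. exp (- nu s * (norm z)\<^sup>2) *\<^sub>R (norm (chirp (alpha s) f z))\<^sup>2)"
    by (simp add: fun_eq_iff omega_eq chirp_def norm_mult power_mult_distrib)
  also have "integrable lborel \<dots> \<longleftrightarrow> integrable (gauss_measure (nu s)) (\<lambda>z. (norm (chirp (alpha s) f z))\<^sup>2)"
    using chirp_measurable[OF True] by (subst gauss_integrable_iff) auto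
  finally show ?thesis
    using True chirp_measurable[OF True, of "alpha s"]
    by (simp add: L2_def borel_measurable_omega borel_measurable_gauss)
next
  case False
  \<comment> \<open>Both sides are false: measurability would be carried back by the inverse
    chirp.\<close>
  then have "chirp (alpha s) f \<notin> borel_measurable borel"
    using chirp_measurable[of "chirp (alpha s) f" "- alpha s"] by (auto simp: chirp_cancel)
  then show ?thesis
    using False by (simp add: L2_def borel_measurable_omega borel_measurable_gauss)
qed

lemma l2_inner_omega:
  assumes f: "f \<in> borel_measurable borel" and g: "g \<in> borel_measurable borel"
  shows "l2_inner (omega_measure s) f g =
    l2_inner (gauss_measure (nu s)) (chirp (alpha s) f) (chirp (alpha s) g)"
proof -
  have cnjm: "(\<lambda>z. cnj (h z)) \<in> borel_measurable borel" if "h \<in> borel_measurable borel" for h :: "complex \<Rightarrow> complex"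
    using that by (rule measurable_compose[OF _ borel_measurable_continuous_onI[OF continuous_on_cnj[OF continuous_on_id]]])
  have "l2_inner (omega_measure s) f g = (LINT z|lborel. omega s z *\<^sub>R (f z * cnj (g z)))"
    unfolding l2_inner_def omega_measure_def
    using f cnjm[OF g] omega_measurable by (intro integral_density) (auto simp: omega_eq)
  also have "(\<lambda>z. omega s z *\<^sub>R (f z * cnj (g z))) =
      (\<lambda>z. exp (- nu s * (norm z)\<^sup>2) *\<^sub>R (chirp (alpha s) f z * cnj (chirp (alpha s) g z)))"
  proof
    fix z :: complex
    let ?E = "exp (of_real (alpha s) * z\<^sup>2)"
    have "of_real ((norm ?E)\<^sup>2) = ?E * cnj ?E" by (rule complex_norm_square)
    then have "omega s z *\<^sub>R (f z * cnj (g z)) = of_real (exp (- nu s * (norm z)\<^sup>2)) * (?E * cnj ?E) * (f z * cnj (g z))"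
      by (simp only: omega_eq scaleR_conv_of_real of_real_mult)
    then show "omega s z *\<^sub>R (f z * cnj (g z)) = exp (- nu s * (norm z)\<^sup>2) *\<^sub>R (chirp (alpha s) f z * cnj (chirp (alpha s) g z))"
      by (simp only: scaleR_conv_of_real chirp_def complex_cnj_mult mult_ac)
  qed
  also have "(LINT z|lborel. \<dots> z) = (LINT z|gauss_measure (nu s). chirp (alpha s) f z * cnj (chirp (alpha s) g z))"
    using chirp_measurable[OF f, of "alpha s"] cnjm[OF chirp_measurable[OF g, of "alpha s"]]
    by (intro gauss_integral[symmetric] borel_measurable_times)
  finally show ?thesis by (simp add: l2_inner_def)
qed

lemma l2_norm_omega:
  assumes "f \<in> borel_measurable borel"
  shows "l2_norm (omega_measure s) f = l2_norm (gauss_measure (nu s)) (chirp (alpha s) f)"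
  using l2_inner_omega[OF assms assms, of s] unfolding l2_inner_self l2_norm_def
  by (simp only: of_real_eq_iff)

lemma X_space_iff: "f \<in> X_space s \<longleftrightarrow> chirp (alpha s) f \<in> fock_space (nu s) 0"
proof -
  have "f holomorphic_on UNIV \<longleftrightarrow> chirp (alpha s) f holomorphic_on UNIV"
    using chirp_holomorphic[of f "alpha s"] chirp_holomorphic[of "chirp (alpha s) f" "- alpha s"]
    by (auto simp: chirp_cancel)
  then show ?thesis by (simp add: X_space_def fock_0_iff L2_omega_iff)
qed

lemma Xn_space_iff: "f \<in> Xn_space n s \<longleftrightarrow> chirp (alpha s) f \<in> fock_space (nu s) n"
proof -
  have "Xn_space n s = chirp (- alpha s) ` fock_space (nu s) n"
    by (auto simp: Xn_space_def chirp_def fun_eq_iff image_def)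
  also have "f \<in> \<dots> \<longleftrightarrow> chirp (alpha s) f \<in> fock_space (nu s) n"
    by (metis (no_types, lifting) chirp_cancel image_iff)
  finally show ?thesis .
qed

lemma fock_measurable: "chirp a f \<in> fock_space \<nu> n \<Longrightarrow> f \<in> borel_measurable borel"
  using chirp_measurable[of "chirp a f" "- a"] fockD(1)[of "chirp a f" \<nu> n]
  by (simp add: chirp_cancel borel_measurable_continuous_onI smooth_continuous)

lemma W_integrand_eq: "W_integrand s n f z \<xi> = fock_kernel (nu s) n z \<xi> * chirp (alpha s) f \<xi>"
proof -
  have "exp (a + b + c) = exp (a + c) * exp b" for a b c :: complex
    by (simp add: exp_add mult_ac)
  then show ?thesis by (simp only: W_integrand_def fock_kernel_def chirp_def mult_ac)
qed

text \<open>The prefactor of \<open>W_op\<close> times the constant of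
  \<open>fock_kernel_integral\<close> is exactly the normalization that makes the power of the
  creation operator isometric.\<close>

lemma W_op_eq:
  assumes \<nu>: "0 < nu s" and f: "f \<in> X_space s"
  shows "W_op s n f = chirp (- alpha s) (normalized_creation (nu s) n (chirp (alpha s) f))"
proof
  fix z
  let ?\<nu> = "nu s" and ?g = "chirp (alpha s) f"
  have g: "?g holomorphic_on UNIV" "?g \<in> L2 (gauss_measure ?\<nu>)"
    using f unfolding X_space_iff fock_0_iff by auto
  have c: "?\<nu> / pi * sqrt (?\<nu> ^ n / fact n) * (pi / ?\<nu> ^ Suc n) = 1 / sqrt (?\<nu> ^ n * fact n)"
  proof -
    have "sqrt (?\<nu> ^ n / fact n) * sqrt (?\<nu> ^ n * fact n) = sqrt (?\<nu> ^ n * ?\<nu> ^ n)"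
      by (simp add: real_sqrt_mult[symmetric])
    also have "\<dots> = ?\<nu> ^ n" using \<nu> by simp
    finally have "sqrt (?\<nu> ^ n / fact n) / ?\<nu> ^ n = 1 / sqrt (?\<nu> ^ n * fact n)"
      using \<nu> by (simp add: field_simps)
    moreover have "?\<nu> / pi * sqrt (?\<nu> ^ n / fact n) * (pi / ?\<nu> ^ Suc n) = sqrt (?\<nu> ^ n / fact n) / ?\<nu> ^ n"
      using \<nu> by simp
    ultimately show ?thesis by simp
  qed
  have "W_op s n f z = of_real (?\<nu> / pi * sqrt (?\<nu> ^ n / fact n)) * exp (- of_real (alpha s) * z\<^sup>2) *
      (of_real (pi / ?\<nu> ^ Suc n) * (creation ?\<nu> ^^ n) ?g z)"
    unfolding W_op_def W_integrand_eq fock_kernel_integral(2)[OF \<nu> g] ..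
  also have "\<dots> = exp (- of_real (alpha s) * z\<^sup>2) *
      (of_real (?\<nu> / pi * sqrt (?\<nu> ^ n / fact n) * (pi / ?\<nu> ^ Suc n)) * (creation ?\<nu> ^^ n) ?g z)"
    by (simp only: of_real_mult mult_ac)
  also have "\<dots> = chirp (- alpha s) (normalized_creation ?\<nu> n ?g) z"
    unfolding c by (simp add: chirp_def normalized_creation_def)
  finally show "W_op s n f z = chirp (- alpha s) (normalized_creation ?\<nu> n ?g) z" .
qed

lemma W_op_unitary:
  assumes \<nu>: "0 < nu s"
  shows "unitary_onto (omega_measure s) (X_space s) (Xn_space n s) (W_op s n)"
  unfolding unitary_onto_def
proof (intro conjI allI ballI)
  fix a b f g assume f: "f \<in> X_space s" and g: "g \<in> X_space s"
  note F = f[unfolded X_space_iff] and G = g[unfolded X_space_iff]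
  have h: "(\<lambda>z. a * f z + b * g z) \<in> X_space s"
    unfolding X_space_iff chirp_linear by (intro fock_add fock_cmult F G)
  show "W_op s n (\<lambda>z. a * f z + b * g z) = (\<lambda>z. a * W_op s n f z + b * W_op s n g z)"
    unfolding W_op_eq[OF \<nu> h] W_op_eq[OF \<nu> f] W_op_eq[OF \<nu> g] chirp_linear
      normalized_creation_linear[OF fockD(1)[OF F] fockD(1)[OF G]] ..
next
  fix f g assume f: "f \<in> X_space s" and g: "g \<in> X_space s"
  note F = f[unfolded X_space_iff] and G = g[unfolded X_space_iff]
  have W: "chirp (alpha s) (W_op s n h) = normalized_creation (nu s) n (chirp (alpha s) h)"
    "W_op s n h \<in> borel_measurable borel" if h: "h \<in> X_space s" for h
  proof -
    show *: "chirp (alpha s) (W_op s n h) = normalized_creation (nu s) n (chirp (alpha s) h)"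
      unfolding W_op_eq[OF \<nu> h] by (rule chirp_cancel)
    show "W_op s n h \<in> borel_measurable borel"
      by (rule fock_measurable[of "alpha s" _ "nu s" n]) (use h * in \<open>auto simp: X_space_iff intro: normalized_creation_fock\<close>)
  qed
  show "l2_inner (omega_measure s) (W_op s n f) (W_op s n g) = l2_inner (omega_measure s) f g"
    by (simp only: l2_inner_omega[OF W(2)[OF f] W(2)[OF g]] l2_inner_omega[OF fock_measurable[OF F] fock_measurable[OF G]]
        W(1)[OF f] W(1)[OF g] l2_inner_normalized_creation[OF \<nu> F G])
next
  have b1: "bij_betw (chirp (alpha s)) (X_space s) (fock_space (nu s) 0)"
    by (rule bij_betw_byWitness[where f' = "chirp (- alpha s)"]) (auto simp: chirp_cancel X_space_iff)
  have b2: "bij_betw (chirp (- alpha s)) (fock_space (nu s) n) (Xn_space n s)"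
    by (rule bij_betw_byWitness[where f' = "chirp (alpha s)"]) (auto simp: chirp_cancel Xn_space_iff)
  have "bij_betw (chirp (- alpha s) \<circ> (normalized_creation (nu s) n \<circ> chirp (alpha s))) (X_space s) (Xn_space n s)"
    by (rule bij_betw_trans[OF bij_betw_trans[OF b1 normalized_creation_bij[OF \<nu>]] b2])
  \<comment> \<open>The formula for \<open>W_op\<close> is available only on
    \<open>X_space s\<close>, hence a congruence on that set.\<close>
  then show "bij_betw (W_op s n) (X_space s) (Xn_space n s)"
    by (rule bij_betw_cong[THEN iffD1, rotated]) (simp add: W_op_eq[OF \<nu>])
qed

section \<open>The basis functions and their normalization\<close>

lemma nabla_chirp:
  assumes U: "smooth U"
  shows "nabla \<nu> \<gamma> (chirp (- \<gamma>) U) = chirp (- \<gamma>) (creation \<nu> U)"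
proof
  fix z :: complex
  have "((\<lambda>z. exp (of_real (- \<gamma>) * z\<^sup>2)) has_field_derivative exp (of_real (- \<gamma>) * z\<^sup>2) * (of_real (- \<gamma>) * (2 * z))) (at z)"
    by (auto intro!: derivative_eq_intros)
  from has_wirt_mult[OF has_wirt_holomorphic[OF this] smooth_has_wirt[OF U, of z]]
  have "wirt (chirp (- \<gamma>) U) z = exp (of_real (- \<gamma>) * z\<^sup>2) * (of_real (- \<gamma>) * (2 * z)) * U z + exp (of_real (- \<gamma>) * z\<^sup>2) * wirt U z"
    unfolding chirp_def [abs_def] by (rule has_wirtD(1))
  \<comment> \<open>Differentiating the exponential contributes + 2 gamma z, which cancels the last
    term of \<open>nabla\<close>.\<close>
  then show "nabla \<nu> \<gamma> (chirp (- \<gamma>) U) z = chirp (- \<gamma>) (creation \<nu> U) z"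
    unfolding nabla_def by (simp add: chirp_def creation_def algebra_simps)
qed

lemma nabla_funpow_chirp:
  assumes U: "smooth U"
  shows "(nabla \<nu> \<gamma> ^^ n) (chirp (- \<gamma>) U) = chirp (- \<gamma>) ((creation \<nu> ^^ n) U)"
  by (induction n) (simp_all add: nabla_chirp creation_funpow_smooth[OF U])

lemma hermite_fun_chirp: "hermite_fun \<gamma> m = chirp \<gamma> (hermite m)"
  by (simp add: fun_eq_iff hermite_fun_def chirp_def)

text \<open>The part of the normalization of \<open>psi\<close> that does not depend on n; the rest,
  1 / sqrt(nu^n n!), belongs to \<open>normalized_creation\<close>.\<close>

definition basis_factor :: "real \<Rightarrow> nat \<Rightarrow> real" where
  "basis_factor s m = sqrt ((1 - s) / (pi * sqrt s)) * ((1 - s) / (1 + s)) powr (real m / 2) / sqrt (2 ^ m * fact m)"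

text \<open>The exponents alpha, - 1/2 and - gamma add up to zero, so only the creation operators
  acting on \<open>hermite_fun\<close> survive. Thus all n are images of the case n = 0.\<close>

lemma psi_eq:
  fixes s :: real
  assumes s: "0 < s" "s < 1"
  shows "chirp (alpha s) (psi s m n) =
    (\<lambda>z. of_real (basis_factor s m) * normalized_creation (nu s) n (hermite_fun (alpha s - 1 / 2) m) z)"
proof
  fix z :: complex
  let ?\<gamma> = "alpha s - 1 / 2" and ?\<nu> = "nu s"
  let ?D = "(creation ?\<nu> ^^ n) (hermite_fun ?\<gamma> m) z"
  have "hermite m = chirp (- ?\<gamma>) (hermite_fun ?\<gamma> m)"
    unfolding hermite_fun_chirp chirp_cancel ..
  then have nab: "(nabla ?\<nu> ?\<gamma> ^^ n) (hermite m) z = exp (of_real (- ?\<gamma>) * z\<^sup>2) * ?D"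
    using nabla_funpow_chirp[OF smooth_holomorphic[OF hermite_fun_holomorphic[of ?\<gamma> m]], of n ?\<nu> ?\<gamma>]
    by (simp only: chirp_def)
  have e: "exp (of_real (alpha s) * z\<^sup>2) * (exp (- z\<^sup>2 / 2) * exp (of_real (- ?\<gamma>) * z\<^sup>2)) = 1"
    unfolding exp_add[symmetric] by (simp add: algebra_simps)
  have A: "sqrt ((1 - s) / (pi * ?\<nu> ^ n * fact n * sqrt s)) = sqrt ((1 - s) / (pi * sqrt s)) * (1 / sqrt (?\<nu> ^ n * fact n))"
    by (simp add: real_sqrt_mult[symmetric] real_sqrt_divide[symmetric] mult_ac)
  have "chirp (alpha s) (psi s m n) z =
      exp (of_real (alpha s) * z\<^sup>2) * (exp (- z\<^sup>2 / 2) * exp (of_real (- ?\<gamma>) * z\<^sup>2)) *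
      (of_real (sqrt ((1 - s) / (pi * ?\<nu> ^ n * fact n * sqrt s)) * ((1 - s) / (1 + s)) powr (real m / 2) / sqrt (2 ^ m * fact m)) * ?D)"
  proof -
    have "x * (of_real (a * r) * (y / of_real b) * (w * D)) = (x * (y * w)) * (of_real (a * r / b) * D)"
      for x y w D :: complex and a b r :: real
      by simp
    then show ?thesis unfolding chirp_def psi_def nab .
  qed
  also have "\<dots> = of_real (basis_factor s m) * normalized_creation ?\<nu> n (hermite_fun ?\<gamma> m) z"
  proof -
    have "1 * (of_real (p * (1 / q) * r / b) * D) = of_real (p * r / b) * (of_real (1 / q) * D)"
      for D :: complex and p q r b :: real
      by simp
    then show ?thesis unfolding e A basis_factor_def normalized_creation_def .
  qed
  finally show "chirp (alpha s) (psi s m n) z = of_real (basis_factor s m) * normalized_creation ?\<nu> n (hermite_fun ?\<gamma> m) z" .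
qed

text \<open>Everything follows from nu = (1 - s)(1 + s)/(2 s), gamma = (1 - s)^2/(4 s) and 1 + gamma
  = (1 + s)^2/(4 s). In particular nu - 2 gamma = 1 - s and nu + 2 gamma = (1 - s)/s.\<close>

lemma parameter_facts:
  fixes s :: real
  assumes s: "0 < s" "s < 1"
  shows "0 < nu s" "0 \<le> alpha s - 1 / 2" "2 * (alpha s - 1 / 2) < nu s"
    "(nu s)\<^sup>2 = 4 * (alpha s - 1 / 2) * (1 + (alpha s - 1 / 2))"
    "4 * (1 + (alpha s - 1 / 2)) / nu s = 2 * ((1 + s) / (1 - s))"
    "sqrt ((nu s)\<^sup>2 - 4 * (alpha s - 1 / 2)\<^sup>2) = (1 - s) / sqrt s"
proof -
  have n: "nu s = (1 - s) * (1 + s) / (2 * s)" by (simp add: nu_def power2_eq_square algebra_simps)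
  have g: "alpha s - 1 / 2 = (1 - s)\<^sup>2 / (4 * s)"
    using s by (simp add: alpha_def power2_eq_square field_simps)
  have g1: "1 + (alpha s - 1 / 2) = (1 + s)\<^sup>2 / (4 * s)"
    using s by (simp add: alpha_def power2_eq_square field_simps)
  show "0 < nu s" "0 \<le> alpha s - 1 / 2" using s unfolding n g by auto
  have "nu s - 2 * (alpha s - 1 / 2) = 1 - s"
    using s unfolding n g by (simp add: power2_eq_square field_simps)
  then show "2 * (alpha s - 1 / 2) < nu s" using s by linarith
  show "(nu s)\<^sup>2 = 4 * (alpha s - 1 / 2) * (1 + (alpha s - 1 / 2))"
  proof -
    have "(q * t / (2 * s))\<^sup>2 = 4 * (q\<^sup>2 / (4 * s)) * (t\<^sup>2 / (4 * s))" for q t :: real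
      by (simp add: power2_eq_square mult_ac)
    then show ?thesis unfolding n g1 unfolding g .
  qed
  show "4 * (1 + (alpha s - 1 / 2)) / nu s = 2 * ((1 + s) / (1 - s))"
  proof -
    have "4 * (t\<^sup>2 / (4 * s)) / (q * t / (2 * s)) = 2 * (t / q)" if "q \<noteq> 0" "t \<noteq> 0" for q t :: real
      using that s by (simp add: power2_eq_square)
    then show ?thesis unfolding n g1 using s by simp
  qed
  have "(nu s)\<^sup>2 - 4 * (alpha s - 1 / 2)\<^sup>2 = ((1 - s) / sqrt s)\<^sup>2"
    using s unfolding n g by (simp add: power_divide power2_eq_square field_simps)
  then show "sqrt ((nu s)\<^sup>2 - 4 * (alpha s - 1 / 2)\<^sup>2) = (1 - s) / sqrt s"
    using s by simp
qed

text \<open>The bracket is the squared norm of \<open>hermite_fun\<close> from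
  \<open>hermite_fun_inner\<close>, rewritten in s; \<open>basis_factor\<close> is the reciprocal of
  that norm.\<close>

lemma basis_factor_norm:
  fixes s :: real
  assumes s: "0 < s" "s < 1"
  shows "basis_factor s m * basis_factor s m * ((2 * ((1 + s) / (1 - s))) ^ m * fact m * (pi / ((1 - s) / sqrt s))) = 1"
    and "basis_factor s m \<noteq> 0"
proof -
  let ?r = "(1 - s) / (1 + s)"
  have r: "0 < ?r" using s by simp
  have "?r powr (real m / 2) * ?r powr (real m / 2) = ?r ^ m"
    using r by (simp add: powr_add[symmetric] powr_realpow)
  moreover have "basis_factor s m * basis_factor s m =
      (sqrt ((1 - s) / (pi * sqrt s)) * sqrt ((1 - s) / (pi * sqrt s))) *
      (?r powr (real m / 2) * ?r powr (real m / 2)) / (sqrt (2 ^ m * fact m) * sqrt (2 ^ m * fact m))"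
    by (simp add: basis_factor_def mult_ac del: real_sqrt_mult_self)
  ultimately have "basis_factor s m * basis_factor s m = (1 - s) / (pi * sqrt s) * ?r ^ m / (2 ^ m * fact m)"
    using s by simp
  moreover have "(2 * ((1 + s) / (1 - s))) ^ m = 2 ^ m / ?r ^ m"
    unfolding power_mult_distrib by (simp add: power_divide)
  ultimately show "basis_factor s m * basis_factor s m * ((2 * ((1 + s) / (1 - s))) ^ m * fact m * (pi / ((1 - s) / sqrt s))) = 1"
    using s r by simp
  then show "basis_factor s m \<noteq> 0" by auto
qed

lemma psi_orthonormal_basis:
  fixes s :: real
  assumes s: "0 < s" "s < 1"
  shows "orthonormal_basis (omega_measure s) (Xn_space n s) (\<lambda>m. psi s m n)"
  unfolding orthonormal_basis_def
proof (intro conjI allI ballI impI)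
  let ?\<gamma> = "alpha s - 1 / 2" and ?\<nu> = "nu s"
  let ?M = "gauss_measure ?\<nu>"
  let ?f = "hermite_fun ?\<gamma>"
  let ?k = "\<lambda>m. complex_of_real (basis_factor s m)"
  note P = parameter_facts[OF s]
  have f: "?f m \<in> fock_space ?\<nu> 0" for m
    unfolding fock_0_iff using hermite_fun_holomorphic hermite_fun_L2[OF P(2,3)] by blast
  have psi_fock: "chirp (alpha s) (psi s m n) \<in> fock_space ?\<nu> n" for m
    unfolding psi_eq[OF s] by (intro fock_cmult normalized_creation_fock f)
  show "psi s m n \<in> Xn_space n s" for m
    unfolding Xn_space_iff by (rule psi_fock)
  fix j k
  have "l2_inner (omega_measure s) (psi s j n) (psi s k n) =
      ?k j * (?k k * l2_inner ?M (?f j) (?f k))"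
    unfolding l2_inner_omega[OF fock_measurable[OF psi_fock] fock_measurable[OF psi_fock]] psi_eq[OF s]
      l2_inner_cmult_left l2_inner_cmult_right l2_inner_normalized_creation[OF P(1) f f]
    by simp
  also have "\<dots> = (if j = k then 1 else 0)"
  proof (cases "j = k")
    case True
    have "?k j * (?k k * l2_inner ?M (?f j) (?f k)) =
        of_real (basis_factor s k * basis_factor s k * ((2 * ((1 + s) / (1 - s))) ^ k * fact k * (pi / ((1 - s) / sqrt s))))"
      unfolding hermite_fun_inner[OF P(2-4)] P(5,6) True by (simp only: if_True refl of_real_mult mult.assoc)
    then show ?thesis unfolding basis_factor_norm(1)[OF s] using True by simp
  next
    case False
    then show ?thesis unfolding hermite_fun_inner[OF P(2-4)] by simp
  qed
  finally show "l2_inner (omega_measure s) (psi s j n) (psi s k n) = (if j = k then 1 else 0)" .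
next
  let ?\<gamma> = "alpha s - 1 / 2" and ?\<nu> = "nu s"
  let ?M = "gauss_measure ?\<nu>"
  let ?f = "hermite_fun ?\<gamma>"
  let ?k = "\<lambda>m. complex_of_real (basis_factor s m)"
  note P = parameter_facts[OF s]
  have f: "?f m \<in> fock_space ?\<nu> 0" for m
    unfolding fock_0_iff using hermite_fun_holomorphic hermite_fun_L2[OF P(2,3)] by blast
  fix h and \<epsilon> :: real assume h: "h \<in> Xn_space n s" and \<epsilon>: "0 < \<epsilon>"
  \<comment> \<open>Surjectivity on the Fock side pulls the approximation problem back to level
    0.\<close>
  obtain g where g: "g \<in> fock_space ?\<nu> 0" "chirp (alpha s) h = normalized_creation ?\<nu> n g"
    using h normalized_creation_bij[OF P(1), of n] unfolding Xn_space_iff bij_betw_def by blast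
  \<comment> \<open>The error is squared since density was proved for squared norms.\<close>
  obtain N c where c: "(LINT z|?M. (norm (g z - (\<Sum>m<N. c m * ?f m z)))\<^sup>2) < \<epsilon>\<^sup>2"
    using hermite_fun_dense[OF P(2,3) g(1), of "\<epsilon>\<^sup>2"] \<epsilon> by auto
  let ?u = "\<lambda>z. g z - (\<Sum>m<N. c m * ?f m z)"
  \<comment> \<open>Dividing by the nonzero \<open>?k m\<close> turns coefficients for the
    unnormalized Hermite functions into coefficients for \<open>psi\<close>.\<close>
  let ?d = "\<lambda>z. h z - (\<Sum>m<N. c m / ?k m * psi s m n z)"
  have u: "?u \<in> fock_space ?\<nu> 0"
    using g(1) f unfolding fock_0_iff by (auto intro!: holomorphic_intros L2_diff L2_sum L2_cmult)
  have "chirp (alpha s) ?d = (\<lambda>z. chirp (alpha s) h z - (\<Sum>m<N. c m / ?k m * chirp (alpha s) (psi s m n) z))"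
    by (simp add: fun_eq_iff chirp_def algebra_simps sum_distrib_left)
  also have "\<dots> = (\<lambda>z. normalized_creation ?\<nu> n g z - (\<Sum>m<N. c m * normalized_creation ?\<nu> n (?f m) z))"
    unfolding g(2) psi_eq[OF s] using basis_factor_norm(2)[OF s] by simp
  also have "\<dots> = normalized_creation ?\<nu> n ?u"
    by (rule normalized_creation_sum[OF fockD(1)[OF g(1)] fockD(1)[OF f], THEN conjunct1, symmetric])
  finally have d: "chirp (alpha s) ?d = normalized_creation ?\<nu> n ?u" .
  have dm: "?d \<in> borel_measurable borel"
    by (rule fock_measurable[of "alpha s" _ ?\<nu> n]) (unfold d, rule normalized_creation_fock[OF u])
  have "l2_norm (omega_measure s) ?d < \<epsilon>"
    unfolding l2_norm_omega[OF dm] d l2_norm_less_iff[OF \<epsilon>] norm_normalized_creation[OF P(1) u] by (rule c)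
  then show "\<exists>N c. l2_norm (omega_measure s) (\<lambda>z. h z - (\<Sum>m<N. c m * psi s m n z)) < \<epsilon>"
    by (intro exI[of _ N] exI[of _ "\<lambda>m. c m / ?k m"])
qed

text \<open>The integrability clause certifies that the integral in \<open>W_op\<close> is genuine,
  since the Bochner integral of a function that is not integrable has the default value 0.\<close>

theorem theorem3p1:
  fixes s :: real and n :: nat
  assumes "0 < s" and "s < 1"
  shows "(\<forall>f\<in>X_space s. \<forall>z. integrable lborel (W_integrand s n f z)) \<and>
         unitary_onto (omega_measure s) (X_space s) (Xn_space n s) (W_op s n) \<and>
         orthonormal_basis (omega_measure s) (Xn_space n s) (\<lambda>m. psi s m n)"
proof (intro conjI ballI allI)
  have \<nu>: "0 < nu s" using parameter_facts[OF assms] by blast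
  show "integrable lborel (W_integrand s n f z)" if "f \<in> X_space s" for f z
    unfolding W_integrand_eq [abs_def]
    using that fock_kernel_integral(1)[OF \<nu>] unfolding X_space_iff fock_0_iff by blast
  show "unitary_onto (omega_measure s) (X_space s) (Xn_space n s) (W_op s n)"
    by (rule W_op_unitary[OF \<nu>])
  show "orthonormal_basis (omega_measure s) (Xn_space n s) (\<lambda>m. psi s m n)"
    by (rule psi_orthonormal_basis[OF assms])
qed

end
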